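(* Suppose that $(R,\Delta,\mathfrak a_\bullet)$ is a triple and $P$ is a center of sharp $F$-purity for $(R,\Delta,\mathfrak a_\bullet)$ that is maximal (as an ideal), with respect to ideal containment, among the centers of sharp $F$-purity for $(R,\Delta,\mathfrak a_\bullet)$. Then $R/P$ is strongly $F$-regular.
   Context: All rings are commutative, noetherian, excellent, of prime characteristic $p>0$ and $F$-finite (finite as modules over themselves via Frobenius). $F^e_*M$ denotes $M$ viewed as an $R$-module via the $e$-iterated Frobenius. $R^\circ$ is the set of elements of $R$ in no minimal prime. A graded system of ideals $\mathfrak a_\bullet=\{\mathfrak a_i\}_{i\ge 0}$ satisfies $\mathfrak a_i\mathfrak a_j\subseteq\mathfrak a_{i+j}$. A triple $(R,\Delta,\mathfrak a_\bullet)$ consists of a reduced ring $R$, an effective $\mathbb R$-(Weil) divisor $\Delta$ on $\operatorname{Spec}R$, and a graded system of ideals of $R$ such that: $R$ is a normal domain if $\Delta\ne0$; $\mathfrak a_0=R$; $\mathfrak a_i\cap R^\circ\neq\emptyset$ for all $i$. $R(D)$ denotes the global sections of $\mathcal O_{\operatorname{Spec}R}(D)$ (and $R(0)=R$). A prime $P\in\operatorname{Spec}R$ is a center of sharp $F$-purity for $(R,\Delta,\mathfrak a_\bullet)$ if for every $f\in PR_P$, every $e>0$ and every $a\in\mathfrak a_{p^e-1}$, the $R_P$-linear map $R_P\to F^e_*R_P(\lceil (p^e-1)\Delta|_{\operatorname{Spec}R_P}\rceil)$ sending $1$ to $fa$ does not split. A reduced $F$-finite ring $A$ is strongly $F$-regular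 if for every $c\in A^\circ$ there is $e>0$ such that the $A$-linear map $A\to F^e_*A$ sending $1$ to $c$ splits. *)

theory Defs
  imports
    "HOL-Algebra.QuotRing"
    "HOL-Algebra.Ideal_Product"
    "HOL-Algebra.Ring_Divisibility"
    "HOL-Algebra.Module"
    "HOL-Library.Extended_Nat"
    "HOL-Computational_Algebra.Primes"
    Complex_Main
begin

section \<open>Localization\<close>

definition loc_rel :: "('a, 'm) ring_scheme \<Rightarrow> 'a set \<Rightarrow> (('a \<times> 'a) \<times> ('a \<times> 'a)) set" where
  "loc_rel R S = {((a, s), (b, t)).
     a \<in> carrier R \<and> b \<in> carrier R \<and> s \<in> S \<and> t \<in> S \<and>
     (\<exists>u\<in>S. u \<otimes>\<^bsub>R\<^esub> (a \<otimes>\<^bsub>R\<^esub> t) = u \<otimes>\<^bsub>R\<^esub> (b \<otimes>\<^bsub>R\<^esub> s))}"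

text \<open>The fraction \<open>a / s\<close>.\<close>

definition loc_frac :: "('a, 'm) ring_scheme \<Rightarrow> 'a set \<Rightarrow> 'a \<Rightarrow> 'a \<Rightarrow> ('a \<times> 'a) set" where
  "loc_frac R S a s = loc_rel R S `` {(a, s)}"

text \<open>The ring \<open>S\<inverse>R\<close>, for a multiplicatively closed set \<open>S\<close> containing 1. In the unions below all
  representatives of two given classes yield one and the same class.\<close>

definition loc :: "('a, 'm) ring_scheme \<Rightarrow> 'a set \<Rightarrow> ('a \<times> 'a) set ring" where
  "loc R S =
    \<lparr>carrier = (carrier R \<times> S) // loc_rel R S,
     monoid.mult = (\<lambda>X Y. \<Union>(a, s)\<in>X. \<Union>(b, t)\<in>Y. loc_frac R S (a \<otimes>\<^bsub>R\<^esub> b) (s \<otimes>\<^bsub>R\<^esub> t)),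
     one = loc_frac R S \<one>\<^bsub>R\<^esub> \<one>\<^bsub>R\<^esub>,
     zero = loc_frac R S \<zero>\<^bsub>R\<^esub> \<one>\<^bsub>R\<^esub>,
     add = (\<lambda>X Y. \<Union>(a, s)\<in>X. \<Union>(b, t)\<in>Y.
       loc_frac R S ((a \<otimes>\<^bsub>R\<^esub> t) \<oplus>\<^bsub>R\<^esub> (b \<otimes>\<^bsub>R\<^esub> s)) (s \<otimes>\<^bsub>R\<^esub> t))\<rparr>"

definition loc_map :: "('a, 'm) ring_scheme \<Rightarrow> 'a set \<Rightarrow> 'a \<Rightarrow> ('a \<times> 'a) set" where
  "loc_map R S a = loc_frac R S a \<one>\<^bsub>R\<^esub>"

abbreviation loc_at :: "('a, 'm) ring_scheme \<Rightarrow> 'a set \<Rightarrow> ('a \<times> 'a) set ring" where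
  "loc_at R P \<equiv> loc R (carrier R - P)"

abbreviation to_loc_at :: "('a, 'm) ring_scheme \<Rightarrow> 'a set \<Rightarrow> 'a \<Rightarrow> ('a \<times> 'a) set" where
  "to_loc_at R P \<equiv> loc_map R (carrier R - P)"

definition max_ideal_at :: "('a, 'm) ring_scheme \<Rightarrow> 'a set \<Rightarrow> ('a \<times> 'a) set set" where
  "max_ideal_at R P = Idl\<^bsub>loc_at R P\<^esub> (to_loc_at R P ` P)"

definition nonzerodivisors :: "('a, 'm) ring_scheme \<Rightarrow> 'a set" where
  "nonzerodivisors R =
    {s \<in> carrier R. \<forall>x\<in>carrier R. s \<otimes>\<^bsub>R\<^esub> x = \<zero>\<^bsub>R\<^esub> \<longrightarrow> x = \<zero>\<^bsub>R\<^esub>}"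

text \<open>The total ring of fractions; it is the fraction field when \<open>R\<close> is a domain.\<close>

abbreviation tot_frac :: "('a, 'm) ring_scheme \<Rightarrow> ('a \<times> 'a) set ring" where
  "tot_frac R \<equiv> loc R (nonzerodivisors R)"

abbreviation to_tot_frac :: "('a, 'm) ring_scheme \<Rightarrow> 'a \<Rightarrow> ('a \<times> 'a) set" where
  "to_tot_frac R \<equiv> loc_map R (nonzerodivisors R)"


section \<open>Rings and primes\<close>

definition reduced_ring :: "('a, 'm) ring_scheme \<Rightarrow> bool" where
  "reduced_ring R \<longleftrightarrow>
    (\<forall>x\<in>carrier R. \<forall>n::nat. x [^]\<^bsub>R\<^esub> n = \<zero>\<^bsub>R\<^esub> \<longrightarrow> x = \<zero>\<^bsub>R\<^esub>)"

definition minimal_prime :: "('a, 'm) ring_scheme \<Rightarrow> 'a set \<Rightarrow> bool" where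
  "minimal_prime R Q \<longleftrightarrow>
    primeideal Q R \<and> (\<forall>Q'. primeideal Q' R \<and> Q' \<subseteq> Q \<longrightarrow> Q' = Q)"

text \<open>\<open>R\<degree>\<close>, the elements of \<open>R\<close> in no minimal prime.\<close>

definition circ :: "('a, 'm) ring_scheme \<Rightarrow> 'a set" where
  "circ R = {c \<in> carrier R. \<forall>Q. minimal_prime R Q \<longrightarrow> c \<notin> Q}"

definition height :: "('a, 'm) ring_scheme \<Rightarrow> 'a set \<Rightarrow> enat" where
  "height R Q = Sup {enat n | n c.
     (\<forall>i\<le>n. primeideal (c i) R) \<and> (\<forall>i<n. c i \<subset> c (Suc i)) \<and> c n = Q}"

definition height_one_prime :: "('a, 'm) ring_scheme \<Rightarrow> 'a set \<Rightarrow> bool" where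
  "height_one_prime R Q \<longleftrightarrow> primeideal Q R \<and> height R Q = 1"

definition integral_over :: "('a, 'm) ring_scheme \<Rightarrow> ('a \<times> 'a) set \<Rightarrow> bool" where
  "integral_over R x \<longleftrightarrow> (\<exists>(n::nat) c. c \<in> {..<n} \<rightarrow> carrier R \<and>
     x [^]\<^bsub>tot_frac R\<^esub> n \<oplus>\<^bsub>tot_frac R\<^esub>
       (\<Oplus>\<^bsub>tot_frac R\<^esub>i\<in>{..<n}. to_tot_frac R (c i) \<otimes>\<^bsub>tot_frac R\<^esub> x [^]\<^bsub>tot_frac R\<^esub> i)
     = \<zero>\<^bsub>tot_frac R\<^esub>)"

definition normal_domain :: "('a, 'm) ring_scheme \<Rightarrow> bool" where
  "normal_domain R \<longleftrightarrow> domain R \<and>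
    (\<forall>x\<in>carrier (tot_frac R). integral_over R x \<longrightarrow> x \<in> to_tot_frac R ` carrier R)"


section \<open>Modules and the Frobenius\<close>

definition self_module :: "('a, 'm) ring_scheme \<Rightarrow> ('a, 'a) module" where
  "self_module R =
    \<lparr>carrier = carrier R, monoid.mult = monoid.mult R, one = one R, zero = zero R, add = add R,
     smult = monoid.mult R\<rparr>"

definition fin_gen_module ::
    "('a, 'm) ring_scheme \<Rightarrow> ('a, 'b, 'n) module_scheme \<Rightarrow> bool" where
  "fin_gen_module R M \<longleftrightarrow> (\<exists>S. finite S \<and> S \<subseteq> carrier M \<and>
     carrier M = {(\<Oplus>\<^bsub>M\<^esub>s\<in>S. c s \<odot>\<^bsub>M\<^esub> s) | c. c \<in> S \<rightarrow> carrier R})"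

definition linear_maps ::
    "('a, 'm) ring_scheme \<Rightarrow> ('a, 'b, 'n) module_scheme \<Rightarrow> ('a, 'c, 'k) module_scheme \<Rightarrow> ('b \<Rightarrow> 'c) set"
    where
  "linear_maps R M N = {h \<in> carrier M \<rightarrow> carrier N.
     (\<forall>x\<in>carrier M. \<forall>y\<in>carrier M. h (x \<oplus>\<^bsub>M\<^esub> y) = h x \<oplus>\<^bsub>N\<^esub> h y) \<and>
     (\<forall>r\<in>carrier R. \<forall>x\<in>carrier M. h (r \<odot>\<^bsub>M\<^esub> x) = r \<odot>\<^bsub>N\<^esub> h x)}"

text \<open>\<open>splits_at R M x\<close>: the \<open>R\<close>-linear map \<open>R \<rightarrow> M\<close> sending \<open>1\<close> to \<open>x\<close>, that is \<open>r \<mapsto> r x\<close>, has an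
  \<open>R\<close>-linear left inverse.\<close>

definition splits_at ::
    "('a, 'm) ring_scheme \<Rightarrow> ('a, 'b, 'n) module_scheme \<Rightarrow> 'b \<Rightarrow> bool" where
  "splits_at R M x \<longleftrightarrow>
    (\<exists>h\<in>linear_maps R M (self_module R). \<forall>r\<in>carrier R. h (r \<odot>\<^bsub>M\<^esub> x) = r)"

text \<open>\<open>F\<^sup>e\<^sub>*M\<close>\<close>

definition frob_push ::
    "nat \<Rightarrow> nat \<Rightarrow> ('a, 'm) ring_scheme \<Rightarrow> ('a, 'b, 'n) module_scheme \<Rightarrow> ('a, 'b, 'n) module_scheme"
    where
  "frob_push p e R M = M\<lparr>smult := (\<lambda>r x. (r [^]\<^bsub>R\<^esub> (p ^ e)) \<odot>\<^bsub>M\<^esub> x)\<rparr>"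

text \<open>The standing assumptions on rings. Excellence is not listed because noetherian \<open>F\<close>-finite
  rings of characteristic \<open>p\<close> are excellent (Kunz, On noetherian rings of characteristic p, 1976).\<close>

definition F_finite_ring :: "nat \<Rightarrow> ('a, 'm) ring_scheme \<Rightarrow> bool" where
  "F_finite_ring p R \<longleftrightarrow>
    cring R \<and> noetherian_ring R \<and>
    prime p \<and> \<one>\<^bsub>R\<^esub> \<noteq> \<zero>\<^bsub>R\<^esub> \<and> add_pow R p \<one>\<^bsub>R\<^esub> = \<zero>\<^bsub>R\<^esub> \<and>
    fin_gen_module R (frob_push p 1 R (self_module R))"

definition strongly_F_regular :: "nat \<Rightarrow> ('a, 'm) ring_scheme \<Rightarrow> bool" where
  "strongly_F_regular p A \<longleftrightarrow>
    F_finite_ring p A \<and> reduced_ring A \<and>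
    (\<forall>c\<in>circ A. \<exists>e>0. splits_at A (frob_push p e A (self_module A)) c)"


section \<open>Divisors\<close>

text \<open>A divisor on \<open>Spec R\<close> is given by its coefficients at the prime divisors, that is, at the primes
  of height one; the coefficient function is 0 at all other sets.\<close>

definition R_divisor :: "('a, 'm) ring_scheme \<Rightarrow> ('a set \<Rightarrow> real) \<Rightarrow> bool" where
  "R_divisor R D \<longleftrightarrow> finite {Q. D Q \<noteq> 0} \<and> (\<forall>Q. D Q \<noteq> 0 \<longrightarrow> height_one_prime R Q)"

definition effective :: "('a set \<Rightarrow> real) \<Rightarrow> bool" where
  "effective D \<longleftrightarrow> (\<forall>Q. D Q \<ge> 0)"

definition div_restrict ::
    "('a, 'm) ring_scheme \<Rightarrow> 'a set \<Rightarrow> ('a set \<Rightarrow> real) \<Rightarrow> (('a \<times> 'a) set set \<Rightarrow> real)" where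
  "div_restrict R P D = (\<lambda>Q. if height_one_prime (loc_at R P) Q
     then D {r \<in> carrier R. to_loc_at R P r \<in> Q} else 0)"

definition div_ceil :: "('a set \<Rightarrow> real) \<Rightarrow> ('a set \<Rightarrow> int)" where
  "div_ceil D = (\<lambda>Q. \<lceil>D Q\<rceil>)"

text \<open>For \<open>Q\<close> of height one in a noetherian normal domain \<open>R\<close>, the discrete valuation of \<open>R\<^sub>Q\<close>, first for
  nonzero elements of \<open>R\<close>, where it is the largest \<open>n\<close> with \<open>a \<in> (Q R\<^sub>Q)\<^sup>n\<close>, and then for nonzero
  elements of the fraction field.\<close>

definition ring_ord :: "('a, 'm) ring_scheme \<Rightarrow> 'a set \<Rightarrow> 'a \<Rightarrow> nat" where
  "ring_ord R Q a =
    (GREATEST n. to_loc_at R Q a \<in> max_ideal_at R Q [^]\<^bsub>ideals_set (loc_at R Q)\<^esub> n)"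

definition frac_ord :: "('a, 'm) ring_scheme \<Rightarrow> 'a set \<Rightarrow> ('a \<times> 'a) set \<Rightarrow> int" where
  "frac_ord R Q f = (THE n. \<exists>a\<in>carrier R - {\<zero>\<^bsub>R\<^esub>}. \<exists>b\<in>carrier R - {\<zero>\<^bsub>R\<^esub>}.
     f = loc_frac R (nonzerodivisors R) a b \<and> n = int (ring_ord R Q a) - int (ring_ord R Q b))"

text \<open>\<open>R(D)\<close> as an \<open>R\<close>-submodule of the total ring of fractions, for an integral divisor \<open>D\<close>. The ring
  \<open>R\<close> is only required to be a normal domain if \<open>D\<close> is nonzero; \<open>R(0)\<close> is \<open>R\<close> itself. The
  multiplication and unit inherited from the record type play no role.\<close>

definition div_sections ::
    "('a, 'm) ring_scheme \<Rightarrow> ('a set \<Rightarrow> int) \<Rightarrow> ('a, ('a \<times> 'a) set) module" where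
  "div_sections R D =
    \<lparr>carrier =
       (if D = (\<lambda>_. 0) then to_tot_frac R ` carrier R
        else {f \<in> carrier (tot_frac R). f = \<zero>\<^bsub>tot_frac R\<^esub> \<or>
                (\<forall>Q. height_one_prime R Q \<longrightarrow> frac_ord R Q f + D Q \<ge> 0)}),
     monoid.mult = monoid.mult (tot_frac R), one = one (tot_frac R),
     zero = zero (tot_frac R), add = add (tot_frac R),
     smult = (\<lambda>r f. to_tot_frac R r \<otimes>\<^bsub>tot_frac R\<^esub> f)\<rparr>"


section \<open>Triples and centers of sharp \<open>F\<close>-purity\<close>

definition graded_system :: "('a, 'm) ring_scheme \<Rightarrow> (nat \<Rightarrow> 'a set) \<Rightarrow> bool" where
  "graded_system R \<aa> \<longleftrightarrow>
    (\<forall>i. ideal (\<aa> i) R) \<and> (\<forall>i j. \<aa> i \<cdot>\<^bsub>R\<^esub> \<aa> j \<subseteq> \<aa> (i + j))"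

definition triple ::
    "nat \<Rightarrow> ('a, 'm) ring_scheme \<Rightarrow> ('a set \<Rightarrow> real) \<Rightarrow> (nat \<Rightarrow> 'a set) \<Rightarrow> bool" where
  "triple p R \<Delta> \<aa> \<longleftrightarrow>
    F_finite_ring p R \<and> reduced_ring R \<and>
    R_divisor R \<Delta> \<and> effective \<Delta> \<and> graded_system R \<aa> \<and>
    (\<Delta> \<noteq> (\<lambda>_. 0) \<longrightarrow> normal_domain R) \<and>
    \<aa> 0 = carrier R \<and>
    (\<forall>i. \<aa> i \<inter> circ R \<noteq> {})"

definition center_of_sharp_F_purity ::
    "nat \<Rightarrow> ('a, 'm) ring_scheme \<Rightarrow> ('a set \<Rightarrow> real) \<Rightarrow> (nat \<Rightarrow> 'a set) \<Rightarrow> 'a set \<Rightarrow> bool" where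
  "center_of_sharp_F_purity p R \<Delta> \<aa> P \<longleftrightarrow>
    primeideal P R \<and>
    (\<forall>f\<in>max_ideal_at R P. \<forall>e>0. \<forall>a\<in>\<aa> (p ^ e - 1).
       \<not> splits_at (loc_at R P)
           (frob_push p e (loc_at R P)
             (div_sections (loc_at R P)
               (div_ceil (\<lambda>Q. real (p ^ e - 1) * div_restrict R P \<Delta> Q))))
           (to_tot_frac (loc_at R P) (f \<otimes>\<^bsub>loc_at R P\<^esub> to_loc_at R P a)))"

end

theory Submission
  imports Defs
begin

text \<open>Call a map \<open>h\<close> on a ring \<open>A\<close> of characteristic \<open>p\<close> Frobenius-linear of level \<open>e\<close> if it is
  additive and \<open>h(r\<^sup>q x) = r h(x)\<close> for \<open>q = p\<^sup>e\<close>; these are the \<open>A\<close>-linear maps from \<open>F\<^sup>e\<^sub>*A\<close> to \<open>A\<close>. Call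
  an ideal stable if all Frobenius-linear maps of positive level carry it into itself.

  Suppose that \<open>A = R / P\<close> is not strongly \<open>F\<close>-regular, as witnessed by some \<open>c \<noteq> 0\<close> that no
  Frobenius-linear map of positive level sends to 1. Then \<open>A\<close> has a nonzero proper stable ideal
  (lemma \<open>exists_stable_ideal\<close>). If the Frobenius of \<open>A\<close> splits, the values \<open>h(c)\<close> form one: the
  splitting shows that the set of these values increases with the level of \<open>h\<close>, so that sums of
  values are values and 1 is not a value at level 0 either. If
  it does not split, the values of all maps of level 1 form a proper ideal \<open>I\<close>, and all maps of
  positive level have values in \<open>I\<close>; if \<open>I = 0\<close>, then every ideal is stable, and \<open>A\<close> is not a field,
  because the Frobenius of a field splits (\<open>field_frob_split\<close>). An associated prime \<open>q\<close> of a stable ideal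
  is stable (\<open>prime_of_stable_ideal\<close>), and it is nonzero since it contains the ideal.

  The preimage \<open>Q\<close> of \<open>q\<close> in \<open>R\<close> contains \<open>P\<close> properly, and it is a center of sharp \<open>F\<close>-purity
  (\<open>center_of_stable_prime\<close>), which contradicts the maximality of \<open>P\<close>. Indeed, a map that violates
  the condition for \<open>Q\<close> is compatible with the smaller center \<open>P\<close> (\<open>center_compatible\<close>), so after
  clearing denominators it induces a Frobenius-linear map on \<open>R / P\<close> that does not preserve \<open>q\<close>.

  Compatibility with \<open>P\<close> is seen by localizing the map further from \<open>Q\<close> to \<open>P\<close>, which requires
  that every section of the rounded-up divisor near \<open>P\<close> has a multiple by an element outside \<open>P\<close> that
  is a section near \<open>Q\<close> (\<open>center_sections_extend\<close>). Here the divisor enters: if it is nonzero, \<open>R\<close> is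
  normal, its local rings at primes of height one are discrete valuation rings
  (\<open>normal_height_one_uniformizer\<close>), and a nonzero element lies in finitely many such primes. A prime
  of height one in a localization comes with the uniformizer of its contraction to \<open>R\<close>, so that all
  orders can be computed in \<open>R\<close>.\<close>

section \<open>Localization\<close>

locale mult_subset = cring R for R (structure) +
  fixes S
  assumes S_carrier: "S \<subseteq> carrier R"
    and one_S [simp, intro]: "\<one> \<in> S"
    and mult_S [simp, intro]: "\<lbrakk>s \<in> S; t \<in> S\<rbrakk> \<Longrightarrow> s \<otimes> t \<in> S"
begin

abbreviation L where "L \<equiv> loc R S"
abbreviation frac where "frac \<equiv> loc_frac R S"

lemma S_closed [simp, intro]: "s \<in> S \<Longrightarrow> s \<in> carrier R"
  using S_carrier by blast

lemma pow_S [simp, intro]: "s \<in> S \<Longrightarrow> s [^] (n::nat) \<in> S"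
  by (induction n) auto

lemma equiv_loc_rel: "equiv (carrier R \<times> S) (loc_rel R S)"
proof (rule equivI)
  show "loc_rel R S \<subseteq> (carrier R \<times> S) \<times> carrier R \<times> S"
    by (auto simp: loc_rel_def)
  show "refl_on (carrier R \<times> S) (loc_rel R S)"
    by (auto simp: refl_on_def loc_rel_def)
  show "sym (loc_rel R S)"
    unfolding sym_def loc_rel_def by (clarsimp, metis)
  show "trans (loc_rel R S)"
  proof (rule transI)
    fix x y z assume "(x, y) \<in> loc_rel R S" "(y, z) \<in> loc_rel R S"
    then obtain a s b t c v u w where eq: "x = (a, s)" "y = (b, t)" "z = (c, v)"
      and cl: "a \<in> carrier R" "b \<in> carrier R" "c \<in> carrier R" "s \<in> S" "t \<in> S" "v \<in> S" "u \<in> S" "w \<in> S"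
      and 1: "u \<otimes> (a \<otimes> t) = u \<otimes> (b \<otimes> s)" and 2: "w \<otimes> (b \<otimes> v) = w \<otimes> (c \<otimes> t)"
      by (auto simp: loc_rel_def)
    have "(u \<otimes> w \<otimes> t) \<otimes> (a \<otimes> v) = (w \<otimes> v) \<otimes> (u \<otimes> (a \<otimes> t))"
      using cl by (simp add: m_ac)
    also have "\<dots> = (u \<otimes> s) \<otimes> (w \<otimes> (b \<otimes> v))"
      unfolding 1 using cl by (simp add: m_ac)
    also have "\<dots> = (u \<otimes> w \<otimes> t) \<otimes> (c \<otimes> s)"
      unfolding 2 using cl by (simp add: m_ac)
    finally show "(x, z) \<in> loc_rel R S"
      using cl eq by (auto simp: loc_rel_def intro!: bexI[of _ "u \<otimes> w \<otimes> t"])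
  qed
qed

lemma frac_eq_iff:
  assumes "a \<in> carrier R" "b \<in> carrier R" "s \<in> S" "t \<in> S"
  shows "frac a s = frac b t \<longleftrightarrow> (\<exists>u\<in>S. u \<otimes> (a \<otimes> t) = u \<otimes> (b \<otimes> s))"
  using eq_equiv_class_iff[OF equiv_loc_rel, of "(a, s)" "(b, t)"] assms
  by (auto simp: loc_frac_def loc_rel_def)

lemma frac_eqI:
  assumes "a \<in> carrier R" "b \<in> carrier R" "s \<in> S" "t \<in> S" "a \<otimes> t = b \<otimes> s"
  shows "frac a s = frac b t"
  using assms by (auto simp: frac_eq_iff)

lemma mem_fracD:
  assumes "a \<in> carrier R" "s \<in> S" "x \<in> frac a s"
  obtains b t where "x = (b, t)" "b \<in> carrier R" "t \<in> S" "frac b t = frac a s"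
proof -
  have *: "((a, s), x) \<in> loc_rel R S" using assms by (auto simp: loc_frac_def)
  then obtain b t where "x = (b, t)" "b \<in> carrier R" "t \<in> S" by (auto simp: loc_rel_def)
  with * equiv_class_eq[OF equiv_loc_rel *] show ?thesis
    by (intro that) (auto simp: loc_frac_def)
qed

lemma mem_frac_self: "\<lbrakk>a \<in> carrier R; s \<in> S\<rbrakk> \<Longrightarrow> (a, s) \<in> frac a s"
  by (auto simp: loc_frac_def loc_rel_def)

lemma frac_closed [simp, intro]: "\<lbrakk>a \<in> carrier R; s \<in> S\<rbrakk> \<Longrightarrow> frac a s \<in> carrier L"
  by (auto simp: loc_def loc_frac_def intro: quotientI)

lemma loc_cases:
  assumes "x \<in> carrier L"
  obtains a s where "a \<in> carrier R" "s \<in> S" "x = frac a s"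
  using assms by (auto simp: loc_def loc_frac_def elim!: quotientE)

text \<open>Both operations of \<^term>\<open>L\<close> are unions over all representatives; they are evaluated by
  showing that the united sets all coincide.\<close>

lemma UN_fracs:
  assumes "a \<in> carrier R" "s \<in> S" "b \<in> carrier R" "t \<in> S"
    and "\<And>a' s' b' t'. \<lbrakk>a' \<in> carrier R; s' \<in> S; b' \<in> carrier R; t' \<in> S;
      frac a' s' = frac a s; frac b' t' = frac b t\<rbrakk> \<Longrightarrow> f a' s' b' t' = f a s b t"
  shows "(\<Union>(a', s')\<in>frac a s. \<Union>(b', t')\<in>frac b t. f a' s' b' t') = f a s b t"
proof -
  have "f a' s' b' t' = f a s b t" if "(a', s') \<in> frac a s" "(b', t') \<in> frac b t" for a' s' b' t'
    using mem_fracD[OF assms(1,2) that(1)] mem_fracD[OF assms(3,4) that(2)] assms(5)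
    by (metis prod.inject)
  then show ?thesis
    using mem_frac_self[OF assms(1,2)] mem_frac_self[OF assms(3,4)] by fast
qed

lemma frac_mult:
  assumes "a \<in> carrier R" "s \<in> S" "b \<in> carrier R" "t \<in> S"
  shows "frac a s \<otimes>\<^bsub>L\<^esub> frac b t = frac (a \<otimes> b) (s \<otimes> t)"
proof -
  have "frac (a' \<otimes> b') (s' \<otimes> t') = frac (a \<otimes> b) (s \<otimes> t)"
    if cl: "a' \<in> carrier R" "s' \<in> S" "b' \<in> carrier R" "t' \<in> S"
      and eq: "frac a' s' = frac a s" "frac b' t' = frac b t" for a' s' b' t'
  proof -
    obtain u w where uw: "u \<in> S" "w \<in> S" and
      1: "u \<otimes> (a' \<otimes> s) = u \<otimes> (a \<otimes> s')" and 2: "w \<otimes> (b' \<otimes> t) = w \<otimes> (b \<otimes> t')"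
      using eq assms cl by (auto simp only: frac_eq_iff)
    have "(u \<otimes> w) \<otimes> ((a' \<otimes> b') \<otimes> (s \<otimes> t)) = (u \<otimes> (a' \<otimes> s)) \<otimes> (w \<otimes> (b' \<otimes> t))"
      using cl uw assms by (simp add: m_ac)
    also have "\<dots> = (u \<otimes> w) \<otimes> ((a \<otimes> b) \<otimes> (s' \<otimes> t'))"
      unfolding 1 2 using cl uw assms by (simp add: m_ac)
    finally show ?thesis
      using cl uw assms by (subst frac_eq_iff) (auto intro!: bexI[of _ "u \<otimes> w"])
  qed
  then have "(\<Union>(a', s')\<in>frac a s. \<Union>(b', t')\<in>frac b t. frac (a' \<otimes> b') (s' \<otimes> t')) = frac (a \<otimes> b) (s \<otimes> t)"
    using assms by (intro UN_fracs) blast+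
  then show ?thesis
    by (simp add: loc_def)
qed

lemma frac_add:
  assumes "a \<in> carrier R" "s \<in> S" "b \<in> carrier R" "t \<in> S"
  shows "frac a s \<oplus>\<^bsub>L\<^esub> frac b t = frac (a \<otimes> t \<oplus> b \<otimes> s) (s \<otimes> t)"
proof -
  have "frac (a' \<otimes> t' \<oplus> b' \<otimes> s') (s' \<otimes> t') = frac (a \<otimes> t \<oplus> b \<otimes> s) (s \<otimes> t)"
    if cl: "a' \<in> carrier R" "s' \<in> S" "b' \<in> carrier R" "t' \<in> S"
      and eq: "frac a' s' = frac a s" "frac b' t' = frac b t" for a' s' b' t'
  proof -
    obtain u w where uw: "u \<in> S" "w \<in> S" and
      1: "u \<otimes> (a' \<otimes> s) = u \<otimes> (a \<otimes> s')" and 2: "w \<otimes> (b' \<otimes> t) = w \<otimes> (b \<otimes> t')"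
      using eq assms cl by (auto simp only: frac_eq_iff)
    have "(u \<otimes> w) \<otimes> ((a' \<otimes> t' \<oplus> b' \<otimes> s') \<otimes> (s \<otimes> t))
        = (u \<otimes> (a' \<otimes> s)) \<otimes> (w \<otimes> t' \<otimes> t) \<oplus> (w \<otimes> (b' \<otimes> t)) \<otimes> (u \<otimes> s' \<otimes> s)"
      using cl uw assms by (simp add: m_ac l_distr r_distr)
    also have "\<dots> = (u \<otimes> w) \<otimes> ((a \<otimes> t \<oplus> b \<otimes> s) \<otimes> (s' \<otimes> t'))"
      unfolding 1 2 using cl uw assms by (simp add: m_ac l_distr r_distr)
    finally show ?thesis
      using cl uw assms by (subst frac_eq_iff) (auto intro!: bexI[of _ "u \<otimes> w"])
  qed
  then have "(\<Union>(a', s')\<in>frac a s. \<Union>(b', t')\<in>frac b t. frac (a' \<otimes> t' \<oplus> b' \<otimes> s') (s' \<otimes> t'))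
      = frac (a \<otimes> t \<oplus> b \<otimes> s) (s \<otimes> t)"
    using assms by (intro UN_fracs) blast+
  then show ?thesis
    by (simp add: loc_def)
qed

lemma loc_zero: "\<zero>\<^bsub>L\<^esub> = frac \<zero> \<one>" and loc_one: "\<one>\<^bsub>L\<^esub> = frac \<one> \<one>"
  by (simp_all add: loc_def)

lemma frac_zero_eq: "s \<in> S \<Longrightarrow> frac \<zero> s = frac \<zero> \<one>"
  by (rule frac_eqI) auto

lemma loc_cring: "cring L"
proof (rule cringI)
  show "abelian_group L"
  proof (rule abelian_groupI)
    fix x y assume "x \<in> carrier L" "y \<in> carrier L"
    then show "x \<oplus>\<^bsub>L\<^esub> y \<in> carrier L" "x \<oplus>\<^bsub>L\<^esub> y = y \<oplus>\<^bsub>L\<^esub> x"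
      by (auto elim!: loc_cases simp: frac_add m_ac a_comm)
  next
    fix x y z assume "x \<in> carrier L" "y \<in> carrier L" "z \<in> carrier L"
    then show "x \<oplus>\<^bsub>L\<^esub> y \<oplus>\<^bsub>L\<^esub> z = x \<oplus>\<^bsub>L\<^esub> (y \<oplus>\<^bsub>L\<^esub> z)"
      by (auto elim!: loc_cases simp: frac_add m_ac a_ac l_distr r_distr)
  next
    fix x assume x: "x \<in> carrier L"
    then show "\<zero>\<^bsub>L\<^esub> \<oplus>\<^bsub>L\<^esub> x = x"
      by (auto elim!: loc_cases simp: loc_zero frac_add)
    from x obtain a s where "a \<in> carrier R" "s \<in> S" "x = frac a s" by (rule loc_cases)
    then show "\<exists>y\<in>carrier L. y \<oplus>\<^bsub>L\<^esub> x = \<zero>\<^bsub>L\<^esub>"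
      by (intro bexI[of _ "frac (\<ominus> a) s"])
        (auto simp: frac_add loc_zero l_minus l_neg intro!: frac_zero_eq)
  qed (auto simp: loc_zero)
  show "Group.comm_monoid L"
  proof (rule comm_monoidI)
    fix x y assume "x \<in> carrier L" "y \<in> carrier L"
    then show "x \<otimes>\<^bsub>L\<^esub> y \<in> carrier L" "x \<otimes>\<^bsub>L\<^esub> y = y \<otimes>\<^bsub>L\<^esub> x"
      by (auto elim!: loc_cases simp: frac_mult m_ac)
  next
    fix x y z assume "x \<in> carrier L" "y \<in> carrier L" "z \<in> carrier L"
    then show "x \<otimes>\<^bsub>L\<^esub> y \<otimes>\<^bsub>L\<^esub> z = x \<otimes>\<^bsub>L\<^esub> (y \<otimes>\<^bsub>L\<^esub> z)"
      by (auto elim!: loc_cases simp: frac_mult m_ac)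
  qed (auto elim!: loc_cases simp: loc_one frac_mult)
  fix x y z assume "x \<in> carrier L" "y \<in> carrier L" "z \<in> carrier L"
  then obtain a s b t c v where [simp]: "x = frac a s" "y = frac b t" "z = frac c v"
    and [simp]: "a \<in> carrier R" "b \<in> carrier R" "c \<in> carrier R" "s \<in> S" "t \<in> S" "v \<in> S"
    by (metis loc_cases)
  show "(x \<oplus>\<^bsub>L\<^esub> y) \<otimes>\<^bsub>L\<^esub> z = x \<otimes>\<^bsub>L\<^esub> z \<oplus>\<^bsub>L\<^esub> y \<otimes>\<^bsub>L\<^esub> z"
    by (simp add: frac_mult frac_add, rule frac_eqI) (auto simp: m_ac l_distr r_distr)
qed

sublocale L: cring "loc R S"
  by (rule loc_cring)

lemma loc_map_hom: "loc_map R S \<in> ring_hom R L"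
  by (rule ring_hom_memI) (auto simp: loc_map_def frac_mult frac_add loc_one)

sublocale loc_map: ring_hom_cring R "loc R S" "loc_map R S"
  by unfold_locales (rule loc_map_hom)

lemma loc_map_eq_iff:
  assumes "a \<in> carrier R" "b \<in> carrier R"
  shows "loc_map R S a = loc_map R S b \<longleftrightarrow> (\<exists>u\<in>S. u \<otimes> a = u \<otimes> b)"
  using assms by (simp add: loc_map_def frac_eq_iff)

lemma loc_map_eq_zero_iff:
  assumes "a \<in> carrier R"
  shows "loc_map R S a = \<zero>\<^bsub>L\<^esub> \<longleftrightarrow> (\<exists>u\<in>S. u \<otimes> a = \<zero>)"
  using assms by (simp add: loc_map_def loc_zero frac_eq_iff cong: bex_cong)

lemma frac_cancel:
  assumes "a \<in> carrier R" "s \<in> S"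
  shows "loc_map R S s \<otimes>\<^bsub>L\<^esub> frac a s = loc_map R S a"
  using assms by (simp add: loc_map_def frac_mult, intro frac_eqI) (auto simp: m_ac)

lemma frac_Units:
  assumes "s \<in> S" "t \<in> S"
  shows "frac s t \<in> Units L"
proof -
  have "frac s t \<otimes>\<^bsub>L\<^esub> frac t s = \<one>\<^bsub>L\<^esub>"
    using assms by (simp add: frac_mult loc_one, intro frac_eqI) (auto simp: m_ac)
  then show ?thesis
    using assms L.unit_factor[of "frac s t" "frac t s"] by auto
qed

lemma loc_map_Units [simp, intro]: "s \<in> S \<Longrightarrow> loc_map R S s \<in> Units L"
  by (simp add: loc_map_def frac_Units)

lemma unit_cancel_ideal:
  assumes I: "ideal I L" and s: "s \<in> S" and x: "x \<in> carrier L"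
    and m: "loc_map R S s \<otimes>\<^bsub>L\<^esub> x \<in> I"
  shows "x \<in> I"
proof -
  have u: "loc_map R S s \<in> Units L" using s by simp
  then have ic: "inv\<^bsub>L\<^esub> loc_map R S s \<in> carrier L" by simp
  have "inv\<^bsub>L\<^esub> loc_map R S s \<otimes>\<^bsub>L\<^esub> (loc_map R S s \<otimes>\<^bsub>L\<^esub> x) = x"
    using u x ic L.Units_closed[OF u] by (simp add: L.m_assoc[symmetric] L.Units_l_inv)
  then show ?thesis using ideal.I_l_closed[OF I m ic] by simp
qed

lemma loc_map_pow:
  assumes "a \<in> carrier R"
  shows "loc_map R S (a [^] (n::nat)) = loc_map R S a [^]\<^bsub>L\<^esub> n"
  using assms by (induction n) auto

lemma loc_lift:
  assumes "cring B" and f: "f \<in> ring_hom R B" and U: "f ` S \<subseteq> Units B"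
  shows "\<exists>g\<in>ring_hom L B. \<forall>a\<in>carrier R. g (loc_map R S a) = f a"
proof -
  interpret B: cring B by fact
  interpret f: ring_hom_cring R B f by unfold_locales (rule f)
  have fU: "f s \<in> Units B" if "s \<in> S" for s using U that by blast
  have fc [simp]: "f s \<in> carrier B" if "s \<in> S" for s using that by auto
  have ic [simp]: "inv\<^bsub>B\<^esub> f s \<in> carrier B" if "s \<in> S" for s using fU[OF that] by auto
  define q where "q a s = f a \<otimes>\<^bsub>B\<^esub> inv\<^bsub>B\<^esub> f s" for a s
  have q_iff: "y = q a s \<longleftrightarrow> y \<otimes>\<^bsub>B\<^esub> f s = f a"
    if "a \<in> carrier R" "s \<in> S" "y \<in> carrier B" for a s y
    using that fU[of s] B.Units_r_inv[of "f s"] B.Units_l_inv[of "f s"] unfolding q_def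
    by (metis B.m_assoc B.r_one B.Units_closed f.hom_closed B.Units_inv_closed)
  have q_closed: "q a s \<in> carrier B" if "a \<in> carrier R" "s \<in> S" for a s
    using that by (simp add: q_def)
  have q_mult: "q a s \<otimes>\<^bsub>B\<^esub> f s = f a" if "a \<in> carrier R" "s \<in> S" for a s
    using q_iff[OF that q_closed[OF that]] by simp
  have q_cong: "q a s = q b t"
    if ab: "a \<in> carrier R" "s \<in> S" "b \<in> carrier R" "t \<in> S" and eq: "frac a s = frac b t" for a s b t
  proof -
    obtain u where u: "u \<in> S" "u \<otimes> (a \<otimes> t) = u \<otimes> (b \<otimes> s)" using eq ab by (auto simp: frac_eq_iff)
    then have "f u \<otimes>\<^bsub>B\<^esub> (f a \<otimes>\<^bsub>B\<^esub> f t) = f u \<otimes>\<^bsub>B\<^esub> (f b \<otimes>\<^bsub>B\<^esub> f s)"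
      using ab by (metis f.hom_mult m_closed S_closed)
    then have "f a \<otimes>\<^bsub>B\<^esub> f t = f b \<otimes>\<^bsub>B\<^esub> f s"
      using ab u fU[of u] by (simp add: B.Units_l_cancel)
    moreover have "(q a s \<otimes>\<^bsub>B\<^esub> f t) \<otimes>\<^bsub>B\<^esub> f s = (q a s \<otimes>\<^bsub>B\<^esub> f s) \<otimes>\<^bsub>B\<^esub> f t"
      using ab q_closed[of a s] by (simp add: B.m_ac)
    ultimately have "(q a s \<otimes>\<^bsub>B\<^esub> f t) \<otimes>\<^bsub>B\<^esub> f s = f b \<otimes>\<^bsub>B\<^esub> f s"
      using ab q_mult[of a s] by simp
    then have "q a s \<otimes>\<^bsub>B\<^esub> f t = f b"
      using ab fU[of s] q_closed[of a s]
      by (metis B.Units_l_cancel B.m_closed B.m_comm f.hom_closed fc)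
    then show ?thesis using q_iff[of b t "q a s"] ab q_closed by simp
  qed
  define g where "g x = (THE y. \<exists>a s. a \<in> carrier R \<and> s \<in> S \<and> x = frac a s \<and> y = q a s)" for x
  have g: "g (frac a s) = q a s" if "a \<in> carrier R" "s \<in> S" for a s
    unfolding g_def using that q_cong by (intro the_equality) (blast, metis)
  have gm: "g (frac a s) \<otimes>\<^bsub>B\<^esub> f s = f a" if "a \<in> carrier R" "s \<in> S" for a s
    using that by (simp add: g q_mult)
  have "g \<in> ring_hom L B"
  proof (rule ring_hom_memI)
    fix x assume "x \<in> carrier L" then show "g x \<in> carrier B"
      by (auto elim!: loc_cases simp: g q_closed)
  next
    fix x y assume "x \<in> carrier L" "y \<in> carrier L"
    then obtain a s b t where [simp]: "x = frac a s" "y = frac b t"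
      and [simp]: "a \<in> carrier R" "b \<in> carrier R" "s \<in> S" "t \<in> S" by (metis loc_cases)
    note [simp] = q_closed
    have "(q a s \<otimes>\<^bsub>B\<^esub> q b t) \<otimes>\<^bsub>B\<^esub> f (s \<otimes> t) = (q a s \<otimes>\<^bsub>B\<^esub> f s) \<otimes>\<^bsub>B\<^esub> (q b t \<otimes>\<^bsub>B\<^esub> f t)"
      by (simp add: B.m_ac)
    then have "q a s \<otimes>\<^bsub>B\<^esub> q b t = q (a \<otimes> b) (s \<otimes> t)"
      by (subst q_iff) (auto simp: q_mult)
    then show "g (x \<otimes>\<^bsub>L\<^esub> y) = g x \<otimes>\<^bsub>B\<^esub> g y" by (simp add: frac_mult g)
    have "(q a s \<oplus>\<^bsub>B\<^esub> q b t) \<otimes>\<^bsub>B\<^esub> f (s \<otimes> t)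
        = (q a s \<otimes>\<^bsub>B\<^esub> f s) \<otimes>\<^bsub>B\<^esub> f t \<oplus>\<^bsub>B\<^esub> (q b t \<otimes>\<^bsub>B\<^esub> f t) \<otimes>\<^bsub>B\<^esub> f s"
      by (simp add: B.m_ac B.l_distr B.r_distr)
    then have "q a s \<oplus>\<^bsub>B\<^esub> q b t = q (a \<otimes> t \<oplus> b \<otimes> s) (s \<otimes> t)"
      by (subst q_iff) (auto simp: q_mult)
    then show "g (x \<oplus>\<^bsub>L\<^esub> y) = g x \<oplus>\<^bsub>B\<^esub> g y" by (simp add: frac_add g)
  next
    show "g \<one>\<^bsub>L\<^esub> = \<one>\<^bsub>B\<^esub>" using gm[of \<one> \<one>] g[of \<one> \<one>] q_closed[of \<one> \<one>] by (simp add: loc_one)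
  qed
  moreover have "g (loc_map R S a) = f a" if "a \<in> carrier R" for a
    using gm[of a \<one>] that g[of a \<one>] q_closed[of a \<one>] by (simp add: loc_map_def)
  ultimately show ?thesis by blast
qed

(* When S is the complement of a prime, membership in S unfolds to membership in the carrier again. *)
declare S_closed [simp del, rule del]

end

section \<open>Primes and chains in noetherian rings\<close>

lemma (in noetherian_ring) exists_maximal_ideal_in:
  assumes "\<A> \<noteq> {}" and id: "\<And>I. I \<in> \<A> \<Longrightarrow> ideal I R"
  shows "\<exists>M\<in>\<A>. \<forall>X\<in>\<A>. M \<subseteq> X \<longrightarrow> X = M"
proof -
  have "\<Union>\<C> \<in> \<A>" if "\<C> \<noteq> {}" "subset.chain \<A> \<C>" for \<C>
  proof -
    have "subset.chain {I. ideal I R} \<C>"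
      using that id by (auto simp: subset_chain_def)
    then show ?thesis
      using ideal_chain_is_trivial[OF that(1)] that(2) by (auto simp: subset_chain_def)
  qed
  from subset_Zorn_nonempty[OF assms(1) this] show ?thesis .
qed

text \<open>The ideals generated by longer and longer initial segments become stationary. Integral
  equations need the linear relation itself; bounds on multiplicities need its consequence for
  ideals.\<close>

lemma noetherian_sequence:
  fixes R :: "('a, 'm) ring_scheme" (structure) and t :: "nat \<Rightarrow> 'a"
  assumes "noetherian_ring R" "cring R" and t: "\<And>n. t n \<in> carrier R"
  obtains n c where "c \<in> {..<n} \<rightarrow> carrier R" "t n \<oplus> (\<Oplus>i\<in>{..<n}. c i \<otimes> t i) = \<zero>"
    "\<forall>J. ideal J R \<and> (\<forall>i<n. t i \<in> J) \<longrightarrow> t n \<in> J"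
proof -
  interpret noetherian_ring R by fact
  interpret cring R by fact
  define I where "I n = rec_nat {\<zero>} (\<lambda>n J. set_add R J (PIdl (t n))) n" for n
  have I0: "I 0 = {\<zero>}" and IS: "I (Suc n) = set_add R (I n) (PIdl (t n))" for n by (simp_all add: I_def)
  have id: "ideal (I n) R" for n
    by (induction n) (auto simp: I0 IS zeroideal t intro!: add_ideals cgenideal_ideal)
  have sub1: "I n \<subseteq> I (Suc n)" for n
  proof
    fix x assume x: "x \<in> I n"
    have "\<zero> \<in> PIdl (t n)" using t by (auto simp: cgenideal_def intro!: exI[of _ \<zero>])
    moreover have "x = x \<oplus> \<zero>" using x ideal.Icarr[OF id] by simp
    ultimately show "x \<in> I (Suc n)" using x unfolding IS set_add_def' by blast
  qed
  have mono: "I m \<subseteq> I n" if "m \<le> n" for m n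
    using lift_Suc_mono_le[of I, OF sub1 that] .
  have "subset.chain {I. ideal I R} (range I)"
    using id mono by (auto simp: subset_chain_def) (metis nat_le_linear subsetD)
  then have "\<Union>(range I) \<in> range I" by (intro ideal_chain_is_trivial) auto
  then obtain n where n: "\<Union>(range I) = I n" by blast
  have tn: "t n \<in> I n"
  proof -
    have "t n = \<zero> \<oplus> t n" using t by simp
    moreover have "\<zero> \<in> I n" using id by (meson additive_subgroup.zero_closed ideal.axioms(1))
    moreover have "t n \<in> PIdl (t n)" using t by (simp add: cgenideal_self)
    ultimately have "t n \<in> I (Suc n)" unfolding IS set_add_def' by blast
    then show ?thesis using n by blast
  qed
  have combo: "\<exists>c. c \<in> {..<n} \<rightarrow> carrier R \<and> x = (\<Oplus>i\<in>{..<n}. c i \<otimes> t i)" if "x \<in> I n" for n x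
    using that
  proof (induction n arbitrary: x)
    case 0 then show ?case by (auto simp: I0)
  next
    case (Suc n)
    then obtain y z where y: "y \<in> I n" and z: "z \<in> carrier R" and x: "x = y \<oplus> z \<otimes> t n"
      by (auto simp: IS set_add_def' cgenideal_def)
    from Suc.IH[OF y] obtain c where c: "c \<in> {..<n} \<rightarrow> carrier R"
      and yc: "y = (\<Oplus>i\<in>{..<n}. c i \<otimes> t i)" by blast
    have eq: "(\<Oplus>i\<in>{..<n}. (c(n := z)) i \<otimes> t i) = y"
      unfolding yc using c t by (intro finsum_cong') auto
    have "(\<Oplus>i\<in>{..<Suc n}. (c(n := z)) i \<otimes> t i)
        = (c(n := z)) n \<otimes> t n \<oplus> (\<Oplus>i\<in>{..<n}. (c(n := z)) i \<otimes> t i)"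
      unfolding lessThan_Suc using c t z by (intro finsum_insert) (auto intro!: m_closed simp: Pi_iff)
    also have "\<dots> = x"
      unfolding eq x using z t y ideal.Icarr[OF id] by (simp add: a_comm)
    finally show ?case using c z by (intro exI[of _ "c(n := z)"]) (auto simp: less_Suc_eq Pi_iff)
  qed
  have "\<ominus> t n \<in> I n" using tn id by (meson additive_subgroup.a_inv_closed ideal.axioms(1))
  from combo[OF this] obtain c where c: "c \<in> {..<n} \<rightarrow> carrier R"
    "\<ominus> t n = (\<Oplus>i\<in>{..<n}. c i \<otimes> t i)" by blast
  have "t n \<oplus> (\<Oplus>i\<in>{..<n}. c i \<otimes> t i) = \<zero>" using c(2) t r_neg by metis
  moreover have "t n \<in> J" if J: "ideal J R" "\<And>i. i < n \<Longrightarrow> t i \<in> J" for J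
  proof -
    have "I m \<subseteq> J" if "m \<le> n" for m
      using that
    proof (induction m)
      case 0 then show ?case
        using J(1) by (auto simp: I0) (meson additive_subgroup.zero_closed ideal.axioms(1))
    next
      case (Suc m)
      have "PIdl (t m) \<subseteq> J" using Suc J by (intro cgenideal_minimal) auto
      then show ?case
        using Suc J(1) additive_subgroup.a_closed[OF ideal.axioms(1)[OF J(1)]]
        by (fastforce simp: IS set_add_def')
    qed
    then show ?thesis using tn by blast
  qed
  ultimately show ?thesis using c(1) by (intro that[of c n]) auto
qed

text \<open>The ideals \<open>{x. x b \<in> J}\<close> of elements pushing a fixed \<open>b\<close> into \<open>J\<close>, up to
  factors from \<open>S\<close>: one that is maximal among the proper ones is prime, since \<open>x y\<close> pushes \<open>b\<close>
  into \<open>J\<close> if and only if \<open>y\<close> pushes \<open>x b\<close> into \<open>J\<close>. For \<open>S = {1}\<close> this is the existence of an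
  associated prime of \<open>R / J\<close>, in general that of an associated prime avoiding \<open>S\<close>.\<close>

lemma (in mult_subset) exists_prime_colon:
  assumes "noetherian_ring R" and J: "ideal J R" and disj: "S \<inter> J = {}"
  obtains b where "b \<in> carrier R" "primeideal {x \<in> carrier R. \<exists>s\<in>S. s \<otimes> (x \<otimes> b) \<in> J} R"
proof -
  interpret noetherian_ring R by fact
  interpret J: ideal J R by fact
  note [simp, intro] = S_closed
  define C where "C b = {x \<in> carrier R. \<exists>s\<in>S. s \<otimes> (x \<otimes> b) \<in> J}" for b
  have C_ideal: "ideal (C b) R" if b: "b \<in> carrier R" for b
  proof (rule idealI)
    show "ring R" by (rule ring_axioms)
    show "subgroup (C b) (add_monoid R)"
    proof (rule add.subgroupI)
      show "C b \<subseteq> carrier R" by (auto simp: C_def)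
      have "\<zero> \<in> C b" using b by (auto simp: C_def intro!: bexI[of _ \<one>])
      then show "C b \<noteq> {}" by blast
    next
      fix x assume "x \<in> C b"
      then obtain s where x: "x \<in> carrier R" "s \<in> S" "s \<otimes> (x \<otimes> b) \<in> J" by (auto simp: C_def)
      then have "s \<otimes> (\<ominus> x \<otimes> b) = \<ominus> (s \<otimes> (x \<otimes> b))" using b by (simp add: l_minus r_minus)
      then have "s \<otimes> (\<ominus> x \<otimes> b) \<in> J" using x J.a_inv_closed by simp
      then show "\<ominus> x \<in> C b" using x by (auto simp: C_def)
    next
      fix x y assume "x \<in> C b" "y \<in> C b"
      then obtain s t where x: "x \<in> carrier R" "s \<in> S" "s \<otimes> (x \<otimes> b) \<in> J"
        and y: "y \<in> carrier R" "t \<in> S" "t \<otimes> (y \<otimes> b) \<in> J" by (auto simp: C_def)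
      have "(s \<otimes> t) \<otimes> ((x \<oplus> y) \<otimes> b) = t \<otimes> (s \<otimes> (x \<otimes> b)) \<oplus> s \<otimes> (t \<otimes> (y \<otimes> b))"
        using x y b by (simp add: m_ac l_distr r_distr)
      also have "\<dots> \<in> J" using x y by (auto intro!: J.a_closed J.I_l_closed)
      finally show "x \<oplus> y \<in> C b" using x y by (auto simp: C_def)
    qed
  next
    fix x r assume "x \<in> C b" and r: "r \<in> carrier R"
    then obtain s where x: "x \<in> carrier R" "s \<in> S" "s \<otimes> (x \<otimes> b) \<in> J" by (auto simp: C_def)
    have "s \<otimes> ((r \<otimes> x) \<otimes> b) = r \<otimes> (s \<otimes> (x \<otimes> b))" using x r b by (simp add: m_ac)
    also have "\<dots> \<in> J" using x r by (auto intro!: J.I_l_closed)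
    finally show "r \<otimes> x \<in> C b" using x r by (auto simp: C_def)
    then show "x \<otimes> r \<in> C b" using x r by (simp add: m_comm)
  qed
  define \<A> where "\<A> = {C b | b. b \<in> carrier R \<and> \<one> \<notin> C b}"
  have "\<one> \<notin> C \<one>" using disj by (auto simp: C_def)
  then have ne: "\<A> \<noteq> {}" unfolding \<A>_def by blast
  have ids: "ideal I R" if "I \<in> \<A>" for I using that C_ideal by (auto simp: \<A>_def)
  obtain M where M: "M \<in> \<A>" and max: "\<forall>X\<in>\<A>. M \<subseteq> X \<longrightarrow> X = M"
    using exists_maximal_ideal_in[OF ne ids] by blast
  then obtain b where b: "b \<in> carrier R" "\<one> \<notin> C b" "M = C b" by (auto simp: \<A>_def)
  have "primeideal (C b) R"
  proof (rule primeidealI)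
    show "ideal (C b) R" using b C_ideal by blast
    show "cring R" by (rule is_cring)
    show "carrier R \<noteq> C b" using b by auto
  next
    fix x y assume xy: "x \<in> carrier R" "y \<in> carrier R" "x \<otimes> y \<in> C b"
    have "y \<in> C b" if "x \<notin> C b"
    proof -
      have "C b \<subseteq> C (x \<otimes> b)"
      proof
        fix z assume "z \<in> C b"
        then obtain s where z: "z \<in> carrier R" "s \<in> S" "s \<otimes> (z \<otimes> b) \<in> J" by (auto simp: C_def)
        have "s \<otimes> (z \<otimes> (x \<otimes> b)) = x \<otimes> (s \<otimes> (z \<otimes> b))" using z xy b by (simp add: m_ac)
        also have "\<dots> \<in> J" using z xy by (auto intro!: J.I_l_closed)
        finally show "z \<in> C (x \<otimes> b)" using z by (auto simp: C_def)
      qed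
      moreover have "C (x \<otimes> b) \<in> \<A>"
        using that xy b by (auto simp: \<A>_def C_def m_ac)
      ultimately have "C (x \<otimes> b) = C b" using max b by blast
      moreover have "y \<in> C (x \<otimes> b)" using xy b by (auto simp: C_def m_ac)
      ultimately show ?thesis by simp
    qed
    then show "x \<in> C b \<or> y \<in> C b" by blast
  qed
  then show ?thesis using that b by (simp add: C_def)
qed

lemma prime_mult_subset:
  fixes R (structure)
  assumes "primeideal P R"
  shows "mult_subset R (carrier R - P)"
proof -
  interpret primeideal P R by fact
  have "\<one> \<notin> P" using one_imp_carrier I_notcarr by blast
  then show ?thesis
    using I_prime by unfold_locales auto
qed

lemma nonzerodivisors_closed: "c \<in> nonzerodivisors R \<Longrightarrow> c \<in> carrier R"
  unfolding nonzerodivisors_def by blast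

lemma (in cring) nonzerodivisors_mult_subset: "mult_subset R (nonzerodivisors R)"
proof unfold_locales
  fix s t assume "s \<in> nonzerodivisors R" "t \<in> nonzerodivisors R"
  then have s: "s \<in> carrier R" "\<And>x. x \<in> carrier R \<Longrightarrow> s \<otimes> x = \<zero> \<Longrightarrow> x = \<zero>"
    and t: "t \<in> carrier R" "\<And>x. x \<in> carrier R \<Longrightarrow> t \<otimes> x = \<zero> \<Longrightarrow> x = \<zero>"
    unfolding nonzerodivisors_def by blast+
  have "x = \<zero>" if x: "x \<in> carrier R" "s \<otimes> t \<otimes> x = \<zero>" for x
  proof (rule t(2))
    show "t \<otimes> x = \<zero>"
      by (rule s(2)) (use s(1) t(1) x in \<open>simp_all add: m_assoc\<close>)
  qed (use x in simp)
  then show "s \<otimes> t \<in> nonzerodivisors R"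
    using s(1) t(1) by (auto simp: nonzerodivisors_def)
qed (auto simp: nonzerodivisors_def)

lemma (in domain) nonzerodivisors_iff: "c \<in> nonzerodivisors R \<longleftrightarrow> c \<in> carrier R \<and> c \<noteq> \<zero>"
proof -
  have "\<exists>x\<in>carrier R. x \<noteq> \<zero>" using one_not_zero one_closed by blast
  then show ?thesis unfolding nonzerodivisors_def by (auto simp: integral_iff)
qed

section \<open>Orders along a prime of height one\<close>

lemma (in domain) height_one_prime_iff:
  "height_one_prime R q \<longleftrightarrow> primeideal q R \<and> q \<noteq> {\<zero>} \<and>
     (\<forall>q'. primeideal q' R \<and> q' \<subseteq> q \<longrightarrow> q' = {\<zero>} \<or> q' = q)"
proof (cases "primeideal q R")
  case True
  define \<C> where "\<C> = {enat n | n c. (\<forall>i\<le>n. primeideal (c i) R) \<and> (\<forall>i<n. c i \<subset> c (Suc i)) \<and> c n = q}"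
  have h: "height R q = Sup \<C>" by (simp add: height_def \<C>_def)
  have zero_in: "\<zero> \<in> I" if "primeideal I R" for I
    using that by (meson additive_subgroup.zero_closed ideal.axioms(1) primeideal.axioms(1))
  have one_in: "enat 1 \<in> \<C>" if "q \<noteq> {\<zero>}"
    unfolding \<C>_def
    using that True zero_in[OF True] zeroprimeideal
    by (auto intro!: exI[of _ "\<lambda>i. if i = 0 then {\<zero>} else q"])
  have two_in: "enat 2 \<in> \<C>" if "primeideal q' R" "q' \<subset> q" "q' \<noteq> {\<zero>}" for q'
    unfolding \<C>_def
    using that True zero_in[OF that(1)] zeroprimeideal
    by (intro CollectI exI[of _ 2] exI[of _ "\<lambda>i. if i = 0 then {\<zero>} else if i = 1 then q' else q"])
      (auto simp: numeral_2_eq_2 less_Suc_eq)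
  have bounded: "enat n \<le> 1"
    if min: "\<forall>q'. primeideal q' R \<and> q' \<subseteq> q \<longrightarrow> q' = {\<zero>} \<or> q' = q"
      and c: "\<forall>i\<le>n. primeideal (c i) R" "\<forall>i<n. c i \<subset> c (Suc i)" "c n = q" for n c
  proof (rule ccontr)
    assume "\<not> enat n \<le> 1"
    then have "n > 1" by (simp add: one_enat_def)
    then have m': "n = Suc (Suc (n - 2))" by simp
    define m where "m = n - 2"
    have m: "n = Suc (Suc m)" using m' by (simp only: m_def)
    have "c (Suc m) \<subset> q" "primeideal (c (Suc m)) R" using c m by auto
    then have "c (Suc m) = {\<zero>}" using min by blast
    moreover have "c m \<subset> c (Suc m)" "primeideal (c m) R" using c m by auto
    ultimately show False using zero_in[of "c m"] by auto
  qed
  have upper: "Sup \<C> \<le> 1" if "\<forall>q'. primeideal q' R \<and> q' \<subseteq> q \<longrightarrow> q' = {\<zero>} \<or> q' = q"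
    using bounded[OF that] by (auto simp: \<C>_def intro!: Sup_least)
  have "q \<noteq> {\<zero>}" if "Sup \<C> = 1"
  proof
    assume q: "q = {\<zero>}"
    have "n = 0" if "enat n \<in> \<C>" for n
    proof (rule ccontr)
      assume "n \<noteq> 0"
      then obtain m where m: "n = Suc m" by (meson not0_implies_Suc)
      from that obtain c where "\<forall>i\<le>n. primeideal (c i) R" "\<forall>i<n. c i \<subset> c (Suc i)" "c n = q"
        unfolding \<C>_def by auto
      then have "primeideal (c m) R" "c m \<subset> q" using m by auto
      then show False using zero_in q by blast
    qed
    then have "Sup \<C> \<le> 0" by (intro Sup_least) (auto simp: \<C>_def zero_enat_def)
    with that show False by simp
  qed
  moreover have "q' = {\<zero>} \<or> q' = q" if "Sup \<C> = 1" "primeideal q' R" "q' \<subseteq> q" for q'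
  proof (rule ccontr)
    assume "\<not> ?thesis"
    then have "enat 2 \<in> \<C>" using two_in that by blast
    then have "enat 2 \<le> Sup \<C>" by (rule Sup_upper)
    with that show False by (simp add: one_enat_def)
  qed
  moreover have "Sup \<C> = 1" if "q \<noteq> {\<zero>}" "\<forall>q'. primeideal q' R \<and> q' \<subseteq> q \<longrightarrow> q' = {\<zero>} \<or> q' = q"
    using upper[OF that(2)] Sup_upper[OF one_in[OF that(1)]] by (simp add: one_enat_def)
  ultimately show ?thesis using True by (auto simp: height_one_prime_def h)
qed (simp add: height_one_prime_def)

text \<open>\<open>has_order R q \<pi> a n\<close> says that \<open>a\<close> and \<open>\<pi>\<close> to the \<open>n\<close> differ by a unit of the local ring at
  \<open>q\<close>. It is stated without fractions so that it passes unchanged to any localization of \<open>R\<close>.\<close>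

definition has_order :: "('a, 'm) ring_scheme \<Rightarrow> 'a set \<Rightarrow> 'a \<Rightarrow> 'a \<Rightarrow> nat \<Rightarrow> bool" where
  "has_order R q \<pi> a n \<longleftrightarrow>
    (\<exists>s\<in>carrier R - q. \<exists>s'\<in>carrier R - q. s \<otimes>\<^bsub>R\<^esub> a = s' \<otimes>\<^bsub>R\<^esub> \<pi> [^]\<^bsub>R\<^esub> n)"

lemma has_orderI:
  assumes "s \<in> carrier R - q" "s' \<in> carrier R - q" "s \<otimes>\<^bsub>R\<^esub> a = s' \<otimes>\<^bsub>R\<^esub> \<pi> [^]\<^bsub>R\<^esub> n"
  shows "has_order R q \<pi> a n"
  using assms unfolding has_order_def by blast

definition uniformizer :: "('a, 'm) ring_scheme \<Rightarrow> 'a set \<Rightarrow> 'a \<Rightarrow> bool" where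
  "uniformizer R q \<pi> \<longleftrightarrow> \<pi> \<in> q \<and> \<pi> \<noteq> \<zero>\<^bsub>R\<^esub> \<and>
    (\<forall>a\<in>carrier R - {\<zero>\<^bsub>R\<^esub>}. \<exists>n. has_order R q \<pi> a n)"

text \<open>Division by \<open>\<pi>\<close>, up to the factor \<open>w\<close>, leads from a nonzero \<open>c\<close> to quotients \<open>t n\<close> with
  \<open>w\<^sup>n c = \<pi>\<^sup>n t n\<close>. If all of them were in \<open>q\<close>, the ideals that they generate would become
  stationary, and multiplying the resulting relation by a power of \<open>w\<close> would show that \<open>\<pi>\<close>
  divides this power.\<close>

lemma (in noetherian_domain) uniformizerI:
  assumes q: "primeideal q R" and \<pi>: "\<pi> \<in> q" "\<pi> \<noteq> \<zero>" and w: "w \<in> carrier R - q"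
    and div: "\<And>x. x \<in> q \<Longrightarrow> \<exists>z\<in>carrier R. w \<otimes> x = \<pi> \<otimes> z"
  shows "uniformizer R q \<pi>"
proof -
  interpret q: primeideal q R by fact
  interpret S: mult_subset R "carrier R - q" using q by (rule prime_mult_subset)
  have \<pi>c: "\<pi> \<in> carrier R" and wc: "w \<in> carrier R" using \<pi> w q.Icarr by auto
  have "\<exists>n. has_order R q \<pi> c n" if c: "c \<in> carrier R" "c \<noteq> \<zero>" for c
  proof (rule ccontr)
    assume neg: "\<nexists>n. has_order R q \<pi> c n"
    obtain g where g: "\<And>x. x \<in> q \<Longrightarrow> g x \<in> carrier R \<and> w \<otimes> x = \<pi> \<otimes> g x"
      using div by metis
    define t where "t n = (g ^^ n) c" for n
    have t0: "t 0 = c" and tS: "t (Suc n) = g (t n)" for n by (simp_all add: t_def)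
    have tq: "t n \<in> q \<and> w [^] n \<otimes> c = \<pi> [^] n \<otimes> t n" for n
    proof (induction n)
      case 0
      have "c \<in> q"
      proof (rule ccontr)
        assume "c \<notin> q"
        then have "has_order R q \<pi> c 0"
          using c S.one_S by (intro has_orderI[of \<one> _ _ c]) auto
        with neg show False by blast
      qed
      then show ?case using c by (simp add: t0)
    next
      case (Suc n)
      have tn: "t n \<in> carrier R" "t (Suc n) \<in> carrier R" using Suc g tS q.Icarr by auto
      have "w [^] Suc n \<otimes> c = w \<otimes> (w [^] n \<otimes> c)" using wc c by (simp add: m_ac)
      also have "\<dots> = \<pi> [^] n \<otimes> (w \<otimes> t n)" using Suc wc \<pi>c tn by (simp add: m_ac)
      also have "\<dots> = \<pi> [^] Suc n \<otimes> t (Suc n)" using Suc g \<pi>c tn by (simp add: tS m_ac)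
      finally have eq: "w [^] Suc n \<otimes> c = \<pi> [^] Suc n \<otimes> t (Suc n)" .
      have "t (Suc n) \<in> q"
      proof (rule ccontr)
        assume "t (Suc n) \<notin> q"
        then have "has_order R q \<pi> c (Suc n)"
          using S.pow_S[OF w, of "Suc n"] tn(2)
            eq[unfolded m_comm[OF nat_pow_closed[OF \<pi>c, of "Suc n"] tn(2)]]
          by (blast intro: has_orderI)
        with neg show False by blast
      qed
      then show ?case using eq by blast
    qed
    have tc: "t n \<in> carrier R" for n using tq q.Icarr by blast
    obtain n c' where "c' \<in> {..<n} \<rightarrow> carrier R" "t n \<oplus> (\<Oplus>i\<in>{..<n}. c' i \<otimes> t i) = \<zero>"
      and n: "\<forall>J. ideal J R \<and> (\<forall>i<n. t i \<in> J) \<longrightarrow> t n \<in> J"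
      by (rule noetherian_sequence[where t = t, OF noetherian_ring_axioms is_cring tc])
    define J where "J = {x \<in> carrier R. w [^] n \<otimes> x \<in> PIdl (\<pi> \<otimes> t n)}"
    have pw: "w [^] k \<otimes> t i = \<pi> [^] k \<otimes> t (i + k)" for i k
    proof (induction k)
      case (Suc k)
      have "w [^] Suc k \<otimes> t i = w \<otimes> (w [^] k \<otimes> t i)" using wc tc by (simp add: m_ac)
      also have "\<dots> = \<pi> [^] k \<otimes> (w \<otimes> t (i + k))" using Suc wc \<pi>c tc by (simp add: m_ac)
      also have "\<dots> = \<pi> [^] Suc k \<otimes> t (i + Suc k)" using tq g \<pi>c tc by (simp add: tS m_ac)
      finally show ?case .
    qed (use tc in simp)
    have "t n \<in> J"
    proof (rule n[rule_format], intro conjI allI impI)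
      show "ideal J R" unfolding J_def
        using wc \<pi>c tc by (intro ideal.helper_max_prime cgenideal_ideal is_cring) auto
      fix i assume i: "i < n"
      define k where "k = n - Suc i"
      have n_eq: "n = i + Suc k" using i by (simp add: k_def)
      have wn: "w [^] n = w [^] i \<otimes> w [^] Suc k"
        using nat_pow_mult[OF wc, of i "Suc k"] n_eq by metis
      have "w [^] n \<otimes> t i = w [^] i \<otimes> (w [^] Suc k \<otimes> t i)"
        unfolding wn using wc tc by (simp add: m_assoc del: nat_pow_Suc)
      also have "\<dots> = (w [^] i \<otimes> \<pi> [^] k) \<otimes> (\<pi> \<otimes> t n)"
        unfolding pw n_eq[symmetric] using wc \<pi>c tc by (simp add: m_ac)
      also have "\<dots> \<in> PIdl (\<pi> \<otimes> t n)" using wc \<pi>c by (auto simp: cgenideal_def)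
      finally show "t i \<in> J" using tc by (simp add: J_def)
    qed
    then obtain z where z: "z \<in> carrier R" "w [^] n \<otimes> t n = z \<otimes> (\<pi> \<otimes> t n)"
      by (auto simp: J_def cgenideal_def)
    have "t n \<noteq> \<zero>"
    proof
      assume "t n = \<zero>"
      then have "w [^] n \<otimes> c = \<zero>" using tq[of n] \<pi>c by simp
      moreover have "w [^] n \<notin> q" using S.pow_S[OF w] by simp
      ultimately show False using c wc integral[of "w [^] n" c] by auto
    qed
    moreover have "w [^] n \<otimes> t n = (z \<otimes> \<pi>) \<otimes> t n" using z \<pi>c tc by (simp add: m_ac)
    ultimately have "w [^] n = z \<otimes> \<pi>"
      using z \<pi>c tc wc by (simp add: m_rcancel)
    then have "w [^] n \<in> q" using \<pi> z q.I_l_closed by simp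
    then show False using S.pow_S[OF w, of n] by simp
  qed
  then show ?thesis using \<pi> by (auto simp: uniformizer_def)
qed

text \<open>A fraction \<open>b / a\<close> that multiplies a nonzero ideal \<open>q\<close> into itself is integral: the iterated
  products of \<open>a\<close> with \<open>b / a\<close> stay in \<open>q\<close>, hence satisfy a monic linear relation.\<close>

lemma normal_domain_divides:
  fixes R :: "('a, 'm) ring_scheme" (structure)
  assumes "noetherian_ring R" and normal: "normal_domain R" and "ideal q R"
    and a: "a \<in> q" "a \<noteq> \<zero>" and b: "b \<in> carrier R"
    and stable: "\<And>x. x \<in> q \<Longrightarrow> \<exists>z\<in>q. b \<otimes> x = z \<otimes> a"
  shows "b \<in> PIdl a"
proof -
  interpret noetherian_ring R by fact
  interpret domain R using normal by (simp add: normal_domain_def)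
  interpret q: ideal q R by fact
  interpret K: mult_subset R "nonzerodivisors R" by (rule nonzerodivisors_mult_subset)
  let ?K = "tot_frac R" and ?\<iota> = "to_tot_frac R"
  have ac: "a \<in> carrier R" using a q.Icarr by blast
  have aS: "a \<in> nonzerodivisors R" using a ac by (simp add: nonzerodivisors_iff)
  define x where "x = loc_frac R (nonzerodivisors R) b a"
  have xc: "x \<in> carrier ?K" using b aS by (simp add: x_def)
  have xa: "?\<iota> a \<otimes>\<^bsub>?K\<^esub> x = ?\<iota> b" unfolding x_def using b aS by (rule K.frac_cancel)
  obtain g where g: "\<And>y. y \<in> q \<Longrightarrow> g y \<in> q \<and> b \<otimes> y = g y \<otimes> a" using stable by metis
  (* t n is a (b / a) ^ n, computed inside q *)
  define t where "t n = (g ^^ n) a" for n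
  have t0: "t 0 = a" and tS: "t (Suc n) = g (t n)" for n by (simp_all add: t_def)
  have tq: "t n \<in> q" for n by (induction n) (use a g in \<open>auto simp: t0 tS\<close>)
  have tc: "t n \<in> carrier R" for n using tq q.Icarr by blast
  have aU: "?\<iota> a \<in> Units ?K" using aS by simp
  have \<iota>t: "?\<iota> (t n) = x [^]\<^bsub>?K\<^esub> n \<otimes>\<^bsub>?K\<^esub> ?\<iota> a" for n
  proof (induction n)
    case 0 then show ?case using ac by (simp add: t0)
  next
    case (Suc n)
    have "?\<iota> a \<otimes>\<^bsub>?K\<^esub> ?\<iota> (t (Suc n)) = ?\<iota> (b \<otimes> t n)"
      using g[OF tq[of n]] tc[of "Suc n"] ac by (simp add: tS m_comm)
    also have "\<dots> = ?\<iota> a \<otimes>\<^bsub>?K\<^esub> (x \<otimes>\<^bsub>?K\<^esub> ?\<iota> (t n))"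
      using b tc ac xc xa by (simp add: K.L.m_assoc[symmetric])
    finally have "?\<iota> (t (Suc n)) = x \<otimes>\<^bsub>?K\<^esub> ?\<iota> (t n)"
      using aU xc tc by (simp add: K.L.Units_l_cancel)
    then show ?case using xc ac by (simp add: Suc K.L.m_ac)
  qed
  obtain n c where c: "c \<in> {..<n} \<rightarrow> carrier R" and rel: "t n \<oplus> (\<Oplus>i\<in>{..<n}. c i \<otimes> t i) = \<zero>"
    and "\<forall>J. ideal J R \<and> (\<forall>i<n. t i \<in> J) \<longrightarrow> t n \<in> J"
    by (rule noetherian_sequence[where t = t, OF noetherian_ring_axioms is_cring tc])
  let ?p = "\<lambda>i. ?\<iota> (c i) \<otimes>\<^bsub>?K\<^esub> x [^]\<^bsub>?K\<^esub> i"
  have ci: "c i \<in> carrier R" if "i < n" for i using c that by auto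
  have pc: "?p \<in> {..<n} \<rightarrow> carrier ?K" using ci xc by auto
  have "?\<iota> (\<Oplus>i\<in>{..<n}. c i \<otimes> t i) = (\<Oplus>\<^bsub>?K\<^esub>i\<in>{..<n}. ?p i \<otimes>\<^bsub>?K\<^esub> ?\<iota> a)"
  proof -
    have "?\<iota> (\<Oplus>i\<in>{..<n}. c i \<otimes> t i) = (\<Oplus>\<^bsub>?K\<^esub>i\<in>{..<n}. (?\<iota> \<circ> (\<lambda>i. c i \<otimes> t i)) i)"
      using ci tc by (subst K.loc_map.hom_finsum) (auto simp: comp_def)
    also have "\<dots> = (\<Oplus>\<^bsub>?K\<^esub>i\<in>{..<n}. ?p i \<otimes>\<^bsub>?K\<^esub> ?\<iota> a)"
      using ci tc xc ac by (intro K.L.finsum_cong') (auto simp: \<iota>t K.L.m_assoc)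
    finally show ?thesis .
  qed
  also have "\<dots> = (\<Oplus>\<^bsub>?K\<^esub>i\<in>{..<n}. ?p i) \<otimes>\<^bsub>?K\<^esub> ?\<iota> a"
    using pc ac by (intro K.L.finsum_ldistr[symmetric]) auto
  finally have sum: "?\<iota> (\<Oplus>i\<in>{..<n}. c i \<otimes> t i) = (\<Oplus>\<^bsub>?K\<^esub>i\<in>{..<n}. ?p i) \<otimes>\<^bsub>?K\<^esub> ?\<iota> a" .
  have sc: "(\<Oplus>\<^bsub>?K\<^esub>i\<in>{..<n}. ?p i) \<in> carrier ?K" using pc by (rule K.L.finsum_closed)
  have rc: "(\<Oplus>i\<in>{..<n}. c i \<otimes> t i) \<in> carrier R" using ci tc by (intro finsum_closed) auto
  define y where "y = x [^]\<^bsub>?K\<^esub> n \<oplus>\<^bsub>?K\<^esub> (\<Oplus>\<^bsub>?K\<^esub>i\<in>{..<n}. ?p i)"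
  have yc: "y \<in> carrier ?K" using sc xc by (simp add: y_def)
  have "y \<otimes>\<^bsub>?K\<^esub> ?\<iota> a
      = ?\<iota> (t n \<oplus> (\<Oplus>i\<in>{..<n}. c i \<otimes> t i))"
    using sc xc ac tc rc by (simp add: y_def sum \<iota>t K.L.l_distr)
  also have "\<dots> = \<zero>\<^bsub>?K\<^esub>" by (simp add: rel)
  finally have "?\<iota> a \<otimes>\<^bsub>?K\<^esub> y = ?\<iota> a \<otimes>\<^bsub>?K\<^esub> \<zero>\<^bsub>?K\<^esub>"
    using yc ac K.L.m_comm[OF yc, of "?\<iota> a"] by simp
  then have "y = \<zero>\<^bsub>?K\<^esub>" using aU yc by (simp add: K.L.Units_l_cancel)
  then have "integral_over R x" using c unfolding integral_over_def y_def by blast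
  then obtain z where z: "z \<in> carrier R" "x = ?\<iota> z"
    using normal xc by (auto simp: normal_domain_def)
  then have "?\<iota> (a \<otimes> z) = ?\<iota> b" using xa ac by simp
  then obtain u where "u \<in> nonzerodivisors R" "u \<otimes> (a \<otimes> z) = u \<otimes> b"
    using K.loc_map_eq_iff[of "a \<otimes> z" b] ac z b by auto
  then have "a \<otimes> z = b" using ac z b by (auto simp: nonzerodivisors_iff m_lcancel)
  then show ?thesis using ac z by (auto simp: cgenideal_def m_comm intro!: exI[of _ z])
qed

text \<open>The local ring of a noetherian normal domain at a prime \<open>q\<close> of height one is a discrete
  valuation ring. Take an associated prime of \<open>a R\<close> near \<open>q\<close>, that is \<open>q = (a : b)\<close> locally; then
  \<open>b / a\<close> maps \<open>q\<close> into \<open>R\<close>, by normality not into \<open>q\<close>, and an element of \<open>q\<close> that it maps to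
  a unit generates \<open>q\<close>.\<close>

theorem normal_height_one_uniformizer:
  fixes R :: "('a, 'm) ring_scheme" (structure)
  assumes "noetherian_ring R" and normal: "normal_domain R" and q: "height_one_prime R q"
  shows "\<exists>\<pi>. uniformizer R q \<pi>"
proof -
  interpret noetherian_ring R by fact
  interpret domain R using normal by (simp add: normal_domain_def)
  interpret noetherian_domain R ..
  have qp: "primeideal q R" and q0: "q \<noteq> {\<zero>}"
    and qmin: "\<And>q'. primeideal q' R \<Longrightarrow> q' \<subseteq> q \<Longrightarrow> q' = {\<zero>} \<or> q' = q"
    using q by (auto simp: height_one_prime_iff)
  interpret q: primeideal q R by (rule qp)
  interpret S: mult_subset R "carrier R - q" using qp by (rule prime_mult_subset)
  obtain a where a: "a \<in> q" "a \<noteq> \<zero>" using q0 q.zero_closed by blast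
  have ac: "a \<in> carrier R" using a q.Icarr by blast
  have J: "ideal (PIdl a) R" using ac by (rule cgenideal_ideal)
  have "PIdl a \<subseteq> q" using a by (intro cgenideal_minimal q.ideal_axioms)
  then have disj: "(carrier R - q) \<inter> PIdl a = {}" by blast
  obtain b where b: "b \<in> carrier R"
    and Ip: "primeideal {x \<in> carrier R. \<exists>s\<in>carrier R - q. s \<otimes> (x \<otimes> b) \<in> PIdl a} R"
    by (rule S.exists_prime_colon[OF noetherian_ring_axioms J disj])
  define I where "I = {x \<in> carrier R. \<exists>s\<in>carrier R - q. s \<otimes> (x \<otimes> b) \<in> PIdl a}"
  interpret I: primeideal I R unfolding I_def by (rule Ip)
  have one_I: "\<one> \<notin> I" using I.one_imp_carrier I.I_notcarr by blast
  have "I \<subseteq> q"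
  proof (rule subsetI, rule ccontr)
    fix x assume "x \<in> I" "x \<notin> q"
    then obtain s where s: "x \<in> carrier R - q" "s \<in> carrier R - q" "s \<otimes> (x \<otimes> b) \<in> PIdl a"
      unfolding I_def by blast
    then have "(s \<otimes> x) \<otimes> (\<one> \<otimes> b) \<in> PIdl a" using b by (simp add: m_assoc)
    then have "\<one> \<in> I" using S.mult_S[OF s(2,1)] one_closed unfolding I_def by blast
    with one_I show False ..
  qed
  moreover have "a \<in> I"
  proof -
    have "\<one> \<otimes> (a \<otimes> b) \<in> PIdl a" using ac b by (auto simp: cgenideal_def m_comm intro!: exI[of _ b])
    then show ?thesis using ac S.one_S unfolding I_def by blast
  qed
  then have "I \<noteq> {\<zero>}" using a by blast
  ultimately have I: "I = q" using qmin I.primeideal by blast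
  (* q is finitely generated, so one factor s0 outside q serves all its elements. *)
  obtain A where A: "A \<subseteq> carrier R" "finite A" "q = Idl A"
    using finetely_gen[OF q.ideal_axioms] by blast
  have "A \<subseteq> I" using A genideal_self I by blast
  from \<open>finite A\<close> this have "\<exists>s\<in>carrier R - q. \<forall>x\<in>A. s \<otimes> (x \<otimes> b) \<in> PIdl a"
  proof (induction A)
    case empty then show ?case using S.one_S by blast
  next
    case (insert x A)
    obtain s where s: "s \<in> carrier R - q" "\<And>y. y \<in> A \<Longrightarrow> s \<otimes> (y \<otimes> b) \<in> PIdl a"
      using insert.IH insert.prems by blast
    have "x \<in> I" using insert.prems by blast
    then obtain s' where s': "s' \<in> carrier R - q" "s' \<otimes> (x \<otimes> b) \<in> PIdl a"
      unfolding I_def by blast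
    have cl: "y \<in> carrier R" if "y \<in> insert x A" for y using insert.prems that I.Icarr by blast
    have "(s \<otimes> s') \<otimes> (y \<otimes> b) \<in> PIdl a" if y: "y \<in> insert x A" for y
    proof (cases "y \<in> A")
      case True
      have "(s \<otimes> s') \<otimes> (y \<otimes> b) = s' \<otimes> (s \<otimes> (y \<otimes> b))" using s(1) s'(1) cl[OF y] b by (simp add: m_ac)
      then show ?thesis using s(2)[OF True] s'(1) ideal.I_l_closed[OF J] by simp
    next
      case False
      have "(s \<otimes> s') \<otimes> (y \<otimes> b) = s \<otimes> (s' \<otimes> (y \<otimes> b))" using s(1) s'(1) cl[OF y] b by (simp add: m_ac)
      then show ?thesis using s'(2) False y s(1) ideal.I_l_closed[OF J] by auto
    qed
    then show ?case using S.mult_S[OF s(1) s'(1)] by blast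
  qed
  then obtain s0 where s0: "s0 \<in> carrier R - q" "\<And>x. x \<in> A \<Longrightarrow> s0 \<otimes> (x \<otimes> b) \<in> PIdl a" by blast
  define b' where "b' = s0 \<otimes> b"
  have b'c: "b' \<in> carrier R" using s0 b by (simp add: b'_def)
  have "q \<subseteq> {x \<in> carrier R. b' \<otimes> x \<in> PIdl a}"
    unfolding A(3)
  proof (rule genideal_minimal)
    show "ideal {x \<in> carrier R. b' \<otimes> x \<in> PIdl a} R"
      using ideal.helper_max_prime[OF J is_cring b'c] .
    show "A \<subseteq> {x \<in> carrier R. b' \<otimes> x \<in> PIdl a}"
    proof
      fix x assume x: "x \<in> A"
      then have xc: "x \<in> carrier R" using A by blast
      have "b' \<otimes> x = s0 \<otimes> (x \<otimes> b)" using xc s0(1) b by (simp add: b'_def m_ac)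
      then show "x \<in> {x \<in> carrier R. b' \<otimes> x \<in> PIdl a}" using s0(2)[OF x] xc by simp
    qed
  qed
  then have quot: "\<exists>z\<in>carrier R. b' \<otimes> x = z \<otimes> a" if "x \<in> q" for x
    using that by (auto simp: cgenideal_def)
  have b'_notin: "b' \<notin> PIdl a"
  proof
    assume "b' \<in> PIdl a"
    then have "s0 \<otimes> (\<one> \<otimes> b) \<in> PIdl a" using b by (simp add: b'_def)
    then have "\<one> \<in> I" using s0(1) unfolding I_def by blast
    with one_I show False ..
  qed
  have "\<not> (\<forall>x\<in>q. \<exists>z\<in>q. b' \<otimes> x = z \<otimes> a)"
    using normal_domain_divides[OF noetherian_ring_axioms normal q.ideal_axioms a b'c] b'_notin
    by blast
  then obtain \<pi> w where \<pi>: "\<pi> \<in> q" and w: "w \<in> carrier R - q" and eq: "b' \<otimes> \<pi> = w \<otimes> a"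
    using quot by blast
  have \<pi>c: "\<pi> \<in> carrier R" using \<pi> q.Icarr by blast
  have b'0: "b' \<noteq> \<zero>" using b'_notin ideal.axioms(1)[OF J] additive_subgroup.zero_closed by metis
  have div: "\<exists>z\<in>carrier R. w \<otimes> x = \<pi> \<otimes> z" if x: "x \<in> q" for x
  proof -
    from quot[OF x] obtain z where z: "z \<in> carrier R" "b' \<otimes> x = z \<otimes> a" by blast
    have xc: "x \<in> carrier R" using x q.Icarr by blast
    have "b' \<otimes> (w \<otimes> x) = w \<otimes> (b' \<otimes> x)" using b'c w xc by (simp add: m_ac)
    also have "\<dots> = z \<otimes> (w \<otimes> a)" unfolding z(2) using z(1) w ac by (simp add: m_ac)
    also have "\<dots> = b' \<otimes> (\<pi> \<otimes> z)" unfolding eq[symmetric] using z(1) \<pi>c b'c by (simp add: m_ac)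
    finally have "w \<otimes> x = \<pi> \<otimes> z" using b'c b'0 w xc \<pi>c z(1) by (simp add: m_lcancel)
    then show ?thesis using z(1) by blast
  qed
  have "\<pi> \<noteq> \<zero>"
  proof
    assume "\<pi> = \<zero>"
    with div[OF a(1)] have "w \<otimes> a = \<zero>" by auto
    then show False using w a ac integral[of w a] by auto
  qed
  from uniformizerI[OF qp \<pi> this w div] show ?thesis by blast
qed

text \<open>In the local ring at \<open>q\<close> a uniformizer generates the maximal ideal, so \<^const>\<open>ring_ord\<close> reads
  off the exponent.\<close>

lemma ring_ord_eq:
  fixes R :: "('a, 'm) ring_scheme" (structure)
  assumes "domain R" "primeideal q R" and \<pi>: "uniformizer R q \<pi>"
    and a: "a \<in> carrier R" and n: "has_order R q \<pi> a n"
  shows "ring_ord R q a = n"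
proof -
  interpret domain R by fact
  interpret q: primeideal q R by fact
  interpret S: mult_subset R "carrier R - q" by (rule prime_mult_subset) fact
  let ?B = "loc_at R q" and ?\<iota> = "to_loc_at R q"
  have \<pi>q: "\<pi> \<in> q" "\<pi> \<noteq> \<zero>" and \<pi>c: "\<pi> \<in> carrier R"
    using \<pi> q.Icarr by (auto simp: uniformizer_def)
  have \<iota>\<pi>: "?\<iota> \<pi> \<in> carrier ?B" using \<pi>c by simp
  have PI: "ideal (PIdl\<^bsub>?B\<^esub> x) ?B" if "x \<in> carrier ?B" for x using that by (rule S.L.cgenideal_ideal)
  have gen: "max_ideal_at R q = PIdl\<^bsub>?B\<^esub> (?\<iota> \<pi>)"
  proof
    have "?\<iota> x \<in> PIdl\<^bsub>?B\<^esub> (?\<iota> \<pi>)" if x: "x \<in> q" for x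
    proof (cases "x = \<zero>")
      case True
      then show ?thesis
        using additive_subgroup.zero_closed[OF ideal.axioms(1)[OF PI[OF \<iota>\<pi>]]] by simp
    next
      case False
      have xc: "x \<in> carrier R" using x q.Icarr by blast
      with False \<pi> obtain k where "has_order R q \<pi> x k" unfolding uniformizer_def by blast
      then obtain s s' where s: "s \<in> carrier R - q" "s' \<in> carrier R - q"
        and eq: "s \<otimes> x = s' \<otimes> \<pi> [^] k" unfolding has_order_def by blast
      have "k \<noteq> 0"
      proof
        assume "k = 0"
        with eq s have "s \<otimes> x = s'" by simp
        moreover have "s \<otimes> x \<in> q" using x s by (simp add: q.I_l_closed)
        ultimately show False using s by simp
      qed
      then obtain m where m: "k = Suc m" by (meson not0_implies_Suc)
      have "?\<iota> s \<otimes>\<^bsub>?B\<^esub> ?\<iota> x = ?\<iota> (s \<otimes> x)" using s xc by simp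
      also have "\<dots> = ?\<iota> (s' \<otimes> \<pi> [^] m) \<otimes>\<^bsub>?B\<^esub> ?\<iota> \<pi>"
        unfolding eq m using s \<pi>c by (simp add: m_assoc[symmetric] S.L.m_assoc[symmetric])
      also have "\<dots> \<in> PIdl\<^bsub>?B\<^esub> (?\<iota> \<pi>)"
        using s \<pi>c unfolding cgenideal_def by blast
      finally show ?thesis using S.unit_cancel_ideal[OF PI[OF \<iota>\<pi>] s(1)] xc by simp
    qed
    then show "max_ideal_at R q \<subseteq> PIdl\<^bsub>?B\<^esub> (?\<iota> \<pi>)"
      unfolding max_ideal_at_def by (intro S.L.genideal_minimal PI \<iota>\<pi>) auto
    have sub: "?\<iota> ` q \<subseteq> carrier ?B" using q.Icarr by auto
    show "PIdl\<^bsub>?B\<^esub> (?\<iota> \<pi>) \<subseteq> max_ideal_at R q"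
      unfolding max_ideal_at_def
      using S.L.genideal_self[OF sub] \<pi>q by (intro S.L.cgenideal_minimal S.L.genideal_ideal sub) blast
  qed
  have pow: "max_ideal_at R q [^]\<^bsub>ideals_set ?B\<^esub> k = PIdl\<^bsub>?B\<^esub> (?\<iota> (\<pi> [^] k))" for k :: nat
  proof (induction k)
    case 0
    then show ?case
      using S.L.genideal_one S.L.cgenideal_eq_genideal[of "\<one>\<^bsub>?B\<^esub>"] by (simp add: ideals_set_def)
  next
    case (Suc k)
    have pk: "?\<iota> (\<pi> [^] k) \<in> carrier ?B" using \<pi>c by simp
    have "max_ideal_at R q [^]\<^bsub>ideals_set ?B\<^esub> Suc k = ideal_prod ?B (PIdl\<^bsub>?B\<^esub> (?\<iota> (\<pi> [^] k))) (PIdl\<^bsub>?B\<^esub> (?\<iota> \<pi>))"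
      using Suc by (simp add: gen ideals_set_def)
    also have "\<dots> = Idl\<^bsub>?B\<^esub> (PIdl\<^bsub>?B\<^esub> (?\<iota> (\<pi> [^] k) \<otimes>\<^bsub>?B\<^esub> ?\<iota> \<pi>))"
      unfolding S.L.ideal_prod_eq_genideal[OF PI[OF pk] PI[OF \<iota>\<pi>]] S.L.cgenideal_prod[OF pk \<iota>\<pi>] ..
    also have "\<dots> = PIdl\<^bsub>?B\<^esub> (?\<iota> (\<pi> [^] k) \<otimes>\<^bsub>?B\<^esub> ?\<iota> \<pi>)"
    proof
      let ?J = "PIdl\<^bsub>?B\<^esub> (?\<iota> (\<pi> [^] k) \<otimes>\<^bsub>?B\<^esub> ?\<iota> \<pi>)"
      have J: "ideal ?J ?B" using pk \<iota>\<pi> by (intro PI) simp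
      show "Idl\<^bsub>?B\<^esub> ?J \<subseteq> ?J" using J by (intro S.L.genideal_minimal) auto
      show "?J \<subseteq> Idl\<^bsub>?B\<^esub> ?J" using ideal.Icarr[OF J] by (intro S.L.genideal_self) blast
    qed
    finally show ?case using \<pi>c by simp
  qed
  obtain s s' where s: "s \<in> carrier R - q" "s' \<in> carrier R - q" and eq: "s \<otimes> a = s' \<otimes> \<pi> [^] n"
    using n by (auto simp: has_order_def)
  show ?thesis
    unfolding ring_ord_def pow
  proof (rule Greatest_equality)
    have "?\<iota> s \<otimes>\<^bsub>?B\<^esub> ?\<iota> a = ?\<iota> (s \<otimes> a)" using s a by simp
    also have "\<dots> = ?\<iota> s' \<otimes>\<^bsub>?B\<^esub> ?\<iota> (\<pi> [^] n)" unfolding eq using s \<pi>c by simp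
    also have "\<dots> \<in> PIdl\<^bsub>?B\<^esub> (?\<iota> (\<pi> [^] n))"
      using s unfolding cgenideal_def by blast
    finally show "?\<iota> a \<in> PIdl\<^bsub>?B\<^esub> (?\<iota> (\<pi> [^] n))"
      using a \<pi>c s(1) by (intro S.unit_cancel_ideal[OF PI, of "?\<iota> (\<pi> [^] n)" s "?\<iota> a"]) auto
  next
    fix k :: nat assume "?\<iota> a \<in> PIdl\<^bsub>?B\<^esub> (?\<iota> (\<pi> [^] k))"
    then obtain y where "y \<in> carrier ?B" and y: "?\<iota> a = y \<otimes>\<^bsub>?B\<^esub> ?\<iota> (\<pi> [^] k)"
      by (auto simp: cgenideal_def)
    then obtain x t where x: "x \<in> carrier R" "t \<in> carrier R - q" "y = loc_frac R (carrier R - q) x t"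
      by (metis S.loc_cases)
    have "?\<iota> (t \<otimes> a) = ?\<iota> t \<otimes>\<^bsub>?B\<^esub> y \<otimes>\<^bsub>?B\<^esub> ?\<iota> (\<pi> [^] k)"
      using x(2) a y \<open>y \<in> carrier ?B\<close> \<pi>c S.L.m_assoc[of "?\<iota> t" y "?\<iota> (\<pi> [^] k)"] by simp
    also have "\<dots> = ?\<iota> (x \<otimes> \<pi> [^] k)"
      unfolding x(3) S.frac_cancel[OF x(1,2)] using x \<pi>c by simp
    finally obtain u where u: "u \<in> carrier R - q" "u \<otimes> (t \<otimes> a) = u \<otimes> (x \<otimes> \<pi> [^] k)"
      using S.loc_map_eq_iff[of "t \<otimes> a" "x \<otimes> \<pi> [^] k"] x a \<pi>c by auto
    have "u \<noteq> \<zero>" using u by auto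
    then have ta: "t \<otimes> a = x \<otimes> \<pi> [^] k" using u x a \<pi>c by (auto simp: m_lcancel)
    show "k \<le> n"
    proof (rule ccontr)
      assume "\<not> k \<le> n"
      then obtain m where m: "k = n + Suc m" using less_imp_Suc_add[of n k] by auto
      define v where "v = \<pi> [^] m"
      define w where "w = \<pi> [^] n"
      have vw: "v \<in> carrier R" "w \<in> carrier R" using \<pi>c by (simp_all add: v_def w_def)
      have \<pi>k: "\<pi> [^] k = w \<otimes> (v \<otimes> \<pi>)"
        unfolding w_def v_def m using nat_pow_mult[OF \<pi>c, of n "Suc m"] by simp
      have "w \<otimes> (t \<otimes> s') = t \<otimes> (s' \<otimes> w)" using x(1,2) s vw by (simp add: m_ac)
      also have "\<dots> = s \<otimes> (t \<otimes> a)"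
        using eq m_lcomm[of s t a] x(2) s a by (simp add: w_def)
      also have "\<dots> = w \<otimes> (s \<otimes> x \<otimes> v \<otimes> \<pi>)"
        unfolding ta \<pi>k using x(1,2) s(1) vw \<pi>c by (simp add: m_ac)
      finally have "\<pi> [^] n \<otimes> (t \<otimes> s') = \<pi> [^] n \<otimes> (s \<otimes> x \<otimes> \<pi> [^] m \<otimes> \<pi>)"
        by (simp only: v_def w_def)
      moreover have "\<pi> [^] n \<noteq> \<zero>" using \<pi>q \<pi>c by (induction n) (auto simp: integral_iff)
      moreover have cl: "t \<otimes> s' \<in> carrier R" "s \<otimes> x \<otimes> \<pi> [^] m \<otimes> \<pi> \<in> carrier R" "\<pi> [^] n \<in> carrier R"
        using x(1,2) s(1,2) \<pi>c by auto
      ultimately have "t \<otimes> s' = s \<otimes> x \<otimes> \<pi> [^] m \<otimes> \<pi>"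
        using m_lcancel[OF _ cl(3,1,2)] by blast
      moreover have "s \<otimes> x \<otimes> \<pi> [^] m \<otimes> \<pi> \<in> q"
        by (rule q.I_l_closed) (use \<pi>q x(1,2) s(1) \<pi>c in auto)
      ultimately show False using S.mult_S[OF x(2) s(2)] by simp
    qed
  qed
qed

section \<open>Primes of a localization\<close>

definition loc_ext :: "('a, 'm) ring_scheme \<Rightarrow> 'a set \<Rightarrow> 'a set \<Rightarrow> ('a \<times> 'a) set set" where
  "loc_ext R S q = {loc_frac R S a s | a s. a \<in> q \<and> s \<in> S}"

definition loc_contr :: "('a, 'm) ring_scheme \<Rightarrow> 'a set \<Rightarrow> ('a \<times> 'a) set set \<Rightarrow> 'a set" where
  "loc_contr R S Q = {r \<in> carrier R. loc_map R S r \<in> Q}"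

context mult_subset
begin

declare S_closed [simp, intro]

lemma loc_ext_ideal:
  assumes "ideal q R"
  shows "ideal (loc_ext R S q) L"
proof -
  interpret q: ideal q R by fact
  show ?thesis
  proof (rule idealI)
    show "ring L" by (rule L.ring_axioms)
    show "subgroup (loc_ext R S q) (add_monoid L)"
    proof (rule L.add.subgroupI)
      show "loc_ext R S q \<subseteq> carrier L" using q.Icarr by (auto simp: loc_ext_def)
      have "frac \<zero> \<one> \<in> loc_ext R S q" using q.zero_closed one_S unfolding loc_ext_def by blast
      then show "loc_ext R S q \<noteq> {}" by blast
    next
      fix x assume "x \<in> loc_ext R S q"
      then obtain a s where x: "x = frac a s" "a \<in> q" "s \<in> S" by (auto simp: loc_ext_def)
      have ac: "a \<in> carrier R" using x q.Icarr by blast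
      have "frac (\<ominus> a) s \<oplus>\<^bsub>L\<^esub> x = \<zero>\<^bsub>L\<^esub>"
        using x ac by (simp add: frac_add loc_zero, intro frac_eqI) (auto simp: l_minus l_neg)
      then have "\<ominus>\<^bsub>L\<^esub> x = frac (\<ominus> a) s" using x ac by (intro L.minus_equality) auto
      moreover have "\<ominus> a \<in> q" using x by simp
      ultimately show "\<ominus>\<^bsub>L\<^esub> x \<in> loc_ext R S q" using x by (auto simp: loc_ext_def)
    next
      fix x y assume "x \<in> loc_ext R S q" "y \<in> loc_ext R S q"
      then obtain a s b t where x: "x = frac a s" "a \<in> q" "s \<in> S" and y: "y = frac b t" "b \<in> q" "t \<in> S"
        by (auto simp: loc_ext_def)
      have "x \<oplus>\<^bsub>L\<^esub> y = frac (a \<otimes> t \<oplus> b \<otimes> s) (s \<otimes> t)" using x y q.Icarr by (simp add: frac_add)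
      moreover have "a \<otimes> t \<oplus> b \<otimes> s \<in> q" using x y by (intro q.a_closed q.I_r_closed) auto
      ultimately show "x \<oplus>\<^bsub>L\<^esub> y \<in> loc_ext R S q" using x y by (auto simp: loc_ext_def)
    qed
  next
    fix x y assume "x \<in> loc_ext R S q" "y \<in> carrier L"
    then obtain a s b t where x: "x = frac a s" "a \<in> q" "s \<in> S"
      and y: "y = frac b t" "b \<in> carrier R" "t \<in> S"
      by (auto simp: loc_ext_def elim: loc_cases)
    have "y \<otimes>\<^bsub>L\<^esub> x = frac (b \<otimes> a) (t \<otimes> s)" using x y q.Icarr by (simp add: frac_mult)
    moreover have "b \<otimes> a \<in> q" using x y by (intro q.I_l_closed) auto
    ultimately show "y \<otimes>\<^bsub>L\<^esub> x \<in> loc_ext R S q" using x y by (auto simp: loc_ext_def)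
    then show "x \<otimes>\<^bsub>L\<^esub> y \<in> loc_ext R S q" using x y q.Icarr by (simp add: L.m_comm)
  qed
qed

lemma frac_in_loc_ext_iff:
  assumes "primeideal q R" "q \<inter> S = {}" "a \<in> carrier R" "s \<in> S"
  shows "frac a s \<in> loc_ext R S q \<longleftrightarrow> a \<in> q"
proof
  interpret q: primeideal q R by fact
  assume "frac a s \<in> loc_ext R S q"
  then obtain b t where b: "frac a s = frac b t" "b \<in> q" "t \<in> S" by (auto simp: loc_ext_def)
  have bc: "b \<in> carrier R" using b(2) q.Icarr by blast
  obtain u where u: "u \<in> S" "u \<otimes> (a \<otimes> t) = u \<otimes> (b \<otimes> s)"
    using b(1) frac_eq_iff[OF assms(3) bc assms(4) b(3)] by blast
  have "u \<otimes> (b \<otimes> s) \<in> q" using b u assms by (intro q.I_l_closed q.I_r_closed) auto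
  then have "u \<in> q \<or> a \<in> q \<or> t \<in> q"
    using u b assms q.I_prime[of u "a \<otimes> t"] q.I_prime[of a t] by auto
  then show "a \<in> q" using u(1) b(3) assms(2) by blast
qed (use assms in \<open>auto simp: loc_ext_def\<close>)

lemma loc_map_in_loc_ext_iff:
  assumes "primeideal q R" "q \<inter> S = {}" "a \<in> carrier R"
  shows "loc_map R S a \<in> loc_ext R S q \<longleftrightarrow> a \<in> q"
  using frac_in_loc_ext_iff[OF assms one_S] by (simp add: loc_map_def)

lemma loc_ext_prime:
  assumes q: "primeideal q R" "q \<inter> S = {}"
  shows "primeideal (loc_ext R S q) L"
proof (rule primeidealI)
  interpret q: primeideal q R by fact
  show "ideal (loc_ext R S q) L" by (rule loc_ext_ideal) (rule q.ideal_axioms)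
  show "cring L" by (rule loc_cring)
  have "\<one> \<notin> q" using q by blast
  then have "loc_map R S \<one> \<notin> loc_ext R S q" using loc_map_in_loc_ext_iff[OF q one_closed] by blast
  then show "carrier L \<noteq> loc_ext R S q" using loc_map.hom_closed[OF one_closed] by blast
  fix x y assume xy: "x \<in> carrier L" "y \<in> carrier L" "x \<otimes>\<^bsub>L\<^esub> y \<in> loc_ext R S q"
  obtain a s where x: "a \<in> carrier R" "s \<in> S" "x = frac a s" using xy(1) by (rule loc_cases)
  obtain b t where y: "b \<in> carrier R" "t \<in> S" "y = frac b t" using xy(2) by (rule loc_cases)
  show "x \<in> loc_ext R S q \<or> y \<in> loc_ext R S q"
    using xy(3) x y q q.I_prime[of a b] by (simp add: frac_mult frac_in_loc_ext_iff)
qed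

lemma loc_contr_prime:
  assumes "primeideal Q L"
  shows "primeideal (loc_contr R S Q) R" "loc_contr R S Q \<inter> S = {}"
proof -
  interpret Q: primeideal Q L by fact
  have one: "\<one>\<^bsub>L\<^esub> \<notin> Q" using Q.one_imp_carrier Q.I_notcarr by blast
  show "primeideal (loc_contr R S Q) R"
  proof (rule primeidealI)
    show "ideal (loc_contr R S Q) R"
    proof (rule idealI)
      show "ring R" by (rule ring_axioms)
      show "subgroup (loc_contr R S Q) (add_monoid R)"
        by (rule add.subgroupI) (auto simp: loc_contr_def intro!: exI[of _ \<zero>])
    qed (auto simp: loc_contr_def intro: Q.I_l_closed Q.I_r_closed)
    show "cring R" by (rule is_cring)
    have "\<one> \<notin> loc_contr R S Q" using one by (simp add: loc_contr_def)
    then show "carrier R \<noteq> loc_contr R S Q" using one_closed by blast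
  next
    fix a b assume "a \<in> carrier R" "b \<in> carrier R" "a \<otimes> b \<in> loc_contr R S Q"
    then show "a \<in> loc_contr R S Q \<or> b \<in> loc_contr R S Q"
      using Q.I_prime[of "loc_map R S a" "loc_map R S b"] by (simp add: loc_contr_def)
  qed
  show "loc_contr R S Q \<inter> S = {}"
  proof (rule ccontr)
    assume "loc_contr R S Q \<inter> S \<noteq> {}"
    then obtain s where s: "s \<in> S" "loc_map R S s \<in> Q" by (auto simp: loc_contr_def)
    have "\<one>\<^bsub>L\<^esub> \<in> Q"
      by (rule unit_cancel_ideal[OF Q.ideal_axioms s(1)]) (use s in simp_all)
    with one show False ..
  qed
qed

lemma loc_ext_contr:
  assumes "ideal Q L"
  shows "loc_ext R S (loc_contr R S Q) = Q"
proof -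
  interpret Q: ideal Q L by fact
  have "x \<in> Q" if "x \<in> loc_ext R S (loc_contr R S Q)" for x
  proof -
    from that obtain a s where x: "x = frac a s" "a \<in> carrier R" "s \<in> S" "loc_map R S a \<in> Q"
      by (auto simp: loc_ext_def loc_contr_def)
    then show ?thesis
      using unit_cancel_ideal[OF assms x(3), of x] frac_cancel[of a s] by simp
  qed
  moreover have "x \<in> loc_ext R S (loc_contr R S Q)" if x: "x \<in> Q" for x
  proof -
    obtain a s where a: "a \<in> carrier R" "s \<in> S" "x = frac a s"
      using Q.Icarr[OF x] by (rule loc_cases)
    have "loc_map R S a \<in> Q"
      using Q.I_l_closed[OF x, of "loc_map R S s"] a by (simp add: frac_cancel)
    then show ?thesis using a by (auto simp: loc_ext_def loc_contr_def)
  qed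
  ultimately show ?thesis by blast
qed

lemma loc_contr_ext:
  assumes q: "primeideal q R" "q \<inter> S = {}"
  shows "loc_contr R S (loc_ext R S q) = q"
proof -
  interpret q: primeideal q R by fact
  show ?thesis
    unfolding loc_contr_def using loc_map_in_loc_ext_iff[OF q] q.Icarr by blast
qed

lemma frac_eq_iff_domain:
  assumes "domain R" "\<zero> \<notin> S" "a \<in> carrier R" "b \<in> carrier R" "s \<in> S" "t \<in> S"
  shows "frac a s = frac b t \<longleftrightarrow> a \<otimes> t = b \<otimes> s"
proof -
  interpret domain R by fact
  have cl: "a \<otimes> t \<in> carrier R" "b \<otimes> s \<in> carrier R" using assms by auto
  have "u \<otimes> (a \<otimes> t) = u \<otimes> (b \<otimes> s) \<longleftrightarrow> a \<otimes> t = b \<otimes> s" if "u \<in> S" for u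
  proof (rule m_lcancel[OF _ S_closed[OF that] cl])
    show "u \<noteq> \<zero>" using that assms(2) by metis
  qed
  then show ?thesis
    using assms(3-) one_S by (auto simp: frac_eq_iff)
qed

lemma loc_map_eq_zero_iff_domain:
  assumes "domain R" "\<zero> \<notin> S" "a \<in> carrier R"
  shows "loc_map R S a = \<zero>\<^bsub>L\<^esub> \<longleftrightarrow> a = \<zero>"
  using assms by (simp add: loc_map_def loc_zero frac_eq_iff_domain)

lemma frac_eq_zero_iff_domain:
  assumes "domain R" "\<zero> \<notin> S" "a \<in> carrier R" "s \<in> S"
  shows "frac a s = \<zero>\<^bsub>L\<^esub> \<longleftrightarrow> a = \<zero>"
  using assms by (simp add: loc_zero frac_eq_iff_domain)

lemma loc_domain:
  assumes "domain R" "\<zero> \<notin> S"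
  shows "domain L"
proof (rule domainI)
  interpret domain R by fact
  show "cring L" by (rule loc_cring)
  show "\<one>\<^bsub>L\<^esub> \<noteq> \<zero>\<^bsub>L\<^esub>"
    using loc_map_eq_zero_iff_domain[OF assms one_closed] by simp
  fix x y assume xy: "x \<otimes>\<^bsub>L\<^esub> y = \<zero>\<^bsub>L\<^esub>" "x \<in> carrier L" "y \<in> carrier L"
  obtain a s where x: "a \<in> carrier R" "s \<in> S" "x = frac a s" using xy(2) by (rule loc_cases)
  obtain b t where y: "b \<in> carrier R" "t \<in> S" "y = frac b t" using xy(3) by (rule loc_cases)
  show "x = \<zero>\<^bsub>L\<^esub> \<or> y = \<zero>\<^bsub>L\<^esub>"
    using xy(1) x y assms by (simp add: frac_mult frac_eq_zero_iff_domain integral_iff)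
qed

lemma loc_ext_zero: "loc_ext R S {\<zero>} = {\<zero>\<^bsub>L\<^esub>}"
proof -
  have "frac \<zero> s = \<zero>\<^bsub>L\<^esub>" if "s \<in> S" for s
    using that unfolding loc_zero by (rule frac_zero_eq)
  then show ?thesis using one_S by (auto simp: loc_ext_def)
qed

lemma height_one_loc_ext:
  assumes "domain R" "\<zero> \<notin> S" and q: "height_one_prime R q" "q \<inter> S = {}"
  shows "height_one_prime L (loc_ext R S q)"
proof -
  interpret domain R by fact
  interpret LD: domain L using assms(1,2) by (rule loc_domain)
  have qp: "primeideal q R" and q0: "q \<noteq> {\<zero>}"
    and qmin: "\<And>q'. primeideal q' R \<Longrightarrow> q' \<subseteq> q \<Longrightarrow> q' = {\<zero>} \<or> q' = q"
    using q by (auto simp: height_one_prime_iff)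
  have "loc_ext R S q \<noteq> {\<zero>\<^bsub>L\<^esub>}"
  proof
    assume "loc_ext R S q = {\<zero>\<^bsub>L\<^esub>}"
    then have "loc_contr R S (loc_ext R S q) \<subseteq> {\<zero>}"
      using assms(1,2) by (auto simp: loc_contr_def loc_map_eq_zero_iff_domain)
    moreover have "\<zero> \<in> q"
      using qp by (meson additive_subgroup.zero_closed ideal.axioms(1) primeideal.axioms(1))
    ultimately show False using q0 qp q(2) by (auto simp: loc_contr_ext)
  qed
  moreover have "Q = {\<zero>\<^bsub>L\<^esub>} \<or> Q = loc_ext R S q" if Q: "primeideal Q L" "Q \<subseteq> loc_ext R S q" for Q
  proof -
    have "loc_contr R S Q \<subseteq> loc_contr R S (loc_ext R S q)" using Q(2) by (auto simp: loc_contr_def)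
    then have "loc_contr R S Q = {\<zero>} \<or> loc_contr R S Q = q"
      using qmin loc_contr_prime(1)[OF Q(1)] loc_contr_ext[OF qp q(2)] by simp
    then show ?thesis
      using loc_ext_contr[OF primeideal.axioms(1)[OF Q(1)]] by (auto simp: loc_ext_zero)
  qed
  ultimately show ?thesis
    using loc_ext_prime[OF qp q(2)] by (auto simp: LD.height_one_prime_iff)
qed

lemma height_one_loc_contr:
  assumes "domain R" "\<zero> \<notin> S" and Q: "height_one_prime L Q"
  shows "height_one_prime R (loc_contr R S Q)"
proof -
  interpret domain R by fact
  interpret LD: domain L using assms(1,2) by (rule loc_domain)
  have Qp: "primeideal Q L" and Q0: "Q \<noteq> {\<zero>\<^bsub>L\<^esub>}"
    and Qmin: "\<And>q'. primeideal q' L \<Longrightarrow> q' \<subseteq> Q \<Longrightarrow> q' = {\<zero>\<^bsub>L\<^esub>} \<or> q' = Q"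
    using Q by (auto simp: LD.height_one_prime_iff)
  note EC = loc_ext_contr[OF primeideal.axioms(1)[OF Qp]]
  have "loc_contr R S Q \<noteq> {\<zero>}" using Q0 EC by (auto simp: loc_ext_zero)
  moreover have "q = {\<zero>} \<or> q = loc_contr R S Q"
    if q: "primeideal q R" "q \<subseteq> loc_contr R S Q" for q
  proof -
    have disj: "q \<inter> S = {}" using q(2) loc_contr_prime(2)[OF Qp] by blast
    have "loc_ext R S q \<subseteq> Q" using q(2) EC by (auto simp: loc_ext_def)
    then have "loc_ext R S q = {\<zero>\<^bsub>L\<^esub>} \<or> loc_ext R S q = Q"
      using Qmin loc_ext_prime[OF q(1) disj] by blast
    moreover have "loc_contr R S {\<zero>\<^bsub>L\<^esub>} = {\<zero>}"
      using assms(1,2) by (auto simp: loc_contr_def loc_map_eq_zero_iff_domain)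
    ultimately show ?thesis using loc_contr_ext[OF q(1) disj] by metis
  qed
  ultimately show ?thesis
    using loc_contr_prime(1)[OF Qp] by (auto simp: height_one_prime_iff)
qed

lemma has_order_loc:
  assumes q: "primeideal q R" "q \<inter> S = {}" and cl: "\<pi> \<in> carrier R" "a \<in> carrier R" "s \<in> S"
    and n: "has_order R q \<pi> a n"
  shows "has_order L (loc_ext R S q) (loc_map R S \<pi>) (frac a s) n"
proof -
  interpret q: primeideal q R by fact
  obtain u u' where u: "u \<in> carrier R - q" "u' \<in> carrier R - q" and eq: "u \<otimes> a = u' \<otimes> \<pi> [^] n"
    using n unfolding has_order_def by blast
  have "u \<otimes> s \<notin> q" using u cl(3) q q.I_prime[of u s] by blast
  then have us: "loc_map R S (u \<otimes> s) \<in> carrier L - loc_ext R S q"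
    using u cl q by (simp add: loc_map_in_loc_ext_iff del: loc_map.hom_mult)
  have u': "loc_map R S u' \<in> carrier L - loc_ext R S q"
    using u q by (simp add: loc_map_in_loc_ext_iff)
  have "loc_map R S (u \<otimes> s) \<otimes>\<^bsub>L\<^esub> frac a s = loc_map R S u \<otimes>\<^bsub>L\<^esub> loc_map R S a"
    using u cl frac_cancel[of a s] by (simp add: L.m_assoc)
  also have "\<dots> = loc_map R S (u' \<otimes> \<pi> [^] n)" using u cl by (simp add: eq[symmetric])
  also have "\<dots> = loc_map R S u' \<otimes>\<^bsub>L\<^esub> loc_map R S \<pi> [^]\<^bsub>L\<^esub> n"
    using u cl by (simp add: loc_map_pow)
  finally show ?thesis by (rule has_orderI[OF us u'])
qed

lemma uniformizer_loc:
  assumes "domain R" "\<zero> \<notin> S" and q: "primeideal q R" "q \<inter> S = {}" and \<pi>: "uniformizer R q \<pi>"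
  shows "uniformizer L (loc_ext R S q) (loc_map R S \<pi>)"
proof -
  interpret q: primeideal q R by fact
  have \<pi>': "\<pi> \<in> q" "\<pi> \<noteq> \<zero>" "\<pi> \<in> carrier R" using \<pi> q.Icarr by (auto simp: uniformizer_def)
  have "\<exists>n. has_order L (loc_ext R S q) (loc_map R S \<pi>) x n" if x: "x \<in> carrier L" "x \<noteq> \<zero>\<^bsub>L\<^esub>" for x
  proof -
    obtain a s where a: "a \<in> carrier R" "s \<in> S" "x = frac a s" using x(1) by (rule loc_cases)
    then have "a \<noteq> \<zero>" using x(2) assms(1,2) by (simp add: frac_eq_zero_iff_domain)
    then obtain n where "has_order R q \<pi> a n" using \<pi> a(1) unfolding uniformizer_def by blast
    then show ?thesis using has_order_loc[OF q \<pi>'(3) a(1,2)] a(3) by blast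
  qed
  moreover have "loc_map R S \<pi> \<in> loc_ext R S q"
    using \<pi>' q by (simp add: loc_map_in_loc_ext_iff)
  moreover have "loc_map R S \<pi> \<noteq> \<zero>\<^bsub>L\<^esub>" using \<pi>' assms(1,2) by (simp add: loc_map_eq_zero_iff_domain)
  ultimately show ?thesis by (auto simp: uniformizer_def)
qed

declare S_closed [simp del, rule del]

end

lemma max_ideal_at_cases:
  assumes P: "primeideal P R" and f: "f \<in> max_ideal_at R P"
  obtains x t where "x \<in> P" "t \<in> carrier R - P" "f = loc_frac R (carrier R - P) x t"
proof -
  interpret P: primeideal P R by fact
  interpret S: mult_subset R "carrier R - P" by (rule prime_mult_subset) fact
  have "to_loc_at R P ` P \<subseteq> loc_ext R (carrier R - P) P"
    using S.one_S by (auto simp: loc_ext_def loc_map_def)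
  then have "max_ideal_at R P \<subseteq> loc_ext R (carrier R - P) P"
    unfolding max_ideal_at_def
    by (intro S.L.genideal_minimal S.loc_ext_ideal P.ideal_axioms)
  with f that show ?thesis by (auto simp: loc_ext_def)
qed

lemma max_ideal_atI:
  assumes P: "primeideal P R" and x: "x \<in> P"
  shows "to_loc_at R P x \<in> max_ideal_at R P"
proof -
  interpret P: primeideal P R by fact
  interpret S: mult_subset R "carrier R - P" by (rule prime_mult_subset) fact
  have "to_loc_at R P ` P \<subseteq> carrier (loc_at R P)" using P.Icarr by auto
  from S.L.genideal_self[OF this] x show ?thesis by (auto simp: max_ideal_at_def)
qed

section \<open>Sections of divisors\<close>

text \<open>A domain has uniformizers if its local rings at the primes of height one are discrete
  valuation rings. It passes to localizations because the uniformizers can be kept.\<close>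

definition has_uniformizers :: "('a, 'm) ring_scheme \<Rightarrow> bool" where
  "has_uniformizers R \<longleftrightarrow> domain R \<and> (\<forall>q. height_one_prime R q \<longrightarrow> (\<exists>\<pi>. uniformizer R q \<pi>))"

lemma normal_has_uniformizers:
  assumes "noetherian_ring R" "normal_domain R"
  shows "has_uniformizers R"
  using normal_height_one_uniformizer[OF assms] assms(2)
  by (simp add: has_uniformizers_def normal_domain_def)

lemma (in mult_subset) loc_has_uniformizers:
  assumes R: "has_uniformizers R" and S: "\<zero> \<notin> S"
  shows "has_uniformizers L"
proof -
  interpret domain R using R by (simp add: has_uniformizers_def)
  interpret LD: domain L using domain_axioms S by (rule loc_domain)
  have "\<exists>\<pi>. uniformizer L Q \<pi>" if Q: "height_one_prime L Q" for Q
  proof -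
    have Qp: "primeideal Q L" using Q by (simp add: height_one_prime_def)
    have q: "height_one_prime R (loc_contr R S Q)"
      using height_one_loc_contr[OF domain_axioms S Q] .
    then obtain \<pi> where "uniformizer R (loc_contr R S Q) \<pi>" using R by (auto simp: has_uniformizers_def)
    from uniformizer_loc[OF domain_axioms S loc_contr_prime[OF Qp] this]
    show ?thesis using loc_ext_contr[OF primeideal.axioms(1)[OF Qp]] by auto
  qed
  then show ?thesis using LD.domain_axioms by (simp add: has_uniformizers_def)
qed

text \<open>All orders along \<open>q\<close> are computed with one uniformizer. The rules of a valuation then come
  from multiplying and adding equations of the form \<open>s a = s' \<pi>\<^sup>n\<close>.\<close>

locale height_one_valuation = domain R for R (structure) +
  fixes q \<pi>
  assumes qp: "primeideal q R" and unif: "uniformizer R q \<pi>"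
begin

sublocale q: primeideal q R by (rule qp)

lemma uniformizer_closed: "\<pi> \<in> q" "\<pi> \<noteq> \<zero>" "\<pi> \<in> carrier R"
  using unif q.Icarr by (auto simp: uniformizer_def)

lemma notin_mult: "\<lbrakk>s \<in> carrier R - q; t \<in> carrier R - q\<rbrakk> \<Longrightarrow> s \<otimes> t \<in> carrier R - q"
  using q.I_prime[of s t] by auto

lemma one_notin: "\<one> \<in> carrier R - q"
  using q.one_imp_carrier q.I_notcarr by blast

lemma ring_ordI: "\<lbrakk>a \<in> carrier R; has_order R q \<pi> a n\<rbrakk> \<Longrightarrow> ring_ord R q a = n"
  by (rule ring_ord_eq[OF domain_axioms qp unif])

lemma has_order_ring_ord:
  assumes "a \<in> carrier R" "a \<noteq> \<zero>"
  shows "has_order R q \<pi> a (ring_ord R q a)"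
proof -
  obtain n where "has_order R q \<pi> a n" using unif assms unfolding uniformizer_def by blast
  with ring_ordI[OF assms(1) this] show ?thesis by simp
qed

lemma ring_ord_mult:
  assumes a: "a \<in> carrier R" "a \<noteq> \<zero>" and b: "b \<in> carrier R" "b \<noteq> \<zero>"
  shows "ring_ord R q (a \<otimes> b) = ring_ord R q a + ring_ord R q b"
proof (rule ring_ordI)
  obtain s s' where s: "s \<in> carrier R - q" "s' \<in> carrier R - q" "s \<otimes> a = s' \<otimes> \<pi> [^] ring_ord R q a"
    using has_order_ring_ord[OF a] unfolding has_order_def by blast
  obtain t t' where t: "t \<in> carrier R - q" "t' \<in> carrier R - q" "t \<otimes> b = t' \<otimes> \<pi> [^] ring_ord R q b"
    using has_order_ring_ord[OF b] unfolding has_order_def by blast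
  have cl: "s \<in> carrier R" "s' \<in> carrier R" "t \<in> carrier R" "t' \<in> carrier R" using s t by auto
  have "(s \<otimes> t) \<otimes> (a \<otimes> b) = (s \<otimes> a) \<otimes> (t \<otimes> b)" using cl a b by (simp add: m_ac)
  also have "\<dots> = (s' \<otimes> t') \<otimes> (\<pi> [^] ring_ord R q a \<otimes> \<pi> [^] ring_ord R q b)"
    unfolding s(3) t(3) using cl uniformizer_closed by (simp add: m_ac)
  also have "\<dots> = (s' \<otimes> t') \<otimes> \<pi> [^] (ring_ord R q a + ring_ord R q b)"
    using uniformizer_closed by (simp add: nat_pow_mult)
  finally show "has_order R q \<pi> (a \<otimes> b) (ring_ord R q a + ring_ord R q b)"
    by (rule has_orderI[OF notin_mult[OF s(1) t(1)] notin_mult[OF s(2) t(2)]])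
qed (use a b in simp)

lemma ring_ord_notin:
  assumes "a \<in> carrier R - q"
  shows "ring_ord R q a = 0"
proof (rule ring_ordI)
  show "has_order R q \<pi> a 0"
    using assms by (intro has_orderI[OF one_notin assms]) auto
qed (use assms in simp)

lemma ring_ord_pos:
  assumes "a \<in> q" "a \<noteq> \<zero>"
  shows "ring_ord R q a \<ge> 1"
proof (rule ccontr)
  assume "\<not> ring_ord R q a \<ge> 1"
  then have "ring_ord R q a = 0" by simp
  then have "has_order R q \<pi> a 0"
    using has_order_ring_ord[OF q.Icarr[OF assms(1)] assms(2)] by metis
  then obtain s s' where s: "s \<in> carrier R - q" "s' \<in> carrier R - q" "s \<otimes> a = s' \<otimes> \<pi> [^] (0::nat)"
    unfolding has_order_def by blast
  then have "s' = s \<otimes> a" by simp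
  moreover have "s \<otimes> a \<in> q" using s assms by (intro q.I_l_closed) auto
  ultimately show False using s by blast
qed

lemma ring_ord_add:
  assumes a: "a \<in> carrier R" "a \<noteq> \<zero>" and b: "b \<in> carrier R" "b \<noteq> \<zero>" and ab: "a \<oplus> b \<noteq> \<zero>"
  shows "ring_ord R q (a \<oplus> b) \<ge> min (ring_ord R q a) (ring_ord R q b)"
proof (rule ccontr)
  define k where "k = min (ring_ord R q a) (ring_ord R q b)"
  define l where "l = ring_ord R q (a \<oplus> b)"
  assume "\<not> ?thesis"
  then have "l < k" unfolding k_def l_def by (simp only: not_le)
  have pi_split: "\<exists>z\<in>carrier R. \<pi> [^] n = \<pi> [^] l \<otimes> (z \<otimes> \<pi>)" if "n \<ge> k" for n :: nat
  proof -
    have "l < n" using that \<open>l < k\<close> by simp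
    then obtain i where "n = l + Suc i" using less_imp_Suc_add[of l n] by auto
    then have "\<pi> [^] n = \<pi> [^] l \<otimes> (\<pi> [^] i \<otimes> \<pi>)"
      using nat_pow_mult[OF uniformizer_closed(3), of l "Suc i"] by simp
    then show ?thesis using uniformizer_closed by blast
  qed
  obtain s s' where s: "s \<in> carrier R - q" "s' \<in> carrier R - q" "s \<otimes> a = s' \<otimes> \<pi> [^] ring_ord R q a"
    using has_order_ring_ord[OF a] unfolding has_order_def by blast
  obtain t t' where t: "t \<in> carrier R - q" "t' \<in> carrier R - q" "t \<otimes> b = t' \<otimes> \<pi> [^] ring_ord R q b"
    using has_order_ring_ord[OF b] unfolding has_order_def by blast
  obtain u u' where u: "u \<in> carrier R - q" "u' \<in> carrier R - q" "u \<otimes> (a \<oplus> b) = u' \<otimes> \<pi> [^] l"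
    using has_order_ring_ord[of "a \<oplus> b"] a b ab unfolding has_order_def l_def by blast
  obtain x where x: "x \<in> carrier R" "\<pi> [^] ring_ord R q a = \<pi> [^] l \<otimes> (x \<otimes> \<pi>)"
    using pi_split[of "ring_ord R q a"] by (auto simp: k_def)
  obtain y where y: "y \<in> carrier R" "\<pi> [^] ring_ord R q b = \<pi> [^] l \<otimes> (y \<otimes> \<pi>)"
    using pi_split[of "ring_ord R q b"] by (auto simp: k_def)
  have cl: "s \<in> carrier R" "s' \<in> carrier R" "t \<in> carrier R" "t' \<in> carrier R" "u \<in> carrier R" "u' \<in> carrier R"
    using s t u by auto
  define p where "p = \<pi> [^] l"
  have p: "p \<in> carrier R" "p \<noteq> \<zero>"
    unfolding p_def using uniformizer_closed by (simp, induction l) (auto simp: integral_iff)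
  have "p \<otimes> (s \<otimes> t \<otimes> u') = (s \<otimes> t) \<otimes> (u' \<otimes> p)" using cl p by (simp add: m_ac)
  also have "\<dots> = (s \<otimes> t) \<otimes> (u \<otimes> (a \<oplus> b))" by (simp only: u(3) p_def)
  also have "\<dots> = u \<otimes> (t \<otimes> (s \<otimes> a) \<oplus> s \<otimes> (t \<otimes> b))" using cl a b by (simp add: m_ac r_distr)
  also have "\<dots> = p \<otimes> ((u \<otimes> (t \<otimes> s' \<otimes> x \<oplus> s \<otimes> t' \<otimes> y)) \<otimes> \<pi>)"
    unfolding s(3) t(3) x(2) y(2) p_def[symmetric]
    using cl x(1) y(1) p uniformizer_closed by (simp add: m_ac l_distr r_distr)
  finally have "p \<otimes> (s \<otimes> t \<otimes> u') = p \<otimes> ((u \<otimes> (t \<otimes> s' \<otimes> x \<oplus> s \<otimes> t' \<otimes> y)) \<otimes> \<pi>)" .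
  then have "s \<otimes> t \<otimes> u' = (u \<otimes> (t \<otimes> s' \<otimes> x \<oplus> s \<otimes> t' \<otimes> y)) \<otimes> \<pi>"
    using p cl x(1) y(1) uniformizer_closed by (subst (asm) m_lcancel) auto
  moreover have "(u \<otimes> (t \<otimes> s' \<otimes> x \<oplus> s \<otimes> t' \<otimes> y)) \<otimes> \<pi> \<in> q"
    by (rule q.I_l_closed) (use uniformizer_closed cl x(1) y(1) in auto)
  ultimately show False using notin_mult[OF notin_mult[OF s(1) t(1)] u(2)] by simp
qed

lemma ring_ord_pow:
  assumes "a \<in> carrier R" "a \<noteq> \<zero>"
  shows "a [^] n \<noteq> \<zero>" "ring_ord R q (a [^] (n::nat)) = n * ring_ord R q a"
proof -
  show *: "a [^] n \<noteq> \<zero>" for n :: nat using assms by (induction n) (auto simp: integral_iff)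
  show "ring_ord R q (a [^] n) = n * ring_ord R q a"
    using assms * ring_ord_notin[OF one_notin] by (induction n) (auto simp: ring_ord_mult)
qed

lemma frac_ord_frac:
  assumes b: "b \<in> carrier R" "b \<noteq> \<zero>" and c: "c \<in> carrier R" "c \<noteq> \<zero>"
  shows "frac_ord R q (loc_frac R (nonzerodivisors R) b c)
    = int (ring_ord R q b) - int (ring_ord R q c)"
proof -
  interpret K: mult_subset R "nonzerodivisors R" by (rule nonzerodivisors_mult_subset)
  have "int (ring_ord R q b) - int (ring_ord R q c) = int (ring_ord R q b') - int (ring_ord R q c')"
    if b': "b' \<in> carrier R" "b' \<noteq> \<zero>" and c': "c' \<in> carrier R" "c' \<noteq> \<zero>"
      and eq: "loc_frac R (nonzerodivisors R) b c = loc_frac R (nonzerodivisors R) b' c'" for b' c'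
  proof -
    have "b \<otimes> c' = b' \<otimes> c"
      using eq b c b' c' K.frac_eq_iff_domain[OF domain_axioms] by (simp add: nonzerodivisors_iff)
    then have "ring_ord R q b + ring_ord R q c' = ring_ord R q b' + ring_ord R q c"
      using ring_ord_mult[OF b c'] ring_ord_mult[OF b' c] by simp
    then show ?thesis by simp
  qed
  then have uniq: "n = int (ring_ord R q b) - int (ring_ord R q c)"
    if "\<exists>b'\<in>carrier R - {\<zero>}. \<exists>c'\<in>carrier R - {\<zero>}.
      loc_frac R (nonzerodivisors R) b c = loc_frac R (nonzerodivisors R) b' c' \<and>
      n = int (ring_ord R q b') - int (ring_ord R q c')" for n
    using that by fastforce
  show ?thesis unfolding frac_ord_def
  proof (rule the_equality)
    show "\<exists>b'\<in>carrier R - {\<zero>}. \<exists>c'\<in>carrier R - {\<zero>}.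
      loc_frac R (nonzerodivisors R) b c = loc_frac R (nonzerodivisors R) b' c' \<and>
      int (ring_ord R q b) - int (ring_ord R q c) = int (ring_ord R q b') - int (ring_ord R q c')"
      using b c by (intro bexI[of _ b] bexI[of _ c]) auto
  qed (rule uniq)
qed

end

lemma has_uniformizers_valuation:
  assumes "has_uniformizers R" "height_one_prime R q"
  obtains \<pi> where "height_one_valuation R q \<pi>"
  using assms
  by (auto simp: has_uniformizers_def height_one_prime_def height_one_valuation_def
      height_one_valuation_axioms_def)

lemma div_sections_simps:
  "\<zero>\<^bsub>div_sections R D\<^esub> = \<zero>\<^bsub>tot_frac R\<^esub>"
  "x \<oplus>\<^bsub>div_sections R D\<^esub> y = x \<oplus>\<^bsub>tot_frac R\<^esub> y"
  "r \<odot>\<^bsub>div_sections R D\<^esub> y = to_tot_frac R r \<otimes>\<^bsub>tot_frac R\<^esub> y"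
  by (simp_all add: div_sections_def)

lemma (in domain) frac_in_div_sections_iff:
  assumes R: "has_uniformizers R" and D: "D \<noteq> (\<lambda>_. 0)"
    and b: "b \<in> carrier R" "b \<noteq> \<zero>" and c: "c \<in> carrier R" "c \<noteq> \<zero>"
  shows "loc_frac R (nonzerodivisors R) b c \<in> carrier (div_sections R D) \<longleftrightarrow>
    (\<forall>q. height_one_prime R q \<longrightarrow> int (ring_ord R q b) - int (ring_ord R q c) + D q \<ge> 0)"
proof -
  interpret K: mult_subset R "nonzerodivisors R" by (rule nonzerodivisors_mult_subset)
  have "frac_ord R q (loc_frac R (nonzerodivisors R) b c) = int (ring_ord R q b) - int (ring_ord R q c)"
    if "height_one_prime R q" for q
    using has_uniformizers_valuation[OF R that] height_one_valuation.frac_ord_frac[OF _ b c] by blast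
  moreover have "loc_frac R (nonzerodivisors R) b c \<noteq> \<zero>\<^bsub>tot_frac R\<^esub>"
    using b c K.frac_eq_zero_iff_domain[OF domain_axioms] by (simp add: nonzerodivisors_iff)
  moreover have "loc_frac R (nonzerodivisors R) b c \<in> carrier (tot_frac R)"
    using b c by (simp add: nonzerodivisors_iff)
  ultimately show ?thesis using D by (simp add: div_sections_def)
qed

lemma (in domain) div_sections_cases:
  assumes D: "D \<noteq> (\<lambda>_. 0)" and f: "f \<in> carrier (div_sections R D)"
  obtains "f = \<zero>\<^bsub>tot_frac R\<^esub>"
  | b c where "b \<in> carrier R" "b \<noteq> \<zero>" "c \<in> carrier R" "c \<noteq> \<zero>"
      "f = loc_frac R (nonzerodivisors R) b c"
proof -
  interpret K: mult_subset R "nonzerodivisors R" by (rule nonzerodivisors_mult_subset)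
  have "f \<in> carrier (tot_frac R)" using D f by (simp add: div_sections_def)
  then obtain b c where bc: "b \<in> carrier R" "c \<in> nonzerodivisors R"
    "f = loc_frac R (nonzerodivisors R) b c" by (rule K.loc_cases)
  then have c: "c \<in> carrier R" "c \<noteq> \<zero>" by (auto simp: nonzerodivisors_iff)
  have "b = \<zero> \<Longrightarrow> f = \<zero>\<^bsub>tot_frac R\<^esub>" using bc(3) K.frac_zero_eq[OF bc(2)] by (simp add: K.loc_zero)
  then show ?thesis using that bc c by blast
qed

text \<open>For \<open>D = 0\<close> the module is the image of \<open>R\<close> by definition. Otherwise a section is a fraction,
  and after passing to a common denominator the claims are inequalities between valuations.\<close>

lemma div_sections_closed:
  fixes R :: "('a, 'm) ring_scheme" (structure)
  assumes "cring R" and R: "D \<noteq> (\<lambda>_. 0) \<Longrightarrow> has_uniformizers R" and D: "\<And>q. D q \<ge> 0"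
  shows "carrier (div_sections R D) \<subseteq> carrier (tot_frac R)"
    and "\<And>a. a \<in> carrier R \<Longrightarrow> to_tot_frac R a \<in> carrier (div_sections R D)"
    and "\<And>f g. \<lbrakk>f \<in> carrier (div_sections R D); g \<in> carrier (div_sections R D)\<rbrakk> \<Longrightarrow>
      f \<oplus>\<^bsub>tot_frac R\<^esub> g \<in> carrier (div_sections R D)"
    and "\<And>a f. \<lbrakk>a \<in> carrier R; f \<in> carrier (div_sections R D)\<rbrakk> \<Longrightarrow>
      to_tot_frac R a \<otimes>\<^bsub>tot_frac R\<^esub> f \<in> carrier (div_sections R D)"
proof -
  interpret cring R by fact
  interpret K: mult_subset R "nonzerodivisors R" by (rule nonzerodivisors_mult_subset)
  let ?M = "carrier (div_sections R D)" and ?K = "tot_frac R" and ?\<iota> = "to_tot_frac R"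
  let ?fr = "loc_frac R (nonzerodivisors R)"
  show sub: "?M \<subseteq> carrier ?K" by (auto simp: div_sections_def)
  have zero: "\<zero>\<^bsub>?K\<^esub> \<in> ?M"
  proof -
    have "\<zero>\<^bsub>?K\<^esub> \<in> ?\<iota> ` carrier R" using K.loc_map.hom_zero zero_closed by (metis imageI)
    then show ?thesis by (simp add: div_sections_def)
  qed
  show map: "?\<iota> a \<in> ?M" if a: "a \<in> carrier R" for a
  proof (cases "D = (\<lambda>_. 0) \<or> a = \<zero>")
    case True then show ?thesis using a zero by (auto simp: div_sections_def)
  next
    case False
    then have U: "has_uniformizers R" using R by blast
    then interpret domain R by (simp add: has_uniformizers_def)
    have "?fr a \<one> \<in> ?M"
    proof (subst frac_in_div_sections_iff[OF U])
      show "\<forall>q. height_one_prime R q \<longrightarrow> int (ring_ord R q a) - int (ring_ord R q \<one>) + D q \<ge> 0"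
      proof (intro allI impI)
        fix q assume "height_one_prime R q"
        then obtain \<pi> where "height_one_valuation R q \<pi>" by (rule has_uniformizers_valuation[OF U])
        then interpret height_one_valuation R q \<pi> .
        show "int (ring_ord R q a) - int (ring_ord R q \<one>) + D q \<ge> 0"
          using ring_ord_notin[OF one_notin] D[of q] by simp
      qed
    qed (use a False in auto)
    then show ?thesis unfolding loc_map_def .
  qed
  show smult: "?\<iota> a \<otimes>\<^bsub>?K\<^esub> f \<in> ?M" if a: "a \<in> carrier R" and f: "f \<in> ?M" for a f
  proof (cases "D = (\<lambda>_. 0)")
    case True
    then obtain b where "b \<in> carrier R" "f = ?\<iota> b" using f by (auto simp: div_sections_def)
    then show ?thesis using a map[of "a \<otimes> b"] by simp
  next
    case False
    then have U: "has_uniformizers R" using R by blast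
    then interpret domain R by (simp add: has_uniformizers_def)
    show ?thesis using False f
    proof (cases rule: div_sections_cases)
      case 1 then show ?thesis using a zero by simp
    next
      case (2 b c)
      show ?thesis
      proof (cases "a = \<zero>")
        case True then show ?thesis using zero sub f by auto
      next
        case a0: False
        have "?\<iota> a \<otimes>\<^bsub>?K\<^esub> f = ?fr (a \<otimes> b) c"
          using 2 a by (simp add: loc_map_def K.frac_mult nonzerodivisors_iff)
        moreover have "?fr (a \<otimes> b) c \<in> ?M"
        proof (subst frac_in_div_sections_iff[OF U False])
          show "\<forall>q. height_one_prime R q \<longrightarrow> int (ring_ord R q (a \<otimes> b)) - int (ring_ord R q c) + D q \<ge> 0"
          proof (intro allI impI)
            fix q assume q: "height_one_prime R q"
            then obtain \<pi> where "height_one_valuation R q \<pi>" by (rule has_uniformizers_valuation[OF U])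
            then interpret height_one_valuation R q \<pi> .
            have "int (ring_ord R q b) - int (ring_ord R q c) + D q \<ge> 0"
              using f q frac_in_div_sections_iff[OF U False 2(1-4)] unfolding 2(5) by blast
            then show "int (ring_ord R q (a \<otimes> b)) - int (ring_ord R q c) + D q \<ge> 0"
              using ring_ord_mult[OF a a0 2(1,2)] by simp
          qed
        qed (use a a0 2 in \<open>auto simp: integral_iff\<close>)
        ultimately show ?thesis by simp
      qed
    qed
  qed
  show "f \<oplus>\<^bsub>?K\<^esub> g \<in> ?M" if f: "f \<in> ?M" and g: "g \<in> ?M" for f g
  proof (cases "D = (\<lambda>_. 0)")
    case True
    then obtain b c where "b \<in> carrier R" "f = ?\<iota> b" "c \<in> carrier R" "g = ?\<iota> c"
      using f g by (auto simp: div_sections_def)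
    then show ?thesis using map[of "b \<oplus> c"] by simp
  next
    case False
    then have U: "has_uniformizers R" using R by blast
    then interpret domain R by (simp add: has_uniformizers_def)
    show ?thesis using False f
    proof (cases rule: div_sections_cases)
      case 1 then show ?thesis using g sub by auto
    next
      case f: (2 b c)
      show ?thesis using False g
      proof (cases rule: div_sections_cases)
        case 1 then show ?thesis using \<open>f \<in> ?M\<close> sub by auto
      next
        case g: (2 b' c')
        have sum: "f \<oplus>\<^bsub>?K\<^esub> g = ?fr (b \<otimes> c' \<oplus> b' \<otimes> c) (c \<otimes> c')"
          using f g by (simp add: K.frac_add nonzerodivisors_iff)
        have nz: "c \<otimes> c' \<noteq> \<zero>" "b \<otimes> c' \<noteq> \<zero>" "b' \<otimes> c \<noteq> \<zero>" using f g by (auto simp: integral_iff)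
        have cl: "c \<otimes> c' \<in> carrier R" "b \<otimes> c' \<in> carrier R" "b' \<otimes> c \<in> carrier R" using f g by auto
        show ?thesis
        proof (cases "b \<otimes> c' \<oplus> b' \<otimes> c = \<zero>")
          case True
          have "c \<otimes> c' \<in> nonzerodivisors R" using cl nz by (simp add: nonzerodivisors_iff)
          from K.frac_zero_eq[OF this] show ?thesis
            unfolding sum True using zero by (simp add: K.loc_zero)
        next
          case n0: False
          show ?thesis unfolding sum
          proof (subst frac_in_div_sections_iff[OF U False _ n0 cl(1) nz(1)])
            show "\<forall>q. height_one_prime R q \<longrightarrow>
              int (ring_ord R q (b \<otimes> c' \<oplus> b' \<otimes> c)) - int (ring_ord R q (c \<otimes> c')) + D q \<ge> 0"
            proof (intro allI impI)
              fix q assume q: "height_one_prime R q"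
              then obtain \<pi> where "height_one_valuation R q \<pi>" by (rule has_uniformizers_valuation[OF U])
              then interpret height_one_valuation R q \<pi> .
              have "int (ring_ord R q b) - int (ring_ord R q c) + D q \<ge> 0"
                using \<open>f \<in> ?M\<close> q frac_in_div_sections_iff[OF U False f(1-4)] unfolding f(5) by blast
              moreover have "int (ring_ord R q b') - int (ring_ord R q c') + D q \<ge> 0"
                using \<open>g \<in> ?M\<close> q frac_in_div_sections_iff[OF U False g(1-4)] unfolding g(5) by blast
              ultimately show "int (ring_ord R q (b \<otimes> c' \<oplus> b' \<otimes> c)) - int (ring_ord R q (c \<otimes> c')) + D q \<ge> 0"
                using ring_ord_add[OF cl(2) nz(2) cl(3) nz(3) n0]
                  ring_ord_mult[OF f(1,2) g(3,4)] ring_ord_mult[OF g(1,2) f(3,4)]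
                  ring_ord_mult[OF f(3,4) g(3,4)]
                by (auto simp: min_def split: if_splits)
            qed
          qed (use cl in simp)
        qed
      qed
    qed
  qed
qed

text \<open>Noetherian induction. A nonzero prime ideal lies in at most one prime of height one. If
  \<open>a b \<in> M\<close>, every prime over \<open>M\<close> lies over \<open>M\<close> enlarged by \<open>a\<close> or by \<open>b\<close>; so an ideal that is
  maximal among those below infinitely many primes of height one cannot fail to be prime
  either.\<close>

lemma (in noetherian_domain) finite_height_one_primes:
  assumes c: "c \<in> carrier R" "c \<noteq> \<zero>"
  shows "finite {q. height_one_prime R q \<and> c \<in> q}"
proof (rule ccontr)
  assume inf: "\<not> ?thesis"
  define V where "V I = {q. height_one_prime R q \<and> I \<subseteq> q}" for I
  have qi: "ideal q R" if "q \<in> V I" for q I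
    using that by (auto simp: V_def height_one_prime_def intro: primeideal.axioms(1))
  have qp: "primeideal q R" if "q \<in> V I" for q I
    using that by (auto simp: V_def height_one_prime_def)
  define \<A> where "\<A> = {I. ideal I R \<and> c \<in> I \<and> infinite (V I)}"
  have "{q. height_one_prime R q \<and> c \<in> q} \<subseteq> V (PIdl c)"
  proof
    fix q assume q: "q \<in> {q. height_one_prime R q \<and> c \<in> q}"
    then have "ideal q R" by (auto simp: height_one_prime_def intro: primeideal.axioms(1))
    then show "q \<in> V (PIdl c)" using q cgenideal_minimal by (simp add: V_def)
  qed
  then have "infinite (V (PIdl c))" using inf finite_subset by blast
  then have ne: "\<A> \<noteq> {}" using cgenideal_ideal[OF c(1)] cgenideal_self[OF c(1)] by (auto simp: \<A>_def)
  have ids: "ideal I R" if "I \<in> \<A>" for I using that by (simp add: \<A>_def)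
  obtain M where "M \<in> \<A>" and max: "\<forall>X\<in>\<A>. M \<subseteq> X \<longrightarrow> X = M"
    using exists_maximal_ideal_in[OF ne ids] by blast
  then have M: "ideal M R" "c \<in> M" "infinite (V M)" by (auto simp: \<A>_def)
  interpret M: ideal M R by (rule M(1))
  have "finite (V M)"
  proof (cases "primeideal M R")
    case True
    have "q = M" if "q \<in> V M" for q
    proof -
      have "M = {\<zero>} \<or> M = q" using that True by (auto simp: V_def height_one_prime_iff)
      then show ?thesis using M(2) c(2) by blast
    qed
    then have "V M \<subseteq> {M}" by blast
    then show ?thesis using finite_subset by blast
  next
    case False
    have "finite (V M)" if "carrier R = M"
    proof -
      have False if q: "q \<in> V M" for q
      proof -
        have "carrier R \<subseteq> q" using q \<open>carrier R = M\<close> by (simp add: V_def)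
        moreover have "q \<subseteq> carrier R" using ideal.Icarr[OF qi[OF q]] by blast
        ultimately show False using primeideal.I_notcarr[OF qp[OF q]] by blast
      qed
      then have "V M = {}" by blast
      then show ?thesis by simp
    qed
    moreover have "finite (V M)"
      if ab: "a \<in> carrier R" "b \<in> carrier R" "a \<otimes> b \<in> M" "a \<notin> M" "b \<notin> M" for a b
    proof -
      have fin: "finite (V (Idl (insert x M)))" if x: "x \<in> carrier R" "x \<notin> M" for x
      proof (rule ccontr)
        have sub: "insert x M \<subseteq> carrier R" using x M.Icarr by blast
        have sup: "insert x M \<subseteq> Idl (insert x M)" by (rule genideal_self[OF sub])
        assume "infinite (V (Idl (insert x M)))"
        then have "Idl (insert x M) \<in> \<A>"
          using genideal_ideal[OF sub] sup M(2) by (auto simp: \<A>_def)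
        then have "Idl (insert x M) = M" using max sup by blast
        then show False using sup x by blast
      qed
      have "V M \<subseteq> V (Idl (insert a M)) \<union> V (Idl (insert b M))"
      proof
        fix q assume q: "q \<in> V M"
        then have "a \<in> q \<or> b \<in> q" using ab primeideal.I_prime[OF qp[OF q]] by (auto simp: V_def)
        moreover have "Idl (insert x M) \<subseteq> q" if "x \<in> q" for x
          using that q by (intro genideal_minimal qi[OF q]) (auto simp: V_def)
        ultimately show "q \<in> V (Idl (insert a M)) \<union> V (Idl (insert b M))"
          using q by (auto simp: V_def)
      qed
      then show ?thesis using fin[OF ab(1,4)] fin[OF ab(2,5)] finite_subset by blast
    qed
    ultimately show ?thesis using M.primeidealCD[OF is_cring False] by blast
  qed
  with M(3) show False by blast
qed

text \<open>Each of the finitely many \<open>q\<close> with \<open>c \<in> q\<close> and \<open>q\<close> not inside \<open>P\<close> contributes a power of an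
  element of \<open>q\<close> outside \<open>P\<close>.\<close>

lemma (in noetherian_domain) exists_multiple_order:
  assumes U: "has_uniformizers R" and P: "primeideal P R" and c: "c \<in> carrier R" "c \<noteq> \<zero>"
  obtains s where "s \<in> carrier R - P"
    "\<forall>q. height_one_prime R q \<and> \<not> q \<subseteq> P \<longrightarrow> ring_ord R q c \<le> ring_ord R q s"
proof -
  interpret P: primeideal P R by fact
  interpret S: mult_subset R "carrier R - P" using P by (rule prime_mult_subset)
  define F where "F = {q. height_one_prime R q \<and> c \<in> q \<and> \<not> q \<subseteq> P}"
  have "finite F"
    by (rule finite_subset[OF _ finite_height_one_primes[OF c]]) (auto simp: F_def)
  moreover have "\<forall>q\<in>F. height_one_prime R q \<and> \<not> q \<subseteq> P" by (simp add: F_def)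
  ultimately have "\<exists>s\<in>carrier R - P. \<forall>q\<in>F. ring_ord R q c \<le> ring_ord R q s"
  proof (induction F)
    case empty then show ?case using S.one_S by blast
  next
    case (insert q F)
    then obtain s where s: "s \<in> carrier R - P" "\<forall>q\<in>F. ring_ord R q c \<le> ring_ord R q s" by blast
    have s': "s \<in> carrier R" "s \<noteq> \<zero>" using s(1) by auto
    have ht: "height_one_prime R q'" if "q' \<in> insert q F" for q' using insert.prems that by blast
    have "\<not> q \<subseteq> P" using insert.prems by blast
    then obtain x where x: "x \<in> q" "x \<notin> P" by blast
    have xc: "x \<in> carrier R" "x \<noteq> \<zero>"
      using x ht[of q] ideal.Icarr by (auto simp: height_one_prime_def primeideal_def)
    define n where "n = ring_ord R q c"
    define s2 where "s2 = s \<otimes> x [^] n"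
    have s2: "s2 \<in> carrier R - P"
      unfolding s2_def using xc(1) x(2) by (intro S.mult_S[OF s(1)] S.pow_S) simp
    have ord: "ring_ord R q' s2 = ring_ord R q' s + n * ring_ord R q' x" if q': "q' \<in> insert q F" for q'
    proof -
      obtain \<pi> where "height_one_valuation R q' \<pi>"
        using ht[OF q'] by (rule has_uniformizers_valuation[OF U])
      then interpret height_one_valuation R q' \<pi> .
      show ?thesis unfolding s2_def
        using ring_ord_mult[OF s' nat_pow_closed[OF xc(1)] ring_ord_pow(1)[OF xc]]
          ring_ord_pow(2)[OF xc] by simp
    qed
    obtain \<pi> where v: "height_one_valuation R q \<pi>"
      using ht[of q] by (auto intro: has_uniformizers_valuation[OF U])
    have "n \<le> n * ring_ord R q x"
      using height_one_valuation.ring_ord_pos[OF v x(1) xc(2)] by simp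
    moreover have "ring_ord R q s2 = ring_ord R q s + n * ring_ord R q x" by (rule ord) simp
    ultimately have "ring_ord R q c \<le> ring_ord R q s2" unfolding n_def[symmetric] by linarith
    moreover have "ring_ord R q' c \<le> ring_ord R q' s2" if "q' \<in> F" for q'
      using that s(2) ord[of q'] by force
    ultimately show ?case using s2 by blast
  qed
  then obtain s where s: "s \<in> carrier R - P" "\<forall>q\<in>F. ring_ord R q c \<le> ring_ord R q s"
    by blast
  have "ring_ord R q c \<le> ring_ord R q s" if q: "height_one_prime R q" "\<not> q \<subseteq> P" for q
  proof (cases "c \<in> q")
    case True then show ?thesis using q s(2) by (simp add: F_def)
  next
    case False
    obtain \<pi> where "height_one_valuation R q \<pi>" using q(1) by (rule has_uniformizers_valuation[OF U])
    then show ?thesis using height_one_valuation.ring_ord_notin c(1) False by fastforce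
  qed
  then show ?thesis using that s(1) by blast
qed

section \<open>Comparison of two localizations\<close>

text \<open>The extension of \<open>R \<rightarrow> R\<^sub>P\<close> to total rings of fractions. It makes it possible to speak of one
  fraction over \<open>R\<close> as a section near several primes at once.\<close>

definition tot_loc_map :: "('a, 'm) ring_scheme \<Rightarrow> 'a set \<Rightarrow> ('a \<times> 'a) set \<Rightarrow> (('a \<times> 'a) set \<times> ('a \<times> 'a) set) set" where
  "tot_loc_map R P = (SOME g. g \<in> ring_hom (tot_frac R) (tot_frac (loc_at R P)) \<and>
    (\<forall>a\<in>carrier R. g (to_tot_frac R a) = to_tot_frac (loc_at R P) (to_loc_at R P a)))"

locale prime_localization = cring R for R (structure) +
  fixes P
  assumes P: "primeideal P R"
begin

sublocale P: primeideal P R by (rule P)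

sublocale S: mult_subset R "carrier R - P" by (rule prime_mult_subset) (rule P)

sublocale K: mult_subset R "nonzerodivisors R" by (rule nonzerodivisors_mult_subset)

sublocale KP: mult_subset "loc_at R P" "nonzerodivisors (loc_at R P)"
  by (rule S.L.nonzerodivisors_mult_subset)

abbreviation "A \<equiv> loc_at R P"
abbreviation "\<iota> \<equiv> to_loc_at R P"
abbreviation "\<epsilon> \<equiv> tot_loc_map R P"

lemma nonzerodivisors_loc:
  assumes s: "s \<in> nonzerodivisors R"
  shows "\<iota> s \<in> nonzerodivisors A"
proof -
  have sc: "s \<in> carrier R" and snz: "\<forall>x\<in>carrier R. s \<otimes> x = \<zero> \<longrightarrow> x = \<zero>"
    using s unfolding nonzerodivisors_def by blast+
  have "x = \<zero>\<^bsub>A\<^esub>" if x: "x \<in> carrier A" "\<iota> s \<otimes>\<^bsub>A\<^esub> x = \<zero>\<^bsub>A\<^esub>" for x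
  proof -
    obtain a t where a: "a \<in> carrier R" "t \<in> carrier R - P" "x = loc_frac R (carrier R - P) a t"
      using x(1) by (rule S.loc_cases)
    have tx: "\<iota> t \<otimes>\<^bsub>A\<^esub> x = \<iota> a" unfolding a(3) by (rule S.frac_cancel[OF a(1,2)])
    have tc: "\<iota> t \<in> carrier A" using a by simp
    have "\<iota> (s \<otimes> a) = \<iota> s \<otimes>\<^bsub>A\<^esub> (\<iota> t \<otimes>\<^bsub>A\<^esub> x)" using sc a(1) tx by simp
    also have "\<dots> = \<iota> t \<otimes>\<^bsub>A\<^esub> (\<iota> s \<otimes>\<^bsub>A\<^esub> x)" using sc tc x(1) by (simp add: S.L.m_lcomm)
    also have "\<dots> = \<zero>\<^bsub>A\<^esub>" using x(2) tc by simp
    finally obtain u where u: "u \<in> carrier R - P" "u \<otimes> (s \<otimes> a) = \<zero>"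
      using S.loc_map_eq_zero_iff[of "s \<otimes> a"] sc a(1) by blast
    have "s \<otimes> (u \<otimes> a) = \<zero>" using u sc a(1) m_lcomm[of s u a] by simp
    then have "u \<otimes> a = \<zero>" using snz u(1) a(1) by blast
    then have "\<iota> a = \<zero>\<^bsub>A\<^esub>" using S.loc_map_eq_zero_iff[OF a(1)] u(1) by blast
    then have "\<iota> t \<otimes>\<^bsub>A\<^esub> x = \<iota> t \<otimes>\<^bsub>A\<^esub> \<zero>\<^bsub>A\<^esub>" using tx tc by simp
    moreover have "\<iota> t \<in> Units A" using a(2) by simp
    ultimately show ?thesis using x(1) S.L.Units_l_cancel[of "\<iota> t" x "\<zero>\<^bsub>A\<^esub>"] by simp
  qed
  moreover have "\<iota> s \<in> carrier A" using sc by simp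
  ultimately show ?thesis unfolding nonzerodivisors_def by blast
qed

lemma tot_loc_map:
  "\<epsilon> \<in> ring_hom (tot_frac R) (tot_frac A)"
  "a \<in> carrier R \<Longrightarrow> \<epsilon> (to_tot_frac R a) = to_tot_frac A (\<iota> a)"
proof -
  have comp: "to_tot_frac A \<circ> \<iota> \<in> ring_hom R (tot_frac A)"
    by (rule ring_hom_trans[OF S.loc_map_hom KP.loc_map_hom])
  have U: "(to_tot_frac A \<circ> \<iota>) ` nonzerodivisors R \<subseteq> Units (tot_frac A)"
    using KP.loc_map_Units[OF nonzerodivisors_loc] by auto
  obtain g where "g \<in> ring_hom (tot_frac R) (tot_frac A)"
    "\<forall>a\<in>carrier R. g (to_tot_frac R a) = (to_tot_frac A \<circ> \<iota>) a"
    using K.loc_lift[OF KP.loc_cring comp U] by blast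
  then have "\<exists>g. g \<in> ring_hom (tot_frac R) (tot_frac A) \<and>
    (\<forall>a\<in>carrier R. g (to_tot_frac R a) = to_tot_frac A (\<iota> a))" by auto
  from someI_ex[OF this] show "\<epsilon> \<in> ring_hom (tot_frac R) (tot_frac A)"
    "a \<in> carrier R \<Longrightarrow> \<epsilon> (to_tot_frac R a) = to_tot_frac A (\<iota> a)"
    unfolding tot_loc_map_def by blast+
qed

sublocale \<epsilon>: ring_hom_cring "tot_frac R" "tot_frac (loc_at R P)" "tot_loc_map R P"
  by unfold_locales (rule tot_loc_map(1))

lemma tot_loc_map_frac:
  assumes b: "b \<in> carrier R" and c: "c \<in> nonzerodivisors R"
  shows "\<epsilon> (loc_frac R (nonzerodivisors R) b c) = loc_frac A (nonzerodivisors A) (\<iota> b) (\<iota> c)"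
proof -
  have cc: "c \<in> carrier R" using c by (rule nonzerodivisors_closed)
  have fc: "loc_frac R (nonzerodivisors R) b c \<in> carrier (tot_frac R)" using b c by simp
  have fc': "loc_frac A (nonzerodivisors A) (\<iota> b) (\<iota> c) \<in> carrier (tot_frac A)"
    using b nonzerodivisors_loc[OF c] by simp
  have "to_tot_frac A (\<iota> c) \<otimes>\<^bsub>tot_frac A\<^esub> \<epsilon> (loc_frac R (nonzerodivisors R) b c)
    = \<epsilon> (to_tot_frac R c \<otimes>\<^bsub>tot_frac R\<^esub> loc_frac R (nonzerodivisors R) b c)"
    using cc fc by (simp add: tot_loc_map(2))
  also have "\<dots> = to_tot_frac A (\<iota> b)"
    unfolding K.frac_cancel[OF b c] by (rule tot_loc_map(2)[OF b])
  also have "\<dots> = to_tot_frac A (\<iota> c) \<otimes>\<^bsub>tot_frac A\<^esub> loc_frac A (nonzerodivisors A) (\<iota> b) (\<iota> c)"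
    using KP.frac_cancel[of "\<iota> b" "\<iota> c"] b nonzerodivisors_loc[OF c] by simp
  finally show ?thesis
    using KP.L.Units_l_cancel[OF KP.loc_map_Units[OF nonzerodivisors_loc[OF c]] \<epsilon>.hom_closed[OF fc] fc']
    by blast
qed

lemma tot_loc_map_eqD:
  assumes m: "m \<in> carrier (tot_frac R)" and m': "m' \<in> carrier (tot_frac R)" and eq: "\<epsilon> m = \<epsilon> m'"
  obtains u where "u \<in> carrier R - P"
    "to_tot_frac R u \<otimes>\<^bsub>tot_frac R\<^esub> m = to_tot_frac R u \<otimes>\<^bsub>tot_frac R\<^esub> m'"
proof -
  obtain b c where b: "b \<in> carrier R" "c \<in> nonzerodivisors R" "m = loc_frac R (nonzerodivisors R) b c"
    using m by (rule K.loc_cases)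
  obtain b' c' where b': "b' \<in> carrier R" "c' \<in> nonzerodivisors R" "m' = loc_frac R (nonzerodivisors R) b' c'"
    using m' by (rule K.loc_cases)
  have cl: "c \<in> carrier R" "c' \<in> carrier R" using b(2) b'(2) by (blast dest: nonzerodivisors_closed)+
  note nz = nonzerodivisors_loc[OF b(2)] nonzerodivisors_loc[OF b'(2)]
  have "loc_frac A (nonzerodivisors A) (\<iota> b) (\<iota> c) = loc_frac A (nonzerodivisors A) (\<iota> b') (\<iota> c')"
    using eq unfolding b(3) b'(3) tot_loc_map_frac[OF b(1,2)] tot_loc_map_frac[OF b'(1,2)] .
  then obtain v where v: "v \<in> nonzerodivisors A" "v \<otimes>\<^bsub>A\<^esub> (\<iota> b \<otimes>\<^bsub>A\<^esub> \<iota> c') = v \<otimes>\<^bsub>A\<^esub> (\<iota> b' \<otimes>\<^bsub>A\<^esub> \<iota> c)"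
    using KP.frac_eq_iff[OF _ _ nz, of "\<iota> b" "\<iota> b'"] b(1) b'(1) by auto
  define x where "x = \<iota> b \<otimes>\<^bsub>A\<^esub> \<iota> c'"
  define y where "y = \<iota> b' \<otimes>\<^bsub>A\<^esub> \<iota> c"
  have xy: "x \<in> carrier A" "y \<in> carrier A" "v \<in> carrier A"
    using b(1) b'(1) cl nonzerodivisors_closed[OF v(1)] by (simp_all add: x_def y_def)
  have "v \<otimes>\<^bsub>A\<^esub> (x \<ominus>\<^bsub>A\<^esub> y) = \<zero>\<^bsub>A\<^esub>"
    using v(2) xy by (simp add: x_def[symmetric] y_def[symmetric] a_minus_def S.L.r_distr S.L.r_minus S.L.r_neg)
  then have "x \<ominus>\<^bsub>A\<^esub> y = \<zero>\<^bsub>A\<^esub>" using v(1) xy unfolding nonzerodivisors_def by blast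
  then have "x = y" using xy by simp
  then have "\<iota> (b \<otimes> c') = \<iota> (b' \<otimes> c)" using b(1) b'(1) cl by (simp add: x_def y_def)
  then obtain u where u: "u \<in> carrier R - P" "u \<otimes> (b \<otimes> c') = u \<otimes> (b' \<otimes> c)"
    using S.loc_map_eq_iff[of "b \<otimes> c'" "b' \<otimes> c"] b(1) b'(1) cl by auto
  have um: "to_tot_frac R u \<otimes>\<^bsub>tot_frac R\<^esub> loc_frac R (nonzerodivisors R) a d = loc_frac R (nonzerodivisors R) (u \<otimes> a) d"
    if "a \<in> carrier R" "d \<in> nonzerodivisors R" for a d
    using u(1) that nonzerodivisors_closed[OF that(2)] by (simp add: loc_map_def K.frac_mult)
  have "loc_frac R (nonzerodivisors R) (u \<otimes> b) c = loc_frac R (nonzerodivisors R) (u \<otimes> b') c'"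
    using u b(1,2) b'(1,2) cl by (intro K.frac_eqI) (auto simp: m_assoc)
  then have "to_tot_frac R u \<otimes>\<^bsub>tot_frac R\<^esub> m = to_tot_frac R u \<otimes>\<^bsub>tot_frac R\<^esub> m'"
    unfolding b(3) b'(3) um[OF b(1,2)] um[OF b'(1,2)] .
  with u(1) show ?thesis by (rule that)
qed

text \<open>Localization of an additive map which is semilinear for the \<open>q\<close>-th power: the value at a
  fraction \<open>f\<close> with denominator \<open>s\<close>, written as \<open>s\<^sup>q f / s\<^sup>q\<close>, has to be \<open>\<theta> (s\<^sup>q f) / s\<close>. This
  does not depend on \<open>s\<close>, because two elements of \<open>M\<close> with the same image become equal after
  multiplication by some \<open>u\<close> outside \<open>P\<close>, and \<open>\<theta>\<close> turns a factor \<open>u\<^sup>q\<close> into the unit \<open>u\<close>.\<close>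

lemma semilinear_extension:
  assumes M: "M \<subseteq> carrier (tot_frac R)"
    and M_add: "\<And>m n. \<lbrakk>m \<in> M; n \<in> M\<rbrakk> \<Longrightarrow> m \<oplus>\<^bsub>tot_frac R\<^esub> n \<in> M"
    and M_smult: "\<And>r m. \<lbrakk>r \<in> carrier R; m \<in> M\<rbrakk> \<Longrightarrow> to_tot_frac R r \<otimes>\<^bsub>tot_frac R\<^esub> m \<in> M"
    and \<theta>: "\<And>m. m \<in> M \<Longrightarrow> \<theta> m \<in> carrier A"
    and \<theta>_add: "\<And>m n. \<lbrakk>m \<in> M; n \<in> M\<rbrakk> \<Longrightarrow> \<theta> (m \<oplus>\<^bsub>tot_frac R\<^esub> n) = \<theta> m \<oplus>\<^bsub>A\<^esub> \<theta> n"
    and \<theta>_smult: "\<And>r m. \<lbrakk>r \<in> carrier R; m \<in> M\<rbrakk> \<Longrightarrow>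
      \<theta> (to_tot_frac R (r [^] q) \<otimes>\<^bsub>tot_frac R\<^esub> m) = \<iota> r \<otimes>\<^bsub>A\<^esub> \<theta> m"
    and q: "q > (0::nat)"
    and N: "N \<subseteq> carrier (tot_frac A)"
    and N_M: "\<And>f. f \<in> N \<Longrightarrow> \<exists>s\<in>carrier R - P. \<exists>m\<in>M. \<epsilon> m = to_tot_frac A (\<iota> s) \<otimes>\<^bsub>tot_frac A\<^esub> f"
  shows "\<exists>h. (\<forall>f\<in>N. h f \<in> carrier A) \<and>
    (\<forall>f\<in>N. \<forall>g\<in>N. h (f \<oplus>\<^bsub>tot_frac A\<^esub> g) = h f \<oplus>\<^bsub>A\<^esub> h g) \<and>
    (\<forall>r\<in>carrier A. \<forall>f\<in>N.
      h (to_tot_frac A (r [^]\<^bsub>A\<^esub> q) \<otimes>\<^bsub>tot_frac A\<^esub> f) = r \<otimes>\<^bsub>A\<^esub> h f) \<and>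
    (\<forall>m\<in>M. h (\<epsilon> m) = \<theta> m)"
proof -
  let ?K = "tot_frac R" and ?B = "tot_frac A"
  let ?j = "to_tot_frac R" and ?k = "\<lambda>r. to_tot_frac A (\<iota> r)"
  have Mc: "m \<in> carrier ?K" if "m \<in> M" for m using M that by blast
  have kc: "?k r \<in> carrier ?B" if "r \<in> carrier R" for r using that by simp
  have \<epsilon>_smult: "\<epsilon> (?j r \<otimes>\<^bsub>?K\<^esub> m) = ?k r \<otimes>\<^bsub>?B\<^esub> \<epsilon> m" if "r \<in> carrier R" "m \<in> M" for r m
    using that Mc tot_loc_map(2) by simp
  have \<epsilon>c: "\<epsilon> m \<in> carrier ?B" if "m \<in> M" for m using Mc[OF that] by simp
  define rel where "rel f y \<longleftrightarrow> y \<in> carrier A \<and>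
    (\<exists>s\<in>carrier R - P. \<exists>m\<in>M. \<epsilon> m = ?k (s [^] q) \<otimes>\<^bsub>?B\<^esub> f \<and> \<iota> s \<otimes>\<^bsub>A\<^esub> y = \<theta> m)" for f y
  have \<theta>_cong: "\<theta> x = \<theta> x'" if x: "x \<in> M" "x' \<in> M" "\<epsilon> x = \<epsilon> x'" for x x'
  proof -
    obtain u where u: "u \<in> carrier R - P" "?j u \<otimes>\<^bsub>?K\<^esub> x = ?j u \<otimes>\<^bsub>?K\<^esub> x'"
      using tot_loc_map_eqD[OF Mc[OF x(1)] Mc[OF x(2)] x(3)] by blast
    have uc: "u \<in> carrier R" using u by simp
    obtain q' where q': "q = Suc q'" using q by (metis gr0_implies_Suc)
    have uq: "?j (u [^] q) \<otimes>\<^bsub>?K\<^esub> m = ?j (u [^] q') \<otimes>\<^bsub>?K\<^esub> (?j u \<otimes>\<^bsub>?K\<^esub> m)" if "m \<in> M" for m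
      using uc Mc[OF that] by (simp add: q' K.L.m_assoc)
    have "\<theta> (?j (u [^] q) \<otimes>\<^bsub>?K\<^esub> x) = \<theta> (?j (u [^] q) \<otimes>\<^bsub>?K\<^esub> x')"
      unfolding uq[OF x(1)] uq[OF x(2)] u(2) ..
    then have "\<iota> u \<otimes>\<^bsub>A\<^esub> \<theta> x = \<iota> u \<otimes>\<^bsub>A\<^esub> \<theta> x'" using \<theta>_smult[OF uc] x by simp
    then show ?thesis
      using S.L.Units_l_cancel[OF S.loc_map_Units[OF u(1)] \<theta>[OF x(1)] \<theta>[OF x(2)]] by blast
  qed
  have uniq: "y = y'" if f: "f \<in> carrier ?B" and y: "rel f y" "rel f y'" for f y y'
  proof -
    obtain s m where s: "s \<in> carrier R - P" "m \<in> M" "\<epsilon> m = ?k (s [^] q) \<otimes>\<^bsub>?B\<^esub> f" "\<iota> s \<otimes>\<^bsub>A\<^esub> y = \<theta> m"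
      using y(1) unfolding rel_def by blast
    obtain s' m' where s': "s' \<in> carrier R - P" "m' \<in> M" "\<epsilon> m' = ?k (s' [^] q) \<otimes>\<^bsub>?B\<^esub> f" "\<iota> s' \<otimes>\<^bsub>A\<^esub> y' = \<theta> m'"
      using y(2) unfolding rel_def by blast
    have yc: "y \<in> carrier A" "y' \<in> carrier A" using y by (simp_all add: rel_def)
    have sc: "s \<in> carrier R" "s' \<in> carrier R" using s(1) s'(1) by auto
    have sq: "s [^] q \<in> carrier R" "s' [^] q \<in> carrier R" using sc by auto
    have "\<epsilon> (?j (s' [^] q) \<otimes>\<^bsub>?K\<^esub> m) = \<epsilon> (?j (s [^] q) \<otimes>\<^bsub>?K\<^esub> m')"
      unfolding \<epsilon>_smult[OF sq(2) s(2)] \<epsilon>_smult[OF sq(1) s'(2)] s(3) s'(3)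
      using KP.L.m_lcomm[OF kc[OF sq(2)] kc[OF sq(1)] f] .
    then have "\<theta> (?j (s' [^] q) \<otimes>\<^bsub>?K\<^esub> m) = \<theta> (?j (s [^] q) \<otimes>\<^bsub>?K\<^esub> m')"
      by (intro \<theta>_cong M_smult sq s(2) s'(2))
    then have "\<iota> s' \<otimes>\<^bsub>A\<^esub> (\<iota> s \<otimes>\<^bsub>A\<^esub> y) = \<iota> s \<otimes>\<^bsub>A\<^esub> (\<iota> s' \<otimes>\<^bsub>A\<^esub> y')"
      unfolding \<theta>_smult[OF sc(2) s(2)] \<theta>_smult[OF sc(1) s'(2)] s(4) s'(4) .
    also have "\<dots> = \<iota> s' \<otimes>\<^bsub>A\<^esub> (\<iota> s \<otimes>\<^bsub>A\<^esub> y')" using sc yc by (intro S.L.m_lcomm) auto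
    finally have "\<iota> s \<otimes>\<^bsub>A\<^esub> y = \<iota> s \<otimes>\<^bsub>A\<^esub> y'"
      using S.L.Units_l_cancel[OF S.loc_map_Units[OF s'(1)]] sc yc by simp
    then show "y = y'" using S.L.Units_l_cancel[OF S.loc_map_Units[OF s(1)]] yc by simp
  qed
  define h where "h f = (THE y. rel f y)" for f
  have h: "h f = y" if "f \<in> carrier ?B" "rel f y" for f y
    unfolding h_def using that uniq by (intro the_equality) blast+
  have ex: "\<exists>y. rel f y" if f: "f \<in> N" for f
  proof -
    obtain s m where s: "s \<in> carrier R - P" "m \<in> M" "\<epsilon> m = ?k s \<otimes>\<^bsub>?B\<^esub> f" using N_M[OF f] by blast
    have sc: "s \<in> carrier R" using s(1) by simp
    have fc: "f \<in> carrier ?B" using f N by blast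
    obtain q' where q': "q = Suc q'" using q by (metis gr0_implies_Suc)
    define n where "n = ?j (s [^] q') \<otimes>\<^bsub>?K\<^esub> m"
    have n: "n \<in> M" unfolding n_def using sc s(2) by (intro M_smult) auto
    have "\<epsilon> n = ?k (s [^] q) \<otimes>\<^bsub>?B\<^esub> f"
      unfolding n_def using sc s(2) fc by (subst \<epsilon>_smult) (auto simp: s(3) q' KP.L.m_assoc)
    moreover have iU: "\<iota> s \<in> Units A" using s(1) by simp
    define y where "y = inv\<^bsub>A\<^esub> (\<iota> s) \<otimes>\<^bsub>A\<^esub> \<theta> n"
    have "y \<in> carrier A" using iU \<theta>[OF n] by (simp add: y_def)
    moreover have "\<iota> s \<otimes>\<^bsub>A\<^esub> y = \<theta> n"
      unfolding y_def using iU \<theta>[OF n] sc by (simp add: S.L.m_assoc[symmetric] S.L.Units_r_inv)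
    ultimately show ?thesis using s(1) n unfolding rel_def by blast
  qed
  have rel: "rel f (h f)" if "f \<in> N" for f using ex[OF that] h[of f] that N by auto
  show ?thesis
  proof (intro exI[of _ h] conjI ballI)
    fix f assume "f \<in> N" then show "h f \<in> carrier A" using rel by (simp add: rel_def)
  next
    fix f g assume f: "f \<in> N" and g: "g \<in> N"
    have fc: "f \<in> carrier ?B" "g \<in> carrier ?B" using f g N by auto
    obtain s m where s: "s \<in> carrier R - P" "m \<in> M" "\<epsilon> m = ?k (s [^] q) \<otimes>\<^bsub>?B\<^esub> f" "\<iota> s \<otimes>\<^bsub>A\<^esub> h f = \<theta> m"
      using rel[OF f] unfolding rel_def by blast
    obtain t n where t: "t \<in> carrier R - P" "n \<in> M" "\<epsilon> n = ?k (t [^] q) \<otimes>\<^bsub>?B\<^esub> g" "\<iota> t \<otimes>\<^bsub>A\<^esub> h g = \<theta> n"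
      using rel[OF g] unfolding rel_def by blast
    have hc: "h f \<in> carrier A" "h g \<in> carrier A" using rel f g by (simp_all add: rel_def)
    have sc: "s \<in> carrier R" "t \<in> carrier R" using s(1) t(1) by auto
    have sq: "s [^] q \<in> carrier R" "t [^] q \<in> carrier R" using sc by auto
    have Mm: "?j (t [^] q) \<otimes>\<^bsub>?K\<^esub> m \<in> M" "?j (s [^] q) \<otimes>\<^bsub>?K\<^esub> n \<in> M"
      using M_smult sq s(2) t(2) by auto
    define w where "w = (?j (t [^] q) \<otimes>\<^bsub>?K\<^esub> m) \<oplus>\<^bsub>?K\<^esub> (?j (s [^] q) \<otimes>\<^bsub>?K\<^esub> n)"
    have w: "w \<in> M" unfolding w_def using Mm by (rule M_add)
    have st: "?k ((s \<otimes> t) [^] q) = ?k (s [^] q) \<otimes>\<^bsub>?B\<^esub> ?k (t [^] q)"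
      using sc sq by (simp add: nat_pow_distrib)
    have "\<epsilon> w = ?k (t [^] q) \<otimes>\<^bsub>?B\<^esub> (?k (s [^] q) \<otimes>\<^bsub>?B\<^esub> f) \<oplus>\<^bsub>?B\<^esub> ?k (s [^] q) \<otimes>\<^bsub>?B\<^esub> (?k (t [^] q) \<otimes>\<^bsub>?B\<^esub> g)"
      unfolding w_def \<epsilon>.hom_add[OF Mc[OF Mm(1)] Mc[OF Mm(2)]]
        \<epsilon>_smult[OF sq(2) s(2)] \<epsilon>_smult[OF sq(1) t(2)] s(3) t(3) ..
    also have "\<dots> = ?k ((s \<otimes> t) [^] q) \<otimes>\<^bsub>?B\<^esub> (f \<oplus>\<^bsub>?B\<^esub> g)"
      unfolding st using kc[OF sq(1)] kc[OF sq(2)] fc by (simp add: KP.L.m_ac KP.L.l_distr KP.L.r_distr)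
    finally have e: "\<epsilon> w = ?k ((s \<otimes> t) [^] q) \<otimes>\<^bsub>?B\<^esub> (f \<oplus>\<^bsub>?B\<^esub> g)" .
    have "\<theta> w = \<iota> t \<otimes>\<^bsub>A\<^esub> (\<iota> s \<otimes>\<^bsub>A\<^esub> h f) \<oplus>\<^bsub>A\<^esub> \<iota> s \<otimes>\<^bsub>A\<^esub> (\<iota> t \<otimes>\<^bsub>A\<^esub> h g)"
      unfolding w_def \<theta>_add[OF Mm] \<theta>_smult[OF sc(2) s(2)] \<theta>_smult[OF sc(1) t(2)] s(4) t(4) ..
    also have "\<dots> = \<iota> (s \<otimes> t) \<otimes>\<^bsub>A\<^esub> (h f \<oplus>\<^bsub>A\<^esub> h g)"
      using sc hc by (simp add: S.L.m_ac S.L.r_distr)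
    finally have "rel (f \<oplus>\<^bsub>?B\<^esub> g) (h f \<oplus>\<^bsub>A\<^esub> h g)"
      unfolding rel_def using S.mult_S[OF s(1) t(1)] w e hc S.L.add.m_closed[OF hc] by metis
    then show "h (f \<oplus>\<^bsub>?B\<^esub> g) = h f \<oplus>\<^bsub>A\<^esub> h g" using fc by (intro h) auto
  next
    fix r f assume r: "r \<in> carrier A" and f: "f \<in> N"
    have fc: "f \<in> carrier ?B" using f N by auto
    obtain a t where a: "a \<in> carrier R" "t \<in> carrier R - P" "r = loc_frac R (carrier R - P) a t"
      using r by (rule S.loc_cases)
    have tr: "\<iota> t \<otimes>\<^bsub>A\<^esub> r = \<iota> a" unfolding a(3) by (rule S.frac_cancel[OF a(1,2)])
    obtain s m where s: "s \<in> carrier R - P" "m \<in> M" "\<epsilon> m = ?k (s [^] q) \<otimes>\<^bsub>?B\<^esub> f" "\<iota> s \<otimes>\<^bsub>A\<^esub> h f = \<theta> m"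
      using rel[OF f] unfolding rel_def by blast
    have hc: "h f \<in> carrier A" using rel f by (simp add: rel_def)
    have sc: "s \<in> carrier R" "t \<in> carrier R" using s(1) a(2) by auto
    have sq: "s [^] q \<in> carrier R" "t [^] q \<in> carrier R" "a [^] q \<in> carrier R" using sc a(1) by auto
    have rq: "to_tot_frac A (r [^]\<^bsub>A\<^esub> q) \<in> carrier ?B" using r by simp
    define w where "w = ?j (a [^] q) \<otimes>\<^bsub>?K\<^esub> m"
    have w: "w \<in> M" unfolding w_def using sq(3) s(2) by (rule M_smult)
    have "?k (t [^] q) \<otimes>\<^bsub>?B\<^esub> to_tot_frac A (r [^]\<^bsub>A\<^esub> q) = to_tot_frac A ((\<iota> t \<otimes>\<^bsub>A\<^esub> r) [^]\<^bsub>A\<^esub> q)"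
      using sc r by (simp add: S.loc_map_pow S.L.nat_pow_distrib)
    also have "\<dots> = ?k (a [^] q)" unfolding tr using a(1) by (simp add: S.loc_map_pow)
    finally have tq: "?k (t [^] q) \<otimes>\<^bsub>?B\<^esub> to_tot_frac A (r [^]\<^bsub>A\<^esub> q) = ?k (a [^] q)" .
    have "\<epsilon> w = (?k (t [^] q) \<otimes>\<^bsub>?B\<^esub> to_tot_frac A (r [^]\<^bsub>A\<^esub> q)) \<otimes>\<^bsub>?B\<^esub> (?k (s [^] q) \<otimes>\<^bsub>?B\<^esub> f)"
      unfolding w_def \<epsilon>_smult[OF sq(3) s(2)] s(3) tq ..
    also have "\<dots> = (?k (s [^] q) \<otimes>\<^bsub>?B\<^esub> ?k (t [^] q)) \<otimes>\<^bsub>?B\<^esub> (to_tot_frac A (r [^]\<^bsub>A\<^esub> q) \<otimes>\<^bsub>?B\<^esub> f)"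
      using kc[OF sq(1)] kc[OF sq(2)] fc rq by (simp add: KP.L.m_ac)
    also have "?k (s [^] q) \<otimes>\<^bsub>?B\<^esub> ?k (t [^] q) = ?k ((s \<otimes> t) [^] q)"
      using sc sq by (simp add: nat_pow_distrib)
    finally have e: "\<epsilon> w = ?k ((s \<otimes> t) [^] q) \<otimes>\<^bsub>?B\<^esub> (to_tot_frac A (r [^]\<^bsub>A\<^esub> q) \<otimes>\<^bsub>?B\<^esub> f)" .
    have "\<theta> w = (\<iota> t \<otimes>\<^bsub>A\<^esub> r) \<otimes>\<^bsub>A\<^esub> (\<iota> s \<otimes>\<^bsub>A\<^esub> h f)"
      unfolding w_def \<theta>_smult[OF a(1) s(2)] s(4) tr ..
    also have "\<dots> = \<iota> (s \<otimes> t) \<otimes>\<^bsub>A\<^esub> (r \<otimes>\<^bsub>A\<^esub> h f)"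
      using sc hc r by (simp add: S.L.m_ac)
    finally have "rel (to_tot_frac A (r [^]\<^bsub>A\<^esub> q) \<otimes>\<^bsub>?B\<^esub> f) (r \<otimes>\<^bsub>A\<^esub> h f)"
      unfolding rel_def using S.mult_S[OF s(1) a(2)] w e S.L.m_closed[OF r hc] by metis
    then show "h (to_tot_frac A (r [^]\<^bsub>A\<^esub> q) \<otimes>\<^bsub>?B\<^esub> f) = r \<otimes>\<^bsub>A\<^esub> h f" using fc rq by (intro h) auto
  next
    fix m assume m: "m \<in> M"
    have "rel (\<epsilon> m) (\<theta> m)"
      unfolding rel_def using m \<theta>[OF m] \<epsilon>c[OF m] S.one_S
      by (intro conjI bexI[of _ \<one>] bexI[of _ m]) auto
    then show "h (\<epsilon> m) = \<theta> m" using \<epsilon>c[OF m] by (intro h) auto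
  qed
qed

end

section \<open>The divisors of a triple near two nested primes\<close>

abbreviation center_divisor ::
    "('a, 'm) ring_scheme \<Rightarrow> 'a set \<Rightarrow> ('a set \<Rightarrow> real) \<Rightarrow> nat \<Rightarrow> ('a \<times> 'a) set set \<Rightarrow> int" where
  "center_divisor R P \<Delta> k \<equiv> div_ceil (\<lambda>Q. real k * div_restrict R P \<Delta> Q)"

abbreviation center_sections where
  "center_sections R P \<Delta> k \<equiv> div_sections (loc_at R P) (center_divisor R P \<Delta> k)"

lemma center_divisor_nonneg: "effective \<Delta> \<Longrightarrow> center_divisor R P \<Delta> k Q \<ge> 0"
proof -
  assume "effective \<Delta>"
  then have "real k * div_restrict R P \<Delta> Q \<ge> 0"
    by (simp add: div_restrict_def effective_def)
  then show ?thesis unfolding div_ceil_def by linarith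
qed

lemma center_divisor_nonzero: "center_divisor R P \<Delta> k \<noteq> (\<lambda>_. 0) \<Longrightarrow> \<Delta> \<noteq> (\<lambda>_. 0)"
proof -
  have "center_divisor R P (\<lambda>_. 0) k = (\<lambda>_. 0)"
    by (auto simp: div_ceil_def div_restrict_def fun_eq_iff)
  then show "center_divisor R P \<Delta> k \<noteq> (\<lambda>_. 0) \<Longrightarrow> \<Delta> \<noteq> (\<lambda>_. 0)" by blast
qed

lemma prime_localizationI: "cring R \<Longrightarrow> primeideal P R \<Longrightarrow> prime_localization R P"
  by (simp add: prime_localization_def prime_localization_axioms_def)

context prime_localization
begin

lemma zero_notin: "\<zero> \<notin> carrier R - P" by simp

lemma disjoint_iff:
  assumes "primeideal q R"
  shows "q \<inter> (carrier R - P) = {} \<longleftrightarrow> q \<subseteq> P"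
proof -
  interpret q: primeideal q R by fact
  have "q \<subseteq> carrier R" using q.Icarr by blast
  then show ?thesis by blast
qed

lemma center_sections_closed:
  assumes "effective \<Delta>" and U: "\<Delta> \<noteq> (\<lambda>_. 0) \<Longrightarrow> has_uniformizers R"
  shows "carrier (center_sections R P \<Delta> k) \<subseteq> carrier (tot_frac A)"
    and "\<And>a. a \<in> carrier A \<Longrightarrow> to_tot_frac A a \<in> carrier (center_sections R P \<Delta> k)"
    and "\<And>f g. \<lbrakk>f \<in> carrier (center_sections R P \<Delta> k); g \<in> carrier (center_sections R P \<Delta> k)\<rbrakk> \<Longrightarrow>
      f \<oplus>\<^bsub>tot_frac A\<^esub> g \<in> carrier (center_sections R P \<Delta> k)"
    and "\<And>a f. \<lbrakk>a \<in> carrier A; f \<in> carrier (center_sections R P \<Delta> k)\<rbrakk> \<Longrightarrow>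
      to_tot_frac A a \<otimes>\<^bsub>tot_frac A\<^esub> f \<in> carrier (center_sections R P \<Delta> k)"
proof -
  have "has_uniformizers A" if "center_divisor R P \<Delta> k \<noteq> (\<lambda>_. 0)"
    using S.loc_has_uniformizers[OF U[OF center_divisor_nonzero[OF that]] zero_notin] .
  note * = div_sections_closed[OF S.loc_cring this center_divisor_nonneg[OF assms(1)]]
  show "carrier (center_sections R P \<Delta> k) \<subseteq> carrier (tot_frac A)"
    by (rule *(1)) auto
  show "to_tot_frac A a \<in> carrier (center_sections R P \<Delta> k)" if "a \<in> carrier A" for a
    by (rule *(2)) (use that in auto)
  show "f \<oplus>\<^bsub>tot_frac A\<^esub> g \<in> carrier (center_sections R P \<Delta> k)"
    if "f \<in> carrier (center_sections R P \<Delta> k)" "g \<in> carrier (center_sections R P \<Delta> k)" for f g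
    by (rule *(3)) (use that in auto)
  show "to_tot_frac A a \<otimes>\<^bsub>tot_frac A\<^esub> f \<in> carrier (center_sections R P \<Delta> k)"
    if "a \<in> carrier A" "f \<in> carrier (center_sections R P \<Delta> k)" for a f
    by (rule *(4)) (use that in auto)
qed

lemma ring_ord_loc:
  assumes U: "has_uniformizers R" and q: "height_one_prime R q" "q \<subseteq> P" and b: "b \<in> carrier R" "b \<noteq> \<zero>"
  shows "ring_ord A (loc_ext R (carrier R - P) q) (\<iota> b) = ring_ord R q b"
proof -
  have dom: "domain R" using U by (simp add: has_uniformizers_def)
  have qp: "primeideal q R" using q(1) by (simp add: height_one_prime_def)
  have disj: "q \<inter> (carrier R - P) = {}" using q(2) disjoint_iff[OF qp] by blast
  obtain \<pi> where v: "height_one_valuation R q \<pi>" using q(1) by (rule has_uniformizers_valuation[OF U])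
  have "has_order R q \<pi> b (ring_ord R q b)"
    using height_one_valuation.has_order_ring_ord[OF v b] .
  then have "has_order A (loc_ext R (carrier R - P) q) (\<iota> \<pi>) (\<iota> b) (ring_ord R q b)"
    using S.has_order_loc[OF qp disj height_one_valuation.uniformizer_closed(3)[OF v] b(1) S.one_S]
    by (simp add: loc_map_def)
  then show ?thesis
    using ring_ord_eq[OF S.loc_domain[OF dom zero_notin] S.loc_ext_prime[OF qp disj]
        S.uniformizer_loc[OF dom zero_notin qp disj height_one_valuation.unif[OF v]]] b(1)
    by simp
qed

lemma frac_in_center_sections_iff:
  assumes U: "has_uniformizers R" and D: "center_divisor R P \<Delta> k \<noteq> (\<lambda>_. 0)"
    and b: "b \<in> carrier R" "b \<noteq> \<zero>" and c: "c \<in> carrier R" "c \<noteq> \<zero>"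
  shows "loc_frac A (nonzerodivisors A) (\<iota> b) (\<iota> c) \<in> carrier (center_sections R P \<Delta> k) \<longleftrightarrow>
    (\<forall>q. height_one_prime R q \<and> q \<subseteq> P \<longrightarrow>
      int (ring_ord R q b) - int (ring_ord R q c) + \<lceil>real k * \<Delta> q\<rceil> \<ge> 0)" (is "?L \<longleftrightarrow> ?R")
proof -
  have dom: "domain R" using U by (simp add: has_uniformizers_def)
  interpret AD: domain A by (rule S.loc_domain[OF dom zero_notin])
  have nz: "\<iota> b \<in> carrier A" "\<iota> b \<noteq> \<zero>\<^bsub>A\<^esub>" "\<iota> c \<in> carrier A" "\<iota> c \<noteq> \<zero>\<^bsub>A\<^esub>"
    using b c S.loc_map_eq_zero_iff_domain[OF dom zero_notin] by auto
  note iff = AD.frac_in_div_sections_iff[OF S.loc_has_uniformizers[OF U zero_notin] D nz]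
  have val: "center_divisor R P \<Delta> k Q = \<lceil>real k * \<Delta> (loc_contr R (carrier R - P) Q)\<rceil>"
    if "height_one_prime A Q" for Q
    using that by (simp add: div_ceil_def div_restrict_def loc_contr_def)
  show ?thesis
  proof
    assume L: ?L
    show ?R
    proof (intro allI impI)
      fix q assume q: "height_one_prime R q \<and> q \<subseteq> P"
      then have qp: "primeideal q R" by (simp add: height_one_prime_def)
      have disj: "q \<inter> (carrier R - P) = {}" using q disjoint_iff[OF qp] by blast
      let ?Q = "loc_ext R (carrier R - P) q"
      have Q: "height_one_prime A ?Q" using S.height_one_loc_ext[OF dom zero_notin _ disj] q by blast
      have "int (ring_ord A ?Q (\<iota> b)) - int (ring_ord A ?Q (\<iota> c)) + center_divisor R P \<Delta> k ?Q \<ge> 0"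
        using L iff Q by blast
      then show "int (ring_ord R q b) - int (ring_ord R q c) + \<lceil>real k * \<Delta> q\<rceil> \<ge> 0"
        using q b c by (simp add: val[OF Q] S.loc_contr_ext[OF qp disj] ring_ord_loc[OF U])
    qed
  next
    assume R: ?R
    show ?L
      unfolding iff
    proof (intro allI impI)
      fix Q assume Q: "height_one_prime A Q"
      then have Qp: "primeideal Q A" by (simp add: height_one_prime_def)
      let ?q = "loc_contr R (carrier R - P) Q"
      have q: "height_one_prime R ?q" by (rule S.height_one_loc_contr[OF dom zero_notin Q])
      have qP: "?q \<subseteq> P" using S.loc_contr_prime[OF Qp] disjoint_iff by blast
      have ord: "ring_ord A Q (\<iota> x) = ring_ord R ?q x" if "x \<in> carrier R" "x \<noteq> \<zero>" for x
        using ring_ord_loc[OF U q qP that] S.loc_ext_contr[OF primeideal.axioms(1)[OF Qp]] by simp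
      show "int (ring_ord A Q (\<iota> b)) - int (ring_ord A Q (\<iota> c)) + center_divisor R P \<Delta> k Q \<ge> 0"
        using R q qP unfolding val[OF Q] ord[OF b] ord[OF c] by blast
    qed
  qed
qed

text \<open>Every section near \<open>P\<close> becomes, after multiplication by some \<open>s \<notin> P\<close>, a section near all
  larger primes. Beyond a common denominator, \<open>s\<close> has to cancel the poles along the finitely many
  components of the denominator that do not pass through \<open>P\<close>.\<close>

lemma center_sections_extend:
  assumes noeth: "noetherian_ring R" and eff: "effective \<Delta>"
    and U: "\<Delta> \<noteq> (\<lambda>_. 0) \<Longrightarrow> has_uniformizers R"
    and f: "f \<in> carrier (center_sections R P \<Delta> k)"
  shows "\<exists>s\<in>carrier R - P. \<exists>m\<in>carrier (tot_frac R).
    \<epsilon> m = to_tot_frac A (\<iota> s) \<otimes>\<^bsub>tot_frac A\<^esub> f \<and>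
    (\<forall>Q. primeideal Q R \<and> P \<subseteq> Q \<longrightarrow> tot_loc_map R Q m \<in> carrier (center_sections R Q \<Delta> k))"
proof -
  have regular: "tot_loc_map R Q (to_tot_frac R a) \<in> carrier (center_sections R Q \<Delta> k)"
    if a: "a \<in> carrier R" and Q: "primeideal Q R" for a Q
  proof -
    interpret Q: prime_localization R Q by (rule prime_localizationI[OF is_cring Q])
    show ?thesis
      using Q.center_sections_closed(2)[OF eff U, of "Q.\<iota> a"] a by (simp add: Q.tot_loc_map(2))
  qed
  show ?thesis
  proof (cases "center_divisor R P \<Delta> k = (\<lambda>_. 0)")
    case True
    then obtain x where x: "x \<in> carrier A" "f = to_tot_frac A x"
      using f by (auto simp: div_sections_def)
    obtain a s where a: "a \<in> carrier R" "s \<in> carrier R - P" "x = loc_frac R (carrier R - P) a s"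
      using x(1) by (rule S.loc_cases)
    have "\<iota> s \<otimes>\<^bsub>A\<^esub> x = \<iota> a" unfolding a(3) by (rule S.frac_cancel[OF a(1,2)])
    moreover have "to_tot_frac A (\<iota> s \<otimes>\<^bsub>A\<^esub> x) = to_tot_frac A (\<iota> s) \<otimes>\<^bsub>tot_frac A\<^esub> f"
      unfolding x(2) using a x(1) by (intro KP.loc_map.hom_mult) auto
    ultimately have "\<epsilon> (to_tot_frac R a) = to_tot_frac A (\<iota> s) \<otimes>\<^bsub>tot_frac A\<^esub> f"
      using a(1) by (simp add: tot_loc_map(2))
    then show ?thesis
      using a regular[OF a(1)] K.loc_map.hom_closed[OF a(1)] by blast
  next
    case D: False
    then have UR: "has_uniformizers R" using U center_divisor_nonzero by blast
    then have dom: "domain R" by (simp add: has_uniformizers_def)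
    interpret domain R by (rule dom)
    interpret noetherian_ring R by (rule noeth)
    interpret noetherian_domain R ..
    interpret AD: domain A by (rule S.loc_domain[OF dom zero_notin])
    show ?thesis using D f
    proof (cases rule: AD.div_sections_cases)
      case 1
      have e: "\<epsilon> (to_tot_frac R \<zero>) = to_tot_frac A (\<iota> \<one>) \<otimes>\<^bsub>tot_frac A\<^esub> f"
        using 1 by simp
      show ?thesis
      proof (intro bexI conjI allI impI)
        show "\<epsilon> (to_tot_frac R \<zero>) = to_tot_frac A (\<iota> \<one>) \<otimes>\<^bsub>tot_frac A\<^esub> f" by (rule e)
        show "to_tot_frac R \<zero> \<in> carrier (tot_frac R)" by simp
        show "\<one> \<in> carrier R - P" by (rule S.one_S)
        fix Q assume "primeideal Q R \<and> P \<subseteq> Q"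
        then show "tot_loc_map R Q (to_tot_frac R \<zero>) \<in> carrier (center_sections R Q \<Delta> k)"
          using regular[OF zero_closed] by blast
      qed
    next
      case (2 x y)
      obtain a s where a: "a \<in> carrier R" "s \<in> carrier R - P" "x = loc_frac R (carrier R - P) a s"
        using 2(1) by (rule S.loc_cases)
      obtain a' s' where a': "a' \<in> carrier R" "s' \<in> carrier R - P" "y = loc_frac R (carrier R - P) a' s'"
        using 2(3) by (rule S.loc_cases)
      define b where "b = a \<otimes> s'"
      define c where "c = a' \<otimes> s"
      have nz: "a \<noteq> \<zero>" "a' \<noteq> \<zero>" "s \<noteq> \<zero>" "s' \<noteq> \<zero>"
        using 2(2,4) a a' S.frac_eq_zero_iff_domain[OF dom zero_notin] by auto
      have b: "b \<in> carrier R" "b \<noteq> \<zero>" and c: "c \<in> carrier R" "c \<noteq> \<zero>"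
        using a a' nz by (auto simp: b_def c_def integral_iff)
      have cn: "c \<in> nonzerodivisors R" using c by (simp add: nonzerodivisors_iff)
      have "x \<otimes>\<^bsub>A\<^esub> \<iota> c = \<iota> b \<otimes>\<^bsub>A\<^esub> y"
      proof -
        have "x \<otimes>\<^bsub>A\<^esub> \<iota> c = loc_frac R (carrier R - P) (a \<otimes> c) (s \<otimes> \<one>)"
          unfolding a(3) loc_map_def by (rule S.frac_mult[OF a(1,2) c(1) S.one_S])
        also have "\<dots> = loc_frac R (carrier R - P) (b \<otimes> a') (\<one> \<otimes> s')"
          using a a' b(1) c(1) by (intro S.frac_eqI) (auto simp: b_def c_def m_ac)
        also have "\<dots> = \<iota> b \<otimes>\<^bsub>A\<^esub> y"
          unfolding a'(3) loc_map_def by (rule S.frac_mult[OF b(1) S.one_S a'(1,2), symmetric])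
        finally show ?thesis .
      qed
      then have fbc: "f = loc_frac A (nonzerodivisors A) (\<iota> b) (\<iota> c)"
        unfolding 2(5) using 2 b nonzerodivisors_loc[OF cn]
        by (intro KP.frac_eqI) (auto simp: AD.nonzerodivisors_iff)
      obtain s0 where s0: "s0 \<in> carrier R - P"
        "\<forall>q. height_one_prime R q \<and> \<not> q \<subseteq> P \<longrightarrow> ring_ord R q c \<le> ring_ord R q s0"
        by (rule exists_multiple_order[OF UR P c])
      have s0': "s0 \<in> carrier R" "s0 \<noteq> \<zero>" using s0(1) by auto
      define b2 where "b2 = s0 \<otimes> b"
      have b2: "b2 \<in> carrier R" "b2 \<noteq> \<zero>" using s0' b by (auto simp: b2_def integral_iff)
      define m where "m = loc_frac R (nonzerodivisors R) b2 c"
      have mc: "m \<in> carrier (tot_frac R)" using b2(1) cn by (simp add: m_def)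
      have e: "\<epsilon> m = to_tot_frac A (\<iota> s0) \<otimes>\<^bsub>tot_frac A\<^esub> f"
      proof -
        have "to_tot_frac A (\<iota> s0) \<otimes>\<^bsub>tot_frac A\<^esub> f
          = loc_frac A (nonzerodivisors A) (\<iota> s0 \<otimes>\<^bsub>A\<^esub> \<iota> b) (\<one>\<^bsub>A\<^esub> \<otimes>\<^bsub>A\<^esub> \<iota> c)"
          unfolding fbc loc_map_def[of A] using s0' b nonzerodivisors_loc[OF cn]
          by (intro KP.frac_mult) auto
        also have "\<dots> = \<epsilon> m"
          unfolding m_def tot_loc_map_frac[OF b2(1) cn] using s0' b c by (simp add: b2_def)
        finally show ?thesis by simp
      qed
      have "tot_loc_map R Q m \<in> carrier (center_sections R Q \<Delta> k)"
        if Q: "primeideal Q R" "P \<subseteq> Q" for Q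
      proof -
        interpret Q: prime_localization R Q by (rule prime_localizationI[OF is_cring Q(1)])
        have mem: "tot_loc_map R Q m = loc_frac Q.A (nonzerodivisors Q.A) (Q.\<iota> b2) (Q.\<iota> c)"
          unfolding m_def by (rule Q.tot_loc_map_frac[OF b2(1) cn])
        have bound: "int (ring_ord R q b2) - int (ring_ord R q c) + \<lceil>real k * \<Delta> q\<rceil> \<ge> 0"
          if q: "height_one_prime R q" for q
        proof -
          obtain \<pi> where "height_one_valuation R q \<pi>"
            using q by (rule has_uniformizers_valuation[OF UR])
          then interpret height_one_valuation R q \<pi> .
          have o: "ring_ord R q b2 = ring_ord R q s0 + ring_ord R q b"
            unfolding b2_def by (rule ring_ord_mult[OF s0' b])
          have "real k * \<Delta> q \<ge> 0" using eff by (simp add: effective_def)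
          then have pos: "\<lceil>real k * \<Delta> q\<rceil> \<ge> 0" by linarith
          show ?thesis
          proof (cases "q \<subseteq> P")
            case True
            then have "int (ring_ord R q b) - int (ring_ord R q c) + \<lceil>real k * \<Delta> q\<rceil> \<ge> 0"
              using f q frac_in_center_sections_iff[OF UR D b c] unfolding fbc by blast
            then show ?thesis using o by simp
          next
            case False
            then have "ring_ord R q c \<le> ring_ord R q s0" using s0(2) q by blast
            then show ?thesis using o pos by simp
          qed
        qed
        have "center_divisor R Q \<Delta> k \<noteq> (\<lambda>_. 0)"
        proof -
          obtain q' where q': "center_divisor R P \<Delta> k q' \<noteq> 0" using D by blast
          then have ht: "height_one_prime A q'"
            by (auto simp: div_ceil_def div_restrict_def split: if_splits)
          define q where "q = loc_contr R (carrier R - P) q'"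
          have val: "\<lceil>real k * \<Delta> q\<rceil> \<noteq> 0"
            using q' ht by (simp add: div_ceil_def div_restrict_def q_def loc_contr_def)
          have qh: "height_one_prime R q" unfolding q_def by (rule S.height_one_loc_contr[OF dom zero_notin ht])
          then have qp: "primeideal q R" by (simp add: height_one_prime_def)
          have "q \<inter> (carrier R - P) = {}"
            unfolding q_def using ht by (intro S.loc_contr_prime) (simp add: height_one_prime_def)
          then have disj: "q \<inter> (carrier R - Q) = {}" using Q(2) by blast
          have "height_one_prime Q.A (loc_ext R (carrier R - Q) q)"
            by (rule Q.S.height_one_loc_ext[OF dom Q.zero_notin qh disj])
          then have "center_divisor R Q \<Delta> k (loc_ext R (carrier R - Q) q) = \<lceil>real k * \<Delta> q\<rceil>"
            using Q.S.loc_contr_ext[OF qp disj]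
            by (simp add: div_ceil_def div_restrict_def loc_contr_def)
          with val show ?thesis by auto
        qed
        then show ?thesis
          unfolding mem using Q.frac_in_center_sections_iff[OF UR _ b2 c] bound by blast
      qed
      then show ?thesis using s0(1) mc e by blast
    qed
  qed
qed

end

section \<open>Centers of sharp F-purity\<close>

lemma frob_push_simps [simp]:
  "carrier (frob_push p e R M) = carrier M"
  "x \<oplus>\<^bsub>frob_push p e R M\<^esub> y = x \<oplus>\<^bsub>M\<^esub> y"
  "\<zero>\<^bsub>frob_push p e R M\<^esub> = \<zero>\<^bsub>M\<^esub>"
  "r \<odot>\<^bsub>frob_push p e R M\<^esub> x = (r [^]\<^bsub>R\<^esub> (p ^ e)) \<odot>\<^bsub>M\<^esub> x"
  by (simp_all add: frob_push_def)

lemma self_module_simps [simp]: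
  "carrier (self_module R) = carrier R"
  "x \<oplus>\<^bsub>self_module R\<^esub> y = x \<oplus>\<^bsub>R\<^esub> y"
  "\<zero>\<^bsub>self_module R\<^esub> = \<zero>\<^bsub>R\<^esub>"
  "r \<odot>\<^bsub>self_module R\<^esub> x = r \<otimes>\<^bsub>R\<^esub> x"
  by (simp_all add: self_module_def)

lemma frob_linear_maps_iff:
  "h \<in> linear_maps R (frob_push p e R (div_sections R D)) (self_module R) \<longleftrightarrow>
    (\<forall>f\<in>carrier (div_sections R D). h f \<in> carrier R) \<and>
    (\<forall>f\<in>carrier (div_sections R D). \<forall>g\<in>carrier (div_sections R D).
      h (f \<oplus>\<^bsub>tot_frac R\<^esub> g) = h f \<oplus>\<^bsub>R\<^esub> h g) \<and>
    (\<forall>r\<in>carrier R. \<forall>f\<in>carrier (div_sections R D).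
      h (to_tot_frac R (r [^]\<^bsub>R\<^esub> (p ^ e)) \<otimes>\<^bsub>tot_frac R\<^esub> f) = r \<otimes>\<^bsub>R\<^esub> h f)"
  by (auto simp: linear_maps_def div_sections_simps)

text \<open>The condition defining a center \<open>P\<close> says that the maps on sections near \<open>P\<close> carry \<open>P\<close> into
  itself. This is inherited by maps \<open>\<phi>\<close> on sections near a larger prime \<open>Q\<close>, because such a map
  localizes to \<open>P\<close>: a value of \<open>\<phi>\<close> outside \<open>P\<close> would become a unit there and yield a splitting.\<close>

lemma center_compatible:
  fixes R :: "('a, 'm) ring_scheme" (structure)
  assumes triple: "triple p R \<Delta> \<aa>" and center: "center_of_sharp_F_purity p R \<Delta> \<aa> P"
    and Q: "primeideal Q R" and PQ: "P \<subseteq> Q" and e: "e > 0" and a: "a \<in> \<aa> (p ^ e - 1)"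
    and \<phi>: "\<phi> \<in> linear_maps (loc_at R Q)
      (frob_push p e (loc_at R Q) (center_sections R Q \<Delta> (p ^ e - 1))) (self_module (loc_at R Q))"
    and x: "x \<in> P" and y: "y \<in> carrier R" and t: "t \<in> carrier R - Q"
    and val: "\<phi> (to_tot_frac (loc_at R Q) (to_loc_at R Q (x \<otimes> a))) = loc_frac R (carrier R - Q) y t"
  shows "y \<in> P"
proof (rule ccontr)
  assume yP: "y \<notin> P"
  have Pp: "primeideal P R" using center by (simp add: center_of_sharp_F_purity_def)
  have ff: "F_finite_ring p R" and eff: "effective \<Delta>" using triple by (simp_all add: triple_def)
  have cr: "cring R" and noeth: "noetherian_ring R" and "prime p"
    using ff by (simp_all add: F_finite_ring_def)
  interpret cring R by (rule cr)
  interpret P: prime_localization R P by (rule prime_localizationI[OF is_cring Pp])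
  interpret Q: prime_localization R Q by (rule prime_localizationI[OF is_cring Q])
  have U: "has_uniformizers R" if "\<Delta> \<noteq> (\<lambda>_. 0)"
    using that triple normal_has_uniformizers[OF noeth] by (simp add: triple_def)
  have "ideal (\<aa> (p ^ e - 1)) R" using triple by (simp add: triple_def graded_system_def)
  then have ac: "a \<in> carrier R" using a ideal.Icarr by metis
  have xc: "x \<in> carrier R" using x P.P.Icarr by blast
  have q: "p ^ e > 0" using \<open>prime p\<close> prime_gt_0_nat by simp
  define NP where "NP = carrier (center_sections R P \<Delta> (p ^ e - 1))"
  define NQ where "NQ = carrier (center_sections R Q \<Delta> (p ^ e - 1))"
  note closedP = P.center_sections_closed[OF eff U, where k = "p ^ e - 1", folded NP_def]
  note closedQ = Q.center_sections_closed[OF eff U, where k = "p ^ e - 1", folded NQ_def]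
  have \<phi>c: "\<And>f. f \<in> NQ \<Longrightarrow> \<phi> f \<in> carrier Q.A"
    and \<phi>_add: "\<And>f g. f \<in> NQ \<Longrightarrow> g \<in> NQ \<Longrightarrow> \<phi> (f \<oplus>\<^bsub>tot_frac Q.A\<^esub> g) = \<phi> f \<oplus>\<^bsub>Q.A\<^esub> \<phi> g"
    and \<phi>_smult: "\<And>r f. r \<in> carrier Q.A \<Longrightarrow> f \<in> NQ \<Longrightarrow>
      \<phi> (to_tot_frac Q.A (r [^]\<^bsub>Q.A\<^esub> (p ^ e)) \<otimes>\<^bsub>tot_frac Q.A\<^esub> f) = r \<otimes>\<^bsub>Q.A\<^esub> \<phi> f"
    using \<phi> unfolding frob_linear_maps_iff NQ_def by blast+
  have "P.\<iota> ` (carrier R - Q) \<subseteq> Units P.A" using PQ by auto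
  from Q.S.loc_lift[OF P.S.loc_cring P.S.loc_map_hom this]
  obtain l where l: "l \<in> ring_hom Q.A P.A" "\<forall>a\<in>carrier R. l (Q.\<iota> a) = P.\<iota> a" by blast
  interpret l: ring_hom_cring Q.A P.A l by unfold_locales (rule l(1))
  (* When the divisor vanishes near P but not near Q, a section near Q is one near P only because a
     normal domain is the intersection of its localizations at the primes of height one. Restricting
     to common sections avoids this. *)
  define M where "M = {m \<in> carrier (tot_frac R). P.\<epsilon> m \<in> NP \<and> Q.\<epsilon> m \<in> NQ}"
  define \<theta> where "\<theta> m = l (\<phi> (Q.\<epsilon> m))" for m
  have M_add: "m \<oplus>\<^bsub>tot_frac R\<^esub> n \<in> M" if "m \<in> M" "n \<in> M" for m n
    using that closedP(3) closedQ(3) unfolding M_def by simp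
  have M_smult: "to_tot_frac R r \<otimes>\<^bsub>tot_frac R\<^esub> m \<in> M" if "r \<in> carrier R" "m \<in> M" for r m
    using that closedP(4)[of "P.\<iota> r" "P.\<epsilon> m"] closedQ(4)[of "Q.\<iota> r" "Q.\<epsilon> m"] unfolding M_def
    by (simp add: P.tot_loc_map(2) Q.tot_loc_map(2))
  have Msub: "M \<subseteq> carrier (tot_frac R)" by (auto simp: M_def)
  have MQ: "Q.\<epsilon> m \<in> NQ" if "m \<in> M" for m using that by (simp add: M_def)
  have \<theta>c: "\<theta> m \<in> carrier P.A" if "m \<in> M" for m
    unfolding \<theta>_def using \<phi>c[OF MQ[OF that]] by simp
  have \<theta>_add: "\<theta> (m \<oplus>\<^bsub>tot_frac R\<^esub> n) = \<theta> m \<oplus>\<^bsub>P.A\<^esub> \<theta> n" if "m \<in> M" "n \<in> M" for m n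
    using that MQ \<phi>c \<phi>_add Msub unfolding \<theta>_def by (simp add: subset_iff)
  have \<theta>_smult: "\<theta> (to_tot_frac R (r [^] (p ^ e)) \<otimes>\<^bsub>tot_frac R\<^esub> m) = P.\<iota> r \<otimes>\<^bsub>P.A\<^esub> \<theta> m"
    if r: "r \<in> carrier R" and m: "m \<in> M" for r m
  proof -
    have mc: "m \<in> carrier (tot_frac R)" using m Msub by blast
    have "Q.\<epsilon> (to_tot_frac R (r [^] (p ^ e)) \<otimes>\<^bsub>tot_frac R\<^esub> m)
      = to_tot_frac Q.A (Q.\<iota> r [^]\<^bsub>Q.A\<^esub> (p ^ e)) \<otimes>\<^bsub>tot_frac Q.A\<^esub> Q.\<epsilon> m"
      using r mc by (simp add: Q.tot_loc_map(2) Q.S.loc_map_pow)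
    then show ?thesis
      unfolding \<theta>_def using \<phi>_smult[of "Q.\<iota> r" "Q.\<epsilon> m"] MQ[OF m] \<phi>c[OF MQ[OF m]] r l(2) by simp
  qed
  have N_M: "\<exists>s\<in>carrier R - P. \<exists>m\<in>M. P.\<epsilon> m = to_tot_frac P.A (P.\<iota> s) \<otimes>\<^bsub>tot_frac P.A\<^esub> f"
    if f: "f \<in> NP" for f
  proof -
    obtain s m where s: "s \<in> carrier R - P" and m: "m \<in> carrier (tot_frac R)"
      and em: "P.\<epsilon> m = to_tot_frac P.A (P.\<iota> s) \<otimes>\<^bsub>tot_frac P.A\<^esub> f"
      and mQ: "\<forall>Q. primeideal Q R \<and> P \<subseteq> Q \<longrightarrow> tot_loc_map R Q m \<in> carrier (center_sections R Q \<Delta> (p ^ e - 1))"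
      using P.center_sections_extend[OF noeth eff U, of f "p ^ e - 1"] f unfolding NP_def by blast
    have "P.\<epsilon> m \<in> NP" "Q.\<epsilon> m \<in> NQ" unfolding NP_def NQ_def using mQ Pp Q PQ by blast+
    then show ?thesis using s m em unfolding M_def by blast
  qed
  have NPsub: "NP \<subseteq> carrier (tot_frac P.A)" using closedP(1) by simp
  have "\<exists>h. (\<forall>f\<in>NP. h f \<in> carrier P.A) \<and>
    (\<forall>f\<in>NP. \<forall>g\<in>NP. h (f \<oplus>\<^bsub>tot_frac P.A\<^esub> g) = h f \<oplus>\<^bsub>P.A\<^esub> h g) \<and>
    (\<forall>r\<in>carrier P.A. \<forall>f\<in>NP.
      h (to_tot_frac P.A (r [^]\<^bsub>P.A\<^esub> (p ^ e)) \<otimes>\<^bsub>tot_frac P.A\<^esub> f) = r \<otimes>\<^bsub>P.A\<^esub> h f) \<and>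
    (\<forall>m\<in>M. h (P.\<epsilon> m) = \<theta> m)"
    by (rule P.semilinear_extension[OF Msub M_add M_smult \<theta>c \<theta>_add \<theta>_smult q NPsub N_M])
  then obtain h where h0: "\<forall>f\<in>NP. h f \<in> carrier P.A"
    "\<forall>f\<in>NP. \<forall>g\<in>NP. h (f \<oplus>\<^bsub>tot_frac P.A\<^esub> g) = h f \<oplus>\<^bsub>P.A\<^esub> h g"
    "\<forall>r\<in>carrier P.A. \<forall>f\<in>NP.
      h (to_tot_frac P.A (r [^]\<^bsub>P.A\<^esub> (p ^ e)) \<otimes>\<^bsub>tot_frac P.A\<^esub> f) = r \<otimes>\<^bsub>P.A\<^esub> h f"
    "\<forall>m\<in>M. h (P.\<epsilon> m) = \<theta> m"
    by (elim exE conjE) (rule that)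
  note h = h0(1)[rule_format] h0(2)[rule_format] h0(3)[rule_format] h0(4)[rule_format]
  define v where "v = to_tot_frac P.A (P.\<iota> x \<otimes>\<^bsub>P.A\<^esub> P.\<iota> a)"
  have v: "v \<in> NP" unfolding v_def using xc ac by (intro closedP(2)) auto
  have "to_tot_frac R (x \<otimes> a) \<in> M"
    using xc ac closedP(2)[of "P.\<iota> (x \<otimes> a)"] closedQ(2)[of "Q.\<iota> (x \<otimes> a)"] unfolding M_def
    by (simp add: P.tot_loc_map(2) Q.tot_loc_map(2) del: P.S.loc_map.hom_mult Q.S.loc_map.hom_mult P.K.loc_map.hom_mult)
  from h(4)[OF this] have hv: "h v = l (loc_frac R (carrier R - Q) y t)"
    using xc ac val by (simp add: \<theta>_def v_def P.tot_loc_map(2) Q.tot_loc_map(2))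
  have tc: "t \<in> carrier R" using t by simp
  have fc: "loc_frac R (carrier R - Q) y t \<in> carrier Q.A" using y t by simp
  have "P.\<iota> t \<otimes>\<^bsub>P.A\<^esub> h v = l (Q.\<iota> t \<otimes>\<^bsub>Q.A\<^esub> loc_frac R (carrier R - Q) y t)"
    unfolding hv using tc fc l(2) by simp
  also have "\<dots> = P.\<iota> y" unfolding Q.S.frac_cancel[OF y t] using l(2) y by simp
  finally have "P.\<iota> t \<otimes>\<^bsub>P.A\<^esub> h v = P.\<iota> y" .
  moreover have "P.\<iota> y \<in> Units P.A" using y yP by simp
  ultimately have hU: "h v \<in> Units P.A"
    using P.S.L.unit_factor[of "h v" "P.\<iota> t"] h(1)[OF v] tc P.S.L.m_comm[of "P.\<iota> t" "h v"] by simp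
  define h' where "h' f = inv\<^bsub>P.A\<^esub> (h v) \<otimes>\<^bsub>P.A\<^esub> h f" for f
  have ic: "inv\<^bsub>P.A\<^esub> (h v) \<in> carrier P.A" using hU by simp
  have "h' \<in> linear_maps P.A (frob_push p e P.A (center_sections R P \<Delta> (p ^ e - 1))) (self_module P.A)"
    unfolding frob_linear_maps_iff NP_def[symmetric] h'_def
    using h(1-3) ic by (simp add: P.S.L.r_distr P.S.L.m_lcomm)
  moreover have "h' (r \<odot>\<^bsub>frob_push p e P.A (center_sections R P \<Delta> (p ^ e - 1))\<^esub> v) = r"
    if "r \<in> carrier P.A" for r
    using that h(3)[OF that v] ic h(1)[OF v] hU
    by (simp add: h'_def div_sections_simps P.S.L.m_lcomm P.S.L.Units_l_inv)
  ultimately have "splits_at P.A (frob_push p e P.A (center_sections R P \<Delta> (p ^ e - 1)))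
      (to_tot_frac P.A (P.\<iota> x \<otimes>\<^bsub>P.A\<^esub> P.\<iota> a))"
    unfolding splits_at_def v_def[symmetric] by blast
  then show False
    using center e a max_ideal_atI[OF Pp x] unfolding center_of_sharp_F_purity_def by blast
qed

section \<open>Rings of prime characteristic\<close>

lemma (in cring) binomial:
  assumes x: "x \<in> carrier R" and y: "y \<in> carrier R"
  shows "(x \<oplus> y) [^] (n::nat) = (\<Oplus>k\<in>{..n}. add_pow R (n choose k) (x [^] k \<otimes> y [^] (n - k)))"
proof (induction n)
  case 0 then show ?case using x y by simp
next
  case (Suc n)
  let ?T = "\<lambda>n k. add_pow R (n choose k) (x [^] k \<otimes> y [^] (n - k))"
  have Tc: "?T n k \<in> carrier R" for n k using x y by simp
  define B where "B k = add_pow R (n choose k) (x [^] k \<otimes> y [^] (Suc n - k))" for k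
  have Bc: "B k \<in> carrier R" for k using x y by (simp add: B_def)
  have xs: "x \<otimes> (\<Oplus>k\<in>{..n}. ?T n k) = (\<Oplus>k\<in>{..n}. add_pow R (n choose k) (x [^] Suc k \<otimes> y [^] (n - k)))"
    using x y by (subst finsum_rdistr) (auto simp: add_pow_rdistr m_ac intro!: finsum_cong')
  have yt: "y \<otimes> ?T n k = B k" if "k \<le> n" for k
    using x y that by (simp add: B_def add_pow_rdistr m_ac Suc_diff_le)
  have "y \<otimes> (\<Oplus>k\<in>{..n}. ?T n k) = (\<Oplus>k\<in>{..n}. B k)"
    using x y Tc Bc yt by (subst finsum_rdistr) (auto intro!: finsum_cong' simp del: nat_pow_Suc)
  also have "\<dots> = (\<Oplus>k\<in>{..Suc n}. B k)"
  proof -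
    have "B (Suc n) = \<zero>" using x y by (simp add: B_def binomial_eq_0)
    then show ?thesis using Bc by (subst finsum_Suc) auto
  qed
  also have "\<dots> = (\<Oplus>k\<in>{..n}. B (Suc k)) \<oplus> B 0"
    using Bc by (subst finsum_Suc2) auto
  finally have ys: "y \<otimes> (\<Oplus>k\<in>{..n}. ?T n k) = (\<Oplus>k\<in>{..n}. B (Suc k)) \<oplus> B 0" .
  have T_Suc: "?T (Suc n) (Suc k) = add_pow R (n choose k) (x [^] Suc k \<otimes> y [^] (n - k)) \<oplus> B (Suc k)" for k
    using x y by (simp add: B_def add.nat_pow_mult)
  have "(x \<oplus> y) [^] Suc n = (x \<oplus> y) \<otimes> (\<Oplus>k\<in>{..n}. ?T n k)"
    using Suc x y by (simp add: m_comm)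
  also have "\<dots> = x \<otimes> (\<Oplus>k\<in>{..n}. ?T n k) \<oplus> y \<otimes> (\<Oplus>k\<in>{..n}. ?T n k)"
    using x y Tc by (intro l_distr finsum_closed) auto
  also have "\<dots> = ((\<Oplus>k\<in>{..n}. add_pow R (n choose k) (x [^] Suc k \<otimes> y [^] (n - k))) \<oplus> (\<Oplus>k\<in>{..n}. B (Suc k))) \<oplus> B 0"
    unfolding xs ys using x y Bc by (intro a_assoc[symmetric] finsum_closed) auto
  also have "\<dots> = (\<Oplus>k\<in>{..n}. ?T (Suc n) (Suc k)) \<oplus> B 0"
    unfolding T_Suc using x y Bc by (subst finsum_addf) auto
  also have "\<dots> = (\<Oplus>k\<in>{..Suc n}. ?T (Suc n) k)"
    using Tc[of "Suc n"] by (subst finsum_Suc2) (auto simp: B_def simp del: nat_pow_Suc binomial_Suc_Suc)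
  finally show ?case .
qed

locale prime_char_ring = cring R for R (structure) +
  fixes p :: nat
  assumes prime_p: "prime p" and char_p: "add_pow R p \<one> = \<zero>"
begin

lemma add_pow_multiple:
  assumes "p dvd n" "x \<in> carrier R"
  shows "add_pow R n x = \<zero>"
proof -
  obtain m where m: "n = p * m" using assms(1) by blast
  have "add_pow R p x = (add_pow R p \<one>) \<otimes> x" using assms(2) by (simp add: add_pow_ldistr)
  also have "\<dots> = \<zero>" using assms(2) by (simp add: char_p)
  finally have "add_pow R p x = \<zero>" .
  moreover have "add_pow R n x = add_pow R m (add_pow R p x)"
    unfolding m using add.nat_pow_pow[OF assms(2), of m p] by simp
  ultimately show ?thesis by simp
qed

lemma p_pos: "p > 0"
  using prime_p prime_gt_0_nat by blast

lemma q_pos: "p ^ e > 0"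
  using p_pos by simp

lemma frobenius_add1:
  assumes x: "x \<in> carrier R" and y: "y \<in> carrier R"
  shows "(x \<oplus> y) [^] p = x [^] p \<oplus> y [^] p"
proof -
  let ?T = "\<lambda>k. add_pow R (p choose k) (x [^] k \<otimes> y [^] (p - k))"
  have Tc: "?T k \<in> carrier R" for k using x y by simp
  obtain n where n: "p = Suc n" using p_pos by (metis gr0_implies_Suc)
  have n0: "n \<noteq> 0" using prime_p n by (metis One_nat_def not_prime_1)
  then obtain m where m: "n = Suc m" by (metis not0_implies_Suc)
  (* The binomial coefficients strictly between 0 and p are multiples of p. *)
  have mid: "?T (Suc k) = \<zero>" if "k < n" for k
  proof (rule add_pow_multiple)
    show "p dvd p choose Suc k"
      using prime_p that n by (intro dvd_choose_prime) auto
  qed (use x y in simp)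
  have "(\<Oplus>k\<in>{..m}. ?T (Suc k)) = (\<Oplus>k\<in>{..m}. \<zero>)"
    using mid m by (intro finsum_cong') auto
  then have z: "(\<Oplus>k\<in>{..m}. ?T (Suc k)) = \<zero>" by simp
  have "(x \<oplus> y) [^] p = (\<Oplus>k\<in>{..Suc n}. ?T k)" using binomial[OF x y, of p] n by simp
  also have "\<dots> = ?T (Suc n) \<oplus> (\<Oplus>k\<in>{..n}. ?T k)" using Tc by (subst finsum_Suc) auto
  also have "(\<Oplus>k\<in>{..n}. ?T k) = (\<Oplus>k\<in>{..m}. ?T (Suc k)) \<oplus> ?T 0"
    unfolding m using Tc by (subst finsum_Suc2) auto
  also have "\<dots> = ?T 0" unfolding z using Tc[of 0] by simp
  finally show ?thesis using x y by (simp add: n[symmetric])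
qed

lemma frobenius_add:
  assumes x: "x \<in> carrier R" and y: "y \<in> carrier R"
  shows "(x \<oplus> y) [^] (p ^ e) = x [^] (p ^ e) \<oplus> y [^] (p ^ e)"
proof (induction e)
  case (Suc e)
  have "z [^] (p ^ Suc e) = (z [^] (p ^ e)) [^] p" if "z \<in> carrier R" for z
    using that by (simp add: nat_pow_pow mult.commute)
  then show ?case using Suc x y frobenius_add1 by simp
qed (use x y in simp)

lemma zero_pow_q: "\<zero> [^] (p ^ e) = \<zero>"
  using q_pos[of e] nat_pow_zero by simp

lemma frobenius_minus:
  assumes x: "x \<in> carrier R"
  shows "(\<ominus> x) [^] (p ^ e) = \<ominus> (x [^] (p ^ e))"
proof -
  have "(\<ominus> x) [^] (p ^ e) \<oplus> x [^] (p ^ e) = \<zero>"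
    using frobenius_add[of "\<ominus> x" x e] x by (simp add: l_neg zero_pow_q)
  then show ?thesis using x by (simp add: minus_equality)
qed

end

text \<open>\<open>S\<close> generates \<open>R\<close> over its subring of \<open>q\<close>-th powers. Stating this through all closed sets
  \<open>G\<close> spares the bookkeeping of linear combinations.\<close>

definition power_generators :: "('a, 'm) ring_scheme \<Rightarrow> nat \<Rightarrow> 'a set \<Rightarrow> bool" where
  "power_generators R q S \<longleftrightarrow> finite S \<and> S \<subseteq> carrier R \<and>
    (\<forall>G. \<zero>\<^bsub>R\<^esub> \<in> G \<and> (\<forall>x\<in>G. \<forall>y\<in>G. x \<oplus>\<^bsub>R\<^esub> y \<in> G) \<and>
      (\<forall>r\<in>carrier R. \<forall>s\<in>S. r [^]\<^bsub>R\<^esub> q \<otimes>\<^bsub>R\<^esub> s \<in> G) \<longrightarrow> carrier R \<subseteq> G)"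

lemma power_generatorsD:
  assumes "power_generators R q S" "\<zero>\<^bsub>R\<^esub> \<in> G" "\<And>x y. \<lbrakk>x \<in> G; y \<in> G\<rbrakk> \<Longrightarrow> x \<oplus>\<^bsub>R\<^esub> y \<in> G"
    "\<And>r s. \<lbrakk>r \<in> carrier R; s \<in> S\<rbrakk> \<Longrightarrow> r [^]\<^bsub>R\<^esub> q \<otimes>\<^bsub>R\<^esub> s \<in> G"
  shows "carrier R \<subseteq> G"
proof -
  have "\<zero>\<^bsub>R\<^esub> \<in> G \<and> (\<forall>x\<in>G. \<forall>y\<in>G. x \<oplus>\<^bsub>R\<^esub> y \<in> G) \<and>
      (\<forall>r\<in>carrier R. \<forall>s\<in>S. r [^]\<^bsub>R\<^esub> q \<otimes>\<^bsub>R\<^esub> s \<in> G)"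
    using assms(2-4) by simp
  with assms(1) show ?thesis unfolding power_generators_def by simp
qed

lemma finsum_frob_push: "finsum (frob_push p e R (self_module R)) f A = finsum R f A"
  by (simp add: finsum_def finprod_def frob_push_def self_module_def)

context prime_char_ring
begin

text \<open>The linear combinations of \<open>S\<close> are themselves a closed set \<open>G\<close>: coefficients add up because
  \<open>p\<close>-th powers are additive.\<close>

lemma fin_gen_iff_power_generators:
  "fin_gen_module R (frob_push p 1 R (self_module R)) \<longleftrightarrow> (\<exists>S. power_generators R p S)"
proof -
  let ?C = "\<lambda>S. {(\<Oplus>s\<in>S. c s [^] p \<otimes> s) | c. c \<in> S \<rightarrow> carrier R}"
  have gen: "power_generators R p S" if S: "finite S" "S \<subseteq> carrier R" "carrier R = ?C S" for S
    unfolding power_generators_def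
  proof (intro conjI allI impI S(1,2))
    fix G assume G: "\<zero> \<in> G \<and> (\<forall>x\<in>G. \<forall>y\<in>G. x \<oplus> y \<in> G) \<and> (\<forall>r\<in>carrier R. \<forall>s\<in>S. r [^] p \<otimes> s \<in> G)"
    have "(\<Oplus>s\<in>T. c s [^] p \<otimes> s) \<in> G" if c: "c \<in> S \<rightarrow> carrier R" and T: "T \<subseteq> S" for c T
    proof -
      have "finite T" using T S(1) finite_subset by blast
      then show ?thesis using T
      proof (induction T)
        case empty then show ?case using G by simp
      next
        case (insert t T)
        have cl: "c s [^] p \<otimes> s \<in> carrier R" if "s \<in> S" for s
          using c S(2) that by (auto simp: Pi_iff)
        have "(\<Oplus>s\<in>insert t T. c s [^] p \<otimes> s) = c t [^] p \<otimes> t \<oplus> (\<Oplus>s\<in>T. c s [^] p \<otimes> s)"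
          using insert cl by (intro finsum_insert) auto
        moreover have "c t [^] p \<otimes> t \<in> G" using G c insert.prems by (auto simp: Pi_iff)
        ultimately show ?case using G insert by simp
      qed
    qed
    then have "?C S \<subseteq> G" by blast
    then show "carrier R \<subseteq> G" using S(3) by simp
  qed
  have span: "carrier R = ?C S" if S: "power_generators R p S" for S
  proof
    have fin: "finite S" "S \<subseteq> carrier R" using S by (simp_all add: power_generators_def)
    have cl: "c s [^] p \<otimes> s \<in> carrier R" if "c \<in> S \<rightarrow> carrier R" "s \<in> S" for c s
      using that fin by (auto simp: Pi_iff)
    show "?C S \<subseteq> carrier R" using cl by (auto intro!: finsum_closed)
    show "carrier R \<subseteq> ?C S"
    proof (rule power_generatorsD[OF S])
      have "(\<Oplus>s\<in>S. \<zero> [^] p \<otimes> s) = (\<Oplus>s\<in>S. \<zero>)"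
        using fin zero_pow_q[of 1] by (intro finsum_cong') auto
      then show "\<zero> \<in> ?C S" by (intro CollectI exI[of _ "\<lambda>_. \<zero>"]) simp
    next
      fix x y assume "x \<in> ?C S" "y \<in> ?C S"
      then obtain c d where c: "c \<in> S \<rightarrow> carrier R" "x = (\<Oplus>s\<in>S. c s [^] p \<otimes> s)"
        and d: "d \<in> S \<rightarrow> carrier R" "y = (\<Oplus>s\<in>S. d s [^] p \<otimes> s)" by blast
      have cd: "c s \<in> carrier R" "d s \<in> carrier R" "s \<in> carrier R" if "s \<in> S" for s
        using c d fin that by (auto simp: Pi_iff)
      have "x \<oplus> y = (\<Oplus>s\<in>S. c s [^] p \<otimes> s \<oplus> d s [^] p \<otimes> s)"
        unfolding c d using cd by (intro finsum_addf[symmetric]) auto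
      also have "\<dots> = (\<Oplus>s\<in>S. (\<lambda>s. c s \<oplus> d s) s [^] p \<otimes> s)"
        using cd by (intro finsum_cong') (auto simp: frobenius_add1 l_distr)
      finally show "x \<oplus> y \<in> ?C S"
        using cd by (intro CollectI exI[of _ "\<lambda>s. c s \<oplus> d s"] conjI) auto
    next
      fix r s assume r: "r \<in> carrier R" and s: "s \<in> S"
      define c where "c = (\<lambda>t. if t = s then r else \<zero>)"
      have "(\<Oplus>t\<in>S. c t [^] p \<otimes> t) = (\<Oplus>t\<in>S. if s = t then r [^] p \<otimes> t else \<zero>)"
        using fin r zero_pow_q[of 1] by (intro finsum_cong') (auto simp: c_def)
      also have "\<dots> = r [^] p \<otimes> s"
        using fin r s by (intro add.finprod_singleton) auto
      finally have "r [^] p \<otimes> s = (\<Oplus>t\<in>S. c t [^] p \<otimes> t)" by simp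
      moreover have "c \<in> S \<rightarrow> carrier R" using r by (simp add: c_def)
      ultimately show "r [^] p \<otimes> s \<in> ?C S" by blast
    qed
  qed
  have iff: "fin_gen_module R (frob_push p 1 R (self_module R)) \<longleftrightarrow>
    (\<exists>S. finite S \<and> S \<subseteq> carrier R \<and> carrier R = ?C S)"
    by (simp add: fin_gen_module_def finsum_frob_push)
  show ?thesis
    unfolding iff
  proof
    assume "\<exists>S. finite S \<and> S \<subseteq> carrier R \<and> carrier R = ?C S"
    then obtain S where "finite S" "S \<subseteq> carrier R" "carrier R = ?C S" by (elim exE conjE) (rule that)
    then have "power_generators R p S" by (rule gen)
    then show "\<exists>S. power_generators R p S" ..
  next
    assume "\<exists>S. power_generators R p S"
    then obtain S where S: "power_generators R p S" ..
    then have "finite S" "S \<subseteq> carrier R" by (simp_all add: power_generators_def)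
    with span[OF S] show "\<exists>S. finite S \<and> S \<subseteq> carrier R \<and> carrier R = ?C S"
      by (intro exI[of _ S] conjI)
  qed
qed

text \<open>If \<open>T\<close> generates \<open>R\<close> over the \<open>p ^ e\<close>-th powers, then the \<open>p\<close>-th powers of its elements
  generate the ring of \<open>p\<close>-th powers over the \<open>p ^ (e + 1)\<close>-th powers; so the products \<open>t\<^sup>p s\<close>
  with \<open>t \<in> T\<close> and \<open>s \<in> S\<close> generate \<open>R\<close> over the latter.\<close>

lemma exists_power_generators:
  assumes S: "power_generators R p S"
  shows "\<exists>T. power_generators R (p ^ e) T"
proof (induction e)
  case 0
  have "power_generators R (p ^ 0) {\<one>}"
    unfolding power_generators_def by auto
  then show ?case by blast
next
  case (Suc e)
  then obtain T where T: "power_generators R (p ^ e) T" by blast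
  define U where "U = (\<lambda>(t, s). t [^] p \<otimes> s) ` (T \<times> S)"
  have fin: "finite S" "S \<subseteq> carrier R" "finite T" "T \<subseteq> carrier R"
    using S T by (simp_all add: power_generators_def)
  have "power_generators R (p ^ Suc e) U"
    unfolding power_generators_def
  proof (intro conjI allI impI)
    show "finite U" using fin by (simp add: U_def)
    show "U \<subseteq> carrier R" using fin by (auto simp: U_def)
    fix G assume G: "\<zero> \<in> G \<and> (\<forall>x\<in>G. \<forall>y\<in>G. x \<oplus> y \<in> G) \<and>
      (\<forall>r\<in>carrier R. \<forall>s\<in>U. r [^] (p ^ Suc e) \<otimes> s \<in> G)"
    have "r [^] p \<otimes> s \<in> G" if r: "r \<in> carrier R" and s: "s \<in> S" for r s
    proof -
      have sc: "s \<in> carrier R" using s fin by blast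
      have "carrier R \<subseteq> {x \<in> carrier R. x [^] p \<otimes> s \<in> G}"
      proof (rule power_generatorsD[OF T])
        show "\<zero> \<in> {x \<in> carrier R. x [^] p \<otimes> s \<in> G}" using G sc zero_pow_q[of 1] by simp
      next
        fix x y assume "x \<in> {x \<in> carrier R. x [^] p \<otimes> s \<in> G}" "y \<in> {x \<in> carrier R. x [^] p \<otimes> s \<in> G}"
        then show "x \<oplus> y \<in> {x \<in> carrier R. x [^] p \<otimes> s \<in> G}"
          using G sc by (simp add: frobenius_add1 l_distr)
      next
        fix x t assume x: "x \<in> carrier R" and t: "t \<in> T"
        have tc: "t \<in> carrier R" using t fin by blast
        have "(x [^] (p ^ e) \<otimes> t) [^] p \<otimes> s = x [^] (p ^ Suc e) \<otimes> (t [^] p \<otimes> s)"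
          using x tc sc by (simp add: nat_pow_distrib nat_pow_pow m_assoc mult.commute)
        also have "\<dots> \<in> G"
        proof -
          have "t [^] p \<otimes> s \<in> U" using t s by (force simp: U_def)
          then show ?thesis using G x by blast
        qed
        finally show "x [^] (p ^ e) \<otimes> t \<in> {x \<in> carrier R. x [^] p \<otimes> s \<in> G}" using x tc by simp
      qed
      then show ?thesis using r by blast
    qed
    then show "carrier R \<subseteq> G" using G by (intro power_generatorsD[OF S]) auto
  qed
  then show ?case by blast
qed

end

lemma quot_carrier: "X \<in> carrier (R Quot I) \<Longrightarrow> \<exists>r\<in>carrier R. X = I +>\<^bsub>R\<^esub> r"
  by (auto simp: FactRing_def A_RCOSETS_def')

lemma quot_coset_zero:
  assumes "ideal I R" "x \<in> I"
  shows "I +>\<^bsub>R\<^esub> x = \<zero>\<^bsub>R Quot I\<^esub>"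
proof -
  have "\<zero>\<^bsub>R Quot I\<^esub> = I" by (simp add: FactRing_def)
  moreover have "ring R" using assms(1) by (rule ideal.axioms(2))
  ultimately show ?thesis using ring.a_rcos_zero[OF _ assms] by simp
qed

lemma noetherian_quotient:
  assumes "noetherian_ring R" "ideal I R"
  shows "noetherian_ring (R Quot I)"
proof -
  interpret noetherian_ring R by fact
  interpret I: ideal I R by fact
  interpret Q: ring "R Quot I" by (rule I.quotient_is_ring)
  interpret h: ring_hom_ring R "R Quot I" "(+>\<^bsub>R\<^esub>) I" by (rule I.rcos_ring_hom_ring)
  show ?thesis
  proof (rule Q.noetherian_ringI)
    fix J assume J: "ideal J (R Quot I)"
    obtain A where A: "A \<subseteq> carrier R" "finite A" "{r \<in> carrier R. I +>\<^bsub>R\<^esub> r \<in> J} = Idl\<^bsub>R\<^esub> A"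
      using finetely_gen[OF h.ideal_vimage[OF J]] by blast
    let ?A = "(+>\<^bsub>R\<^esub>) I ` A"
    have Ac: "?A \<subseteq> carrier (R Quot I)" using A(1) by auto
    have "J = Idl\<^bsub>R Quot I\<^esub> ?A"
    proof
      have "A \<subseteq> {r \<in> carrier R. I +>\<^bsub>R\<^esub> r \<in> J}" using genideal_self[OF A(1)] A(3) by simp
      then show "Idl\<^bsub>R Quot I\<^esub> ?A \<subseteq> J" by (intro Q.genideal_minimal J) auto
      have "Idl\<^bsub>R\<^esub> A \<subseteq> {r \<in> carrier R. I +>\<^bsub>R\<^esub> r \<in> Idl\<^bsub>R Quot I\<^esub> ?A}"
        using A(1) Q.genideal_self[OF Ac]
        by (intro genideal_minimal h.ideal_vimage Q.genideal_ideal Ac) auto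
      then show "J \<subseteq> Idl\<^bsub>R Quot I\<^esub> ?A"
        using quot_carrier ideal.Icarr[OF J] A(3) by blast
    qed
    then show "\<exists>A\<subseteq>carrier (R Quot I). finite A \<and> J = Idl\<^bsub>R Quot I\<^esub> A"
      using Ac A(2) by blast
  qed
qed

lemma F_finite_prime_char:
  assumes "F_finite_ring p R"
  shows "prime_char_ring R p"
  using assms by (simp add: F_finite_ring_def prime_char_ring_def prime_char_ring_axioms_def)

lemma F_finite_quotient:
  fixes R (structure)
  assumes R: "F_finite_ring p R" and P: "primeideal P R"
  shows "F_finite_ring p (R Quot P)"
proof -
  interpret prime_char_ring R p by (rule F_finite_prime_char[OF R])
  interpret P: primeideal P R by (rule P)
  interpret Q: domain "R Quot P" by (rule P.quotient_is_domain)
  interpret h: ring_hom_cring R "R Quot P" "(+>) P" by (rule P.rcos_ring_hom_cring)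
  have "add_pow (R Quot P) n \<one>\<^bsub>R Quot P\<^esub> = P +> (add_pow R n \<one>)" for n :: nat
    by (induction n) auto
  from this[of p] have char: "add_pow (R Quot P) p \<one>\<^bsub>R Quot P\<^esub> = \<zero>\<^bsub>R Quot P\<^esub>"
    by (simp only: char_p h.hom_zero)
  interpret Q: prime_char_ring "R Quot P" p by unfold_locales (rule prime_p char)+
  obtain S where S: "power_generators R p S"
    using R fin_gen_iff_power_generators by (auto simp: F_finite_ring_def)
  have "power_generators (R Quot P) p ((+>) P ` S)"
    unfolding power_generators_def
  proof (intro conjI allI impI)
    show "finite ((+>) P ` S)" using S by (simp add: power_generators_def)
    show "(+>) P ` S \<subseteq> carrier (R Quot P)" using S by (auto simp: power_generators_def)
    fix G assume G: "\<zero>\<^bsub>R Quot P\<^esub> \<in> G \<and> (\<forall>x\<in>G. \<forall>y\<in>G. x \<oplus>\<^bsub>R Quot P\<^esub> y \<in> G) \<and>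
      (\<forall>r\<in>carrier (R Quot P). \<forall>s\<in>(+>) P ` S. r [^]\<^bsub>R Quot P\<^esub> p \<otimes>\<^bsub>R Quot P\<^esub> s \<in> G)"
    have hp: "P +> (r [^] n) = (P +> r) [^]\<^bsub>R Quot P\<^esub> n" if "r \<in> carrier R" for r and n :: nat
      using that by (induction n) auto
    have sc: "S \<subseteq> carrier R" using S by (simp add: power_generators_def)
    have "carrier R \<subseteq> {r \<in> carrier R. P +> r \<in> G}"
    proof (rule power_generatorsD[OF S])
      fix r s assume r: "r \<in> carrier R" and s: "s \<in> S"
      have "P +> (r [^] p \<otimes> s) = (P +> r) [^]\<^bsub>R Quot P\<^esub> p \<otimes>\<^bsub>R Quot P\<^esub> (P +> s)"
        using r s sc hp[OF r] by auto
      then show "r [^] p \<otimes> s \<in> {r \<in> carrier R. P +> r \<in> G}"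
        using G r s sc h.hom_closed[OF r] by auto
    qed (use G in auto)
    then show "carrier (R Quot P) \<subseteq> G" using quot_carrier by blast
  qed
  then have "fin_gen_module (R Quot P) (frob_push p 1 (R Quot P) (self_module (R Quot P)))"
    using Q.fin_gen_iff_power_generators by blast
  then show ?thesis
    using noetherian_quotient[OF _ P.ideal_axioms] R char Q.one_not_zero Q.is_cring prime_p
    by (auto simp: F_finite_ring_def)
qed

section \<open>Ideals stable under all Frobenius-linear maps\<close>

abbreviation frob_maps :: "('a, 'm) ring_scheme \<Rightarrow> nat \<Rightarrow> nat \<Rightarrow> ('a \<Rightarrow> 'a) set" where
  "frob_maps R p e \<equiv> linear_maps R (frob_push p e R (self_module R)) (self_module R)"

definition frob_stable :: "nat \<Rightarrow> ('a, 'm) ring_scheme \<Rightarrow> 'a set \<Rightarrow> bool" where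
  "frob_stable p R J \<longleftrightarrow> (\<forall>e>0. \<forall>h\<in>frob_maps R p e. h ` J \<subseteq> J)"

context prime_char_ring
begin

lemma frob_maps_iff:
  "h \<in> frob_maps R p e \<longleftrightarrow> (\<forall>x\<in>carrier R. h x \<in> carrier R) \<and>
    (\<forall>x\<in>carrier R. \<forall>y\<in>carrier R. h (x \<oplus> y) = h x \<oplus> h y) \<and>
    (\<forall>r\<in>carrier R. \<forall>x\<in>carrier R. h (r [^] (p ^ e) \<otimes> x) = r \<otimes> h x)"
  by (auto simp: linear_maps_def)

lemma frob_mapsD:
  assumes "h \<in> frob_maps R p e"
  shows "x \<in> carrier R \<Longrightarrow> h x \<in> carrier R"
    and "\<lbrakk>x \<in> carrier R; y \<in> carrier R\<rbrakk> \<Longrightarrow> h (x \<oplus> y) = h x \<oplus> h y"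
    and "\<lbrakk>r \<in> carrier R; x \<in> carrier R\<rbrakk> \<Longrightarrow> h (r [^] (p ^ e) \<otimes> x) = r \<otimes> h x"
  using assms unfolding frob_maps_iff by blast+

lemma frob_map_id: "(\<lambda>x. x) \<in> frob_maps R p 0"
  by (simp add: frob_maps_iff)

lemma frob_map_comp:
  assumes h: "h \<in> frob_maps R p e" and g: "g \<in> frob_maps R p e'"
  shows "(\<lambda>x. h (g x)) \<in> frob_maps R p (e + e')"
  unfolding frob_maps_iff
proof (intro conjI ballI)
  fix x y assume xy: "x \<in> carrier R" "y \<in> carrier R"
  then show "h (g x) \<in> carrier R" "h (g (x \<oplus> y)) = h (g x) \<oplus> h (g y)"
    using frob_mapsD[OF h] frob_mapsD[OF g] by simp_all
next
  fix r x assume r: "r \<in> carrier R" and x: "x \<in> carrier R"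
  have "r [^] (p ^ (e + e')) = (r [^] (p ^ e)) [^] (p ^ e')"
    using r by (simp add: nat_pow_pow power_add)
  then show "h (g (r [^] (p ^ (e + e')) \<otimes> x)) = r \<otimes> h (g x)"
    using frob_mapsD(3)[OF g, of "r [^] (p ^ e)" x] frob_mapsD(3)[OF h r, of "g x"]
      frob_mapsD(1)[OF g x] r x by simp
qed

lemma frob_map_premult:
  assumes h: "h \<in> frob_maps R p e" and y: "y \<in> carrier R"
  shows "(\<lambda>x. h (y \<otimes> x)) \<in> frob_maps R p e"
  unfolding frob_maps_iff
proof (intro conjI ballI)
  fix r x assume r: "r \<in> carrier R" and x: "x \<in> carrier R"
  then show "h (y \<otimes> (r [^] (p ^ e) \<otimes> x)) = r \<otimes> h (y \<otimes> x)"
    using frob_mapsD(3)[OF h r, of "y \<otimes> x"] y m_lcomm[of y "r [^] (p ^ e)" x] by simp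
qed (use frob_mapsD(1,2)[OF h] y in \<open>simp_all add: r_distr\<close>)

lemma frob_map_postmult:
  assumes h: "h \<in> frob_maps R p e" and y: "y \<in> carrier R"
  shows "(\<lambda>x. y \<otimes> h x) \<in> frob_maps R p e"
  unfolding frob_maps_iff
  using frob_mapsD[OF h] y by (auto simp: r_distr m_lcomm)

lemma frob_map_add:
  assumes h: "h \<in> frob_maps R p e" and g: "g \<in> frob_maps R p e"
  shows "(\<lambda>x. h x \<oplus> g x) \<in> frob_maps R p e"
  unfolding frob_maps_iff
  using frob_mapsD[OF h] frob_mapsD[OF g] by (auto simp: r_distr a_ac)

text \<open>Restriction to the \<open>p ^ e\<close>-th powers: whatever is a value at level \<open>e + 1\<close> is also one at
  level 1, taken at \<open>y = 1\<close>.\<close>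

lemma frob_map_restrict:
  assumes h: "h \<in> frob_maps R p (Suc e)" and x: "x \<in> carrier R"
  shows "(\<lambda>y. h (x \<otimes> y [^] (p ^ e))) \<in> frob_maps R p 1"
  unfolding frob_maps_iff
proof (intro conjI ballI)
  fix y z assume "y \<in> carrier R" "z \<in> carrier R"
  then show "h (x \<otimes> y [^] (p ^ e)) \<in> carrier R"
    "h (x \<otimes> (y \<oplus> z) [^] (p ^ e)) = h (x \<otimes> y [^] (p ^ e)) \<oplus> h (x \<otimes> z [^] (p ^ e))"
    using frob_mapsD[OF h] x by (simp_all add: frobenius_add r_distr)
next
  fix r y assume r: "r \<in> carrier R" and y: "y \<in> carrier R"
  have "(r [^] (p ^ 1) \<otimes> y) [^] (p ^ e) = r [^] (p ^ Suc e) \<otimes> y [^] (p ^ e)"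
    using r y by (simp add: nat_pow_distrib nat_pow_pow)
  then have "x \<otimes> (r [^] (p ^ 1) \<otimes> y) [^] (p ^ e) = r [^] (p ^ Suc e) \<otimes> (x \<otimes> y [^] (p ^ e))"
    using r x y by (simp add: m_lcomm del: power_Suc)
  then show "h (x \<otimes> (r [^] (p ^ 1) \<otimes> y) [^] (p ^ e)) = r \<otimes> h (x \<otimes> y [^] (p ^ e))"
    using frob_mapsD(3)[OF h r, of "x \<otimes> y [^] (p ^ e)"] x y by simp
qed

lemma splits_at_iff:
  assumes c: "c \<in> carrier R"
  shows "splits_at R (frob_push p e R (self_module R)) c \<longleftrightarrow> (\<exists>h\<in>frob_maps R p e. h c = \<one>)"
proof
  assume "splits_at R (frob_push p e R (self_module R)) c"
  then obtain h where h: "h \<in> frob_maps R p e" "\<forall>r\<in>carrier R. h (r [^] (p ^ e) \<otimes> c) = r"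
    unfolding splits_at_def by auto
  have "h c = h (\<one> [^] (p ^ e) \<otimes> c)" using c by simp
  then have "h c = \<one>" using h(2) one_closed by metis
  with h(1) show "\<exists>h\<in>frob_maps R p e. h c = \<one>" by blast
next
  assume "\<exists>h\<in>frob_maps R p e. h c = \<one>"
  then obtain h where h: "h \<in> frob_maps R p e" "h c = \<one>" by blast
  then have "\<forall>r\<in>carrier R. h (r [^] (p ^ e) \<otimes> c) = r" using frob_mapsD(3)[OF h(1)] c by simp
  with h(1) show "splits_at R (frob_push p e R (self_module R)) c"
    unfolding splits_at_def by (intro bexI[of _ h]) simp_all
qed

lemma additive_idealI:
  assumes "J \<subseteq> carrier R" "\<zero> \<in> J" and add: "\<And>x y. \<lbrakk>x \<in> J; y \<in> J\<rbrakk> \<Longrightarrow> x \<oplus> y \<in> J"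
    and mult: "\<And>r x. \<lbrakk>r \<in> carrier R; x \<in> J\<rbrakk> \<Longrightarrow> r \<otimes> x \<in> J"
  shows "ideal J R"
proof (rule idealI)
  show "ring R" by (rule ring_axioms)
  have "\<ominus> x = \<ominus> \<one> \<otimes> x" if "x \<in> J" for x using that assms(1) by (auto simp: l_minus)
  then show "subgroup J (add_monoid R)"
    using assms by (intro add.subgroupI) auto
  show mult': "r \<otimes> x \<in> J" if "x \<in> J" "r \<in> carrier R" for r x using mult that by blast
  show "x \<otimes> r \<in> J" if "x \<in> J" "r \<in> carrier R" for r x
    using mult'[OF that] that assms(1) m_comm by (metis subsetD)
qed

text \<open>Over a field the Frobenius splits along any nonzero \<open>c\<close>: a subspace (over the \<open>p\<close>-th powers)
  that is maximal among those not containing \<open>c\<close> is a complement of the line through \<open>c\<close>.\<close>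

lemma field_frob_split:
  assumes "field R" and c: "c \<in> carrier R" "c \<noteq> \<zero>"
  shows "\<exists>h\<in>frob_maps R p 1. h c = \<one>"
proof -
  interpret field R by fact
  define \<W> where "\<W> = {W. W \<subseteq> carrier R \<and> \<zero> \<in> W \<and> (\<forall>x\<in>W. \<forall>y\<in>W. x \<oplus> y \<in> W) \<and>
    (\<forall>r\<in>carrier R. \<forall>x\<in>W. r [^] p \<otimes> x \<in> W) \<and> c \<notin> W}"
  have "{\<zero>} \<in> \<W>" using c by (auto simp: \<W>_def)
  then have ne: "\<W> \<noteq> {}" by blast
  have chain: "\<Union>\<C> \<in> \<W>" if C: "\<C> \<noteq> {}" "subset.chain \<W> \<C>" for \<C>
  proof -
    have CW: "\<C> \<subseteq> \<W>" and tot: "\<And>X Y. X \<in> \<C> \<Longrightarrow> Y \<in> \<C> \<Longrightarrow> X \<subseteq> Y \<or> Y \<subseteq> X"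
      using C(2) by (auto simp: subset_chain_def)
    have "x \<oplus> y \<in> \<Union>\<C>" if xy: "x \<in> \<Union>\<C>" "y \<in> \<Union>\<C>" for x y
    proof -
      from xy obtain X Y where XY: "X \<in> \<C>" "x \<in> X" "Y \<in> \<C>" "y \<in> Y" by blast
      then obtain Z where "Z \<in> \<C>" "x \<in> Z" "y \<in> Z" using tot[OF XY(1,3)] by blast
      moreover then have "x \<oplus> y \<in> Z" using CW by (auto simp: \<W>_def)
      ultimately show ?thesis by blast
    qed
    moreover have "\<Union>\<C> \<subseteq> carrier R" "c \<notin> \<Union>\<C>" "\<forall>r\<in>carrier R. \<forall>x\<in>\<Union>\<C>. r [^] p \<otimes> x \<in> \<Union>\<C>"
      using CW unfolding \<W>_def by blast+
    moreover have "\<zero> \<in> \<Union>\<C>" using C(1) CW unfolding \<W>_def by blast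
    ultimately show ?thesis unfolding \<W>_def by blast
  qed
  obtain W where W: "W \<in> \<W>" and max: "\<forall>X\<in>\<W>. W \<subseteq> X \<longrightarrow> X = W"
    using subset_Zorn_nonempty[OF ne chain] by blast
  have Wc: "W \<subseteq> carrier R" and W0: "\<zero> \<in> W" and cW: "c \<notin> W"
    and W_add: "\<And>x y. \<lbrakk>x \<in> W; y \<in> W\<rbrakk> \<Longrightarrow> x \<oplus> y \<in> W"
    and W_mult: "\<And>r x. \<lbrakk>r \<in> carrier R; x \<in> W\<rbrakk> \<Longrightarrow> r [^] p \<otimes> x \<in> W"
    using W unfolding \<W>_def by blast+
  have minus_pow: "(\<ominus> x) [^] p = \<ominus> (x [^] p)" if "x \<in> carrier R" for x
    using frobenius_minus[OF that, of 1] by simp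
  have W_minus: "\<ominus> x \<in> W" if "x \<in> W" for x
  proof -
    have "(\<ominus> \<one>) [^] p \<otimes> x = \<ominus> x" using that Wc by (auto simp: minus_pow l_minus)
    then show ?thesis using W_mult[of "\<ominus> \<one>" x] that by simp
  qed
  have pow_inv: "(inv r) [^] p \<otimes> (r [^] p \<otimes> x) = x" if "r \<in> carrier R" "r \<noteq> \<zero>" "x \<in> carrier R" for r x
  proof -
    have rU: "r \<in> Units R" using that field_Units by simp
    then have ic: "inv r \<in> carrier R" by simp
    have "(inv r) [^] p \<otimes> r [^] p = (inv r \<otimes> r) [^] p"
      using that ic by (simp add: nat_pow_distrib)
    also have "\<dots> = \<one>" using rU by (simp add: Units_l_inv)
    finally show ?thesis using that ic by (simp add: m_assoc[symmetric])
  qed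
  have inv_closed: "inv r \<in> carrier R" if "r \<in> carrier R" "r \<noteq> \<zero>" for r
    using that field_Units by simp
  have cancel: "r = \<zero>" if r: "r \<in> carrier R" "r [^] p \<otimes> c \<in> W" for r
  proof (rule ccontr)
    assume "r \<noteq> \<zero>"
    then have "c \<in> W"
      using W_mult[OF inv_closed[OF r(1)] r(2)] pow_inv[of r c] r(1) c(1) by simp
    with cW show False ..
  qed
  have decomp: "\<exists>w\<in>W. \<exists>r\<in>carrier R. v = w \<oplus> r [^] p \<otimes> c" if v: "v \<in> carrier R" for v
  proof (cases "v \<in> W")
    case True
    have "v = v \<oplus> \<zero> [^] p \<otimes> c" using v c zero_pow_q[of 1] by simp
    then show ?thesis using True zero_closed by blast
  next
    case False
    (* V is the span of W and v; by maximality of W it contains c. *)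
    define V where "V = {w \<oplus> r [^] p \<otimes> v | w r. w \<in> W \<and> r \<in> carrier R}"
    have VI: "w \<oplus> r [^] p \<otimes> v \<in> V" if "w \<in> W" "r \<in> carrier R" for w r using that unfolding V_def by blast
    have "W \<subseteq> V"
    proof
      fix w assume w: "w \<in> W"
      have "w = w \<oplus> \<zero> [^] p \<otimes> v" using w v Wc zero_pow_q[of 1] by auto
      then show "w \<in> V" using VI[OF w zero_closed] by simp
    qed
    moreover have "v \<in> V" using VI[OF W0 one_closed] v by simp
    ultimately have "V \<notin> \<W>" using max False by blast
    moreover have "V \<subseteq> carrier R" using Wc v by (auto simp: V_def)
    moreover have "\<zero> \<in> V" using \<open>W \<subseteq> V\<close> W0 by blast
    moreover have "x \<oplus> y \<in> V" if xy: "x \<in> V" "y \<in> V" for x y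
    proof -
      obtain w r where x: "x = w \<oplus> r [^] p \<otimes> v" "w \<in> W" "r \<in> carrier R"
        using xy(1) unfolding V_def by blast
      obtain w' r' where y: "y = w' \<oplus> r' [^] p \<otimes> v" "w' \<in> W" "r' \<in> carrier R"
        using xy(2) unfolding V_def by blast
      have wc: "w \<in> carrier R" "w' \<in> carrier R" using x y Wc by auto
      have "x \<oplus> y = (w \<oplus> w') \<oplus> (r \<oplus> r') [^] p \<otimes> v"
        unfolding x(1) y(1) using wc x(3) y(3) v by (simp add: frobenius_add1 l_distr a_ac)
      then show ?thesis using VI[OF W_add[OF x(2) y(2)], of "r \<oplus> r'"] x(3) y(3) by simp
    qed
    moreover have "s [^] p \<otimes> x \<in> V" if s: "s \<in> carrier R" and xV: "x \<in> V" for s x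
    proof -
      obtain w r where x: "x = w \<oplus> r [^] p \<otimes> v" "w \<in> W" "r \<in> carrier R"
        using xV unfolding V_def by blast
      have wc: "w \<in> carrier R" using x Wc by auto
      have "s [^] p \<otimes> x = s [^] p \<otimes> w \<oplus> (s \<otimes> r) [^] p \<otimes> v"
        unfolding x(1) using wc x(3) v s by (simp add: nat_pow_distrib r_distr m_assoc)
      then show ?thesis using VI[OF W_mult[OF s x(2)], of "s \<otimes> r"] x(3) s by simp
    qed
    ultimately have "c \<in> V" unfolding \<W>_def by blast
    then obtain w r where w: "w \<in> W" and r: "r \<in> carrier R" and cwr: "c = w \<oplus> r [^] p \<otimes> v"
      unfolding V_def by blast
    have wc: "w \<in> carrier R" using w Wc by auto
    have "r \<noteq> \<zero>"
    proof
      assume "r = \<zero>"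
      then have "c = w" using cwr wc v zero_pow_q[of 1] by simp
      with w cW show False by simp
    qed
    have "r [^] p \<otimes> v = \<ominus> w \<oplus> c"
      unfolding cwr using wc r v by (simp add: r_neg2 r_neg1)
    then have "v = (inv r) [^] p \<otimes> (\<ominus> w) \<oplus> (inv r) [^] p \<otimes> c"
      using pow_inv[OF r \<open>r \<noteq> \<zero>\<close> v] inv_closed[OF r \<open>r \<noteq> \<zero>\<close>] wc c(1) by (simp add: r_distr)
    moreover have "(inv r) [^] p \<otimes> (\<ominus> w) \<in> W"
      using W_mult[OF inv_closed[OF r \<open>r \<noteq> \<zero>\<close>] W_minus[OF w]] .
    ultimately show ?thesis using inv_closed[OF r \<open>r \<noteq> \<zero>\<close>] by blast
  qed
  have uniq: "r = r'"
    if r: "r \<in> carrier R" "r' \<in> carrier R" and w: "w \<in> W" "w' \<in> W"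
      and eq: "w \<oplus> r [^] p \<otimes> c = w' \<oplus> r' [^] p \<otimes> c" for r r' w w'
  proof -
    have wc: "w \<in> carrier R" "w' \<in> carrier R" using w Wc by auto
    define a where "a = r [^] p \<otimes> c"
    define b where "b = r' [^] p \<otimes> c"
    have ab: "a \<in> carrier R" "b \<in> carrier R" using r c(1) by (simp_all add: a_def b_def)
    have "(r \<oplus> \<ominus> r') [^] p \<otimes> c = a \<oplus> \<ominus> b"
      using r c(1) by (simp add: frobenius_add1 minus_pow l_distr l_minus a_def b_def)
    also have "a = \<ominus> w \<oplus> (w' \<oplus> b)"
      using eq[folded a_def b_def] wc ab r_neg1[of w a] by simp
    also have "\<ominus> w \<oplus> (w' \<oplus> b) \<oplus> \<ominus> b = \<ominus> w \<oplus> w'"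
      using wc ab by (simp add: a_assoc r_neg)
    also have "\<dots> \<in> W" using W_add[OF W_minus[OF w(1)] w(2)] .
    finally have "r \<oplus> \<ominus> r' = \<zero>" using r by (intro cancel) auto
    then show ?thesis using r minus_unique[of r "\<ominus> r'"] by (metis a_comm a_inv_closed minus_minus minus_equality)
  qed
  define h where "h v = (THE r. r \<in> carrier R \<and> (\<exists>w\<in>W. v = w \<oplus> r [^] p \<otimes> c))" for v
  have h: "h (w \<oplus> r [^] p \<otimes> c) = r" if "w \<in> W" "r \<in> carrier R" for w r
    unfolding h_def using that uniq by (intro the_equality) blast+
  have "h \<in> frob_maps R p 1"
    unfolding frob_maps_iff
  proof (intro conjI ballI)
    fix x assume "x \<in> carrier R"
    then obtain w r where "w \<in> W" "r \<in> carrier R" "x = w \<oplus> r [^] p \<otimes> c" using decomp by blast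
    then show "h x \<in> carrier R" using h by simp
  next
    fix x y assume "x \<in> carrier R" "y \<in> carrier R"
    then obtain w r w' r' where x: "w \<in> W" "r \<in> carrier R" "x = w \<oplus> r [^] p \<otimes> c"
      and y: "w' \<in> W" "r' \<in> carrier R" "y = w' \<oplus> r' [^] p \<otimes> c" using decomp by metis
    have wc: "w \<in> carrier R" "w' \<in> carrier R" using x y Wc by auto
    have "x \<oplus> y = (w \<oplus> w') \<oplus> (r \<oplus> r') [^] p \<otimes> c"
      unfolding x(3) y(3) using wc x(2) y(2) c by (simp add: frobenius_add1 l_distr a_ac)
    then show "h (x \<oplus> y) = h x \<oplus> h y" using h x y W_add by simp
  next
    fix s x assume s: "s \<in> carrier R" and "x \<in> carrier R"
    then obtain w r where x: "w \<in> W" "r \<in> carrier R" "x = w \<oplus> r [^] p \<otimes> c" using decomp by blast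
    have wc: "w \<in> carrier R" using x Wc by auto
    have "s [^] (p ^ 1) \<otimes> x = s [^] p \<otimes> w \<oplus> (s \<otimes> r) [^] p \<otimes> c"
      unfolding x(3) using wc x(2) s c by (simp add: nat_pow_distrib r_distr m_assoc)
    then show "h (s [^] (p ^ 1) \<otimes> x) = s \<otimes> h x" using h x s W_mult by simp
  qed
  moreover have "h c = \<one>" using h[OF W0 one_closed] c(1) by simp
  ultimately show ?thesis by blast
qed

text \<open>Values of Frobenius-linear maps at a fixed \<open>c\<close> form a stable ideal once a splitting of the
  Frobenius makes the level \<open>e\<close> irrelevant. Without any splitting, all values at positive levels
  lie among those at level 1, which then form a proper ideal.\<close>

lemma exists_stable_ideal:
  assumes "domain R" and c: "c \<in> carrier R" "c \<noteq> \<zero>"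
    and nosplit: "\<And>e h. \<lbrakk>e > 0; h \<in> frob_maps R p e\<rbrakk> \<Longrightarrow> h c \<noteq> \<one>"
  shows "\<exists>J. ideal J R \<and> \<one> \<notin> J \<and> J \<noteq> {\<zero>} \<and> frob_stable p R J"
proof (cases "\<exists>h\<in>frob_maps R p 1. \<exists>x\<in>carrier R. h x = \<one>")
  case True
  then obtain h0 x0 where h0: "h0 \<in> frob_maps R p 1" "x0 \<in> carrier R" "h0 x0 = \<one>" by blast
  define \<psi> where "\<psi> y = h0 (x0 \<otimes> y)" for y
  have \<psi>: "\<psi> \<in> frob_maps R p 1" "\<psi> \<one> = \<one>"
    unfolding \<psi>_def using frob_map_premult[OF h0(1,2)] h0(2,3) by simp_all
  define J where "J e = {h c | h. h \<in> frob_maps R p e}" for e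
  have JI: "h c \<in> J e" if "h \<in> frob_maps R p e" for h e using that unfolding J_def by blast
  have step: "J e \<subseteq> J (Suc e)" for e
  proof
    fix y assume "y \<in> J e"
    then obtain h where h: "h \<in> frob_maps R p e" "y = h c" unfolding J_def by blast
    have yc: "y \<in> carrier R" using h frob_mapsD(1)[OF h(1) c(1)] by simp
    (* y = \<psi> (y ^ p), and one of the p factors y is the value h c *)
    define g where "g x = \<psi> (y [^] (p - 1) \<otimes> h x)" for x
    have "g \<in> frob_maps R p (1 + e)"
      unfolding g_def using \<psi>(1) h(1) yc by (intro frob_map_comp frob_map_premult frob_map_postmult) auto
    moreover have "g c = y"
    proof -
      have "y [^] (p - 1) \<otimes> y = y [^] (p ^ 1) \<otimes> \<one>"
        using yc p_pos nat_pow_Suc[of y "p - 1"] by simp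
      then have "g c = \<psi> (y [^] (p ^ 1) \<otimes> \<one>)" unfolding g_def h(2)[symmetric] by (rule arg_cong)
      also have "\<dots> = y" using frob_mapsD(3)[OF \<psi>(1) yc one_closed] yc \<psi>(2) by simp
      finally show ?thesis .
    qed
    ultimately show "y \<in> J (Suc e)" using JI[of g "Suc e"] by simp
  qed
  have mono: "J e \<subseteq> J e'" if "e \<le> e'" for e e' using lift_Suc_mono_le[of J, OF step that] .
  define I where "I = \<Union>(range J)"
  have "ideal I R"
  proof (rule additive_idealI)
    show "I \<subseteq> carrier R" using frob_mapsD(1) c(1) by (auto simp: I_def J_def)
    have "(\<lambda>x. \<zero> \<otimes> x) \<in> frob_maps R p 0"
      using frob_map_postmult[OF frob_map_id zero_closed] .
    then have "\<zero> \<otimes> c \<in> J 0" by (rule JI)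
    then show "\<zero> \<in> I" using c(1) by (auto simp: I_def)
    fix x y assume "x \<in> I" "y \<in> I"
    then obtain e e' where e: "x \<in> J e" "y \<in> J e'" by (auto simp: I_def)
    then have "x \<in> J (max e e')" "y \<in> J (max e e')"
      using mono[of e "max e e'"] mono[of e' "max e e'"] by auto
    then obtain h g where h: "h \<in> frob_maps R p (max e e')" "x = h c"
      and g: "g \<in> frob_maps R p (max e e')" "y = g c" unfolding J_def by blast
    have "x \<oplus> y \<in> J (max e e')"
      using JI[OF frob_map_add[OF h(1) g(1)]] h(2) g(2) by simp
    then show "x \<oplus> y \<in> I" by (auto simp: I_def)
  next
    fix r x assume r: "r \<in> carrier R" and "x \<in> I"
    then obtain e h where h: "h \<in> frob_maps R p e" "x = h c" by (auto simp: I_def J_def)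
    then show "r \<otimes> x \<in> I" using JI[OF frob_map_postmult[OF h(1) r]] by (auto simp: I_def)
  qed
  moreover have "\<one> \<notin> I"
  proof
    assume "\<one> \<in> I"
    then obtain e where "\<one> \<in> J e" by (auto simp: I_def)
    then have "\<one> \<in> J (Suc e)" using step by blast
    then obtain h where "h \<in> frob_maps R p (Suc e)" "h c = \<one>" unfolding J_def by force
    then show False using nosplit[of "Suc e" h] by simp
  qed
  moreover have "I \<noteq> {\<zero>}"
  proof -
    have "c \<in> I" using JI[OF frob_map_id] by (auto simp: I_def)
    then show ?thesis using c(2) by blast
  qed
  moreover have "frob_stable p R I"
    unfolding frob_stable_def
  proof (intro allI ballI impI image_subsetI)
    fix e h x assume h: "h \<in> frob_maps R p e" and "x \<in> I"
    then obtain e' g where g: "g \<in> frob_maps R p e'" "x = g c" by (auto simp: I_def J_def)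
    then show "h x \<in> I" using JI[OF frob_map_comp[OF h g(1)]] by (auto simp: I_def)
  qed
  ultimately show ?thesis by blast
next
  case False
  define I where "I = {h x | h x. h \<in> frob_maps R p 1 \<and> x \<in> carrier R}"
  have "I = {h \<one> | h. h \<in> frob_maps R p 1}"
  proof -
    have "\<exists>g\<in>frob_maps R p 1. h x = g \<one>" if "h \<in> frob_maps R p 1" "x \<in> carrier R" for h x
      using frob_map_premult[OF that] that(2) by (intro bexI[of _ "\<lambda>y. h (x \<otimes> y)"]) simp_all
    then show ?thesis unfolding I_def using one_closed by blast
  qed
  note I_one = this
  have II: "h \<one> \<in> I" if "h \<in> frob_maps R p 1" for h using that one_closed unfolding I_def by blast
  have Ic: "I \<subseteq> carrier R" using frob_mapsD(1) by (auto simp: I_def)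
  have id: "ideal I R"
  proof (rule additive_idealI[OF Ic])
    have "(\<lambda>x. \<zero>) \<in> frob_maps R p 1" by (simp add: frob_maps_iff)
    from II[OF this] show "\<zero> \<in> I" .
    fix x y assume "x \<in> I" "y \<in> I"
    then obtain h g where h: "h \<in> frob_maps R p 1" "x = h \<one>" and g: "g \<in> frob_maps R p 1" "y = g \<one>"
      unfolding I_one by blast
    then show "x \<oplus> y \<in> I" using II[OF frob_map_add[OF h(1) g(1)]] by simp
  next
    fix r x assume r: "r \<in> carrier R" and "x \<in> I"
    then obtain h where h: "h \<in> frob_maps R p 1" "x = h \<one>" unfolding I_one by blast
    then show "r \<otimes> x \<in> I" using II[OF frob_map_postmult[OF h(1) r]] by simp
  qed
  have vals: "h x \<in> I" if e: "e > 0" and h: "h \<in> frob_maps R p e" and x: "x \<in> carrier R" for e h x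
  proof -
    obtain e' where e': "e = Suc e'" using e by (metis gr0_implies_Suc)
    from II[OF frob_map_restrict[OF h[unfolded e'] x]] show ?thesis using x by simp
  qed
  have one: "\<one> \<notin> I"
  proof
    assume "\<one> \<in> I"
    then obtain h x where "h \<in> frob_maps R p 1" "x \<in> carrier R" "h x = \<one>"
      unfolding I_def by force
    with False show False by blast
  qed
  show ?thesis
  proof (cases "I = {\<zero>}")
    case False
    moreover have "frob_stable p R I"
      unfolding frob_stable_def using vals Ic by blast
    ultimately show ?thesis using id one by blast
  next
    case I0: True
    have notfield: "\<not> field R" using field_frob_split[OF _ c] nosplit[of 1] by auto
    interpret domain R by fact
    have nz: "carrier R \<noteq> {\<zero>}" using one_not_zero one_closed by blast
    have "\<exists>J. ideal J R \<and> J \<noteq> {\<zero>} \<and> J \<noteq> carrier R"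
    proof (rule ccontr)
      assume none: "\<not> ?thesis"
      have "{J. ideal J R} = {{\<zero>}, carrier R}"
      proof
        show "{J. ideal J R} \<subseteq> {{\<zero>}, carrier R}" using none by blast
        show "{{\<zero>}, carrier R} \<subseteq> {J. ideal J R}" using zeroideal oneideal by simp
      qed
      with notfield show False using trivialideals_eq_field[OF nz] by simp
    qed
    then obtain J where J: "ideal J R" "J \<noteq> {\<zero>}" "J \<noteq> carrier R" by blast
    interpret J: ideal J R by (rule J(1))
    have "frob_stable p R J"
      unfolding frob_stable_def
    proof (intro allI ballI impI image_subsetI)
      fix e h x assume "e > 0" "h \<in> frob_maps R p e" "x \<in> J"
      then have "h x \<in> I" using J.Icarr by (intro vals)
      then show "h x \<in> J" using I0 J.zero_closed by simp
    qed
    moreover have "\<one> \<notin> J" using J(3) J.one_imp_carrier by metis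
    ultimately show ?thesis using J(1,2) by metis
  qed
qed

end

section \<open>Lifting stable primes to centers\<close>

text \<open>An associated prime of a stable ideal is stable: if \<open>x b \<in> J\<close>, then \<open>b h(x)\<close>, being the value of
  \<open>h\<close> at the product of \<open>x\<close> with the \<open>p ^ e\<close>-th power of \<open>b\<close>, lies in \<open>J\<close> as well.\<close>

lemma prime_of_stable_ideal:
  fixes A :: "('a, 'm) ring_scheme" (structure)
  assumes "prime_char_ring A p" "noetherian_ring A" and J: "ideal J A" "\<one> \<notin> J" "J \<noteq> {\<zero>}" "frob_stable p A J"
  obtains q where "primeideal q A" "q \<noteq> {\<zero>}" "frob_stable p A q"
proof -
  interpret prime_char_ring A p by fact
  interpret J: ideal J A by (rule J(1))
  interpret S: mult_subset A "{\<one>}" by unfold_locales auto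
  have disj: "{\<one>} \<inter> J = {}" using J(2) by blast
  obtain b where b: "b \<in> carrier A"
    and q': "primeideal {x \<in> carrier A. \<exists>s\<in>{\<one>}. s \<otimes> (x \<otimes> b) \<in> J} A"
    by (rule S.exists_prime_colon[OF \<open>noetherian_ring A\<close> J(1) disj])
  define q where "q = {x \<in> carrier A. x \<otimes> b \<in> J}"
  have "{x \<in> carrier A. \<exists>s\<in>{\<one>}. s \<otimes> (x \<otimes> b) \<in> J} = q"
    using b by (auto simp: q_def)
  then have q: "primeideal q A" using q' by simp
  have "J \<subseteq> q" using b J.Icarr J.I_r_closed by (auto simp: q_def)
  moreover obtain x where "x \<in> J" "x \<noteq> \<zero>" using J(3) J.zero_closed by blast
  ultimately have "q \<noteq> {\<zero>}" by blast
  moreover have "frob_stable p A q"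
    unfolding frob_stable_def
  proof (intro allI ballI impI image_subsetI)
    fix e h x assume e: "e > 0" and h: "h \<in> frob_maps A p e" and x: "x \<in> q"
    have xc: "x \<in> carrier A" and xb: "x \<otimes> b \<in> J" using x by (simp_all add: q_def)
    obtain k where k: "p ^ e = Suc k" using q_pos[of e] by (metis gr0_implies_Suc)
    have "b [^] (p ^ e) \<otimes> x = b [^] k \<otimes> (x \<otimes> b)"
      unfolding k using b xc by (simp add: m_ac)
    also have "\<dots> \<in> J" using b by (intro J.I_l_closed[OF xb]) simp
    finally have "h (b [^] (p ^ e) \<otimes> x) \<in> J" using J(4) e h by (auto simp: frob_stable_def)
    then have "h x \<otimes> b \<in> J"
      using frob_mapsD(3)[OF h b xc] frob_mapsD(1)[OF h xc] b by (simp add: m_comm)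
    then show "h x \<in> q" using frob_mapsD(1)[OF h xc] by (simp add: q_def)
  qed
  ultimately show ?thesis using q that by blast
qed

text \<open>Let \<open>Q\<close> be the preimage of the stable prime. A map \<open>\<phi>\<close> near \<open>Q\<close> that splits off \<open>f a\<close>, with \<open>f\<close>
  in the maximal ideal at \<open>Q\<close>, becomes by precomposition with \<open>a\<close> a semilinear map \<open>\<psi>\<close> on \<open>R\<close> with
  values in the local ring at \<open>Q\<close>. As \<open>R\<close> has finitely many generators over its powers, a multiple
  \<open>s \<psi>\<close> with \<open>s \<notin> Q\<close> has values in the image of \<open>R\<close>, and compatibility with \<open>P\<close> turns it into a
  Frobenius-linear map \<open>\<chi>\<close> on \<open>R / P\<close>. That map sends an element of the stable prime to the class of
  a product of two elements outside \<open>Q\<close>.\<close>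

lemma center_of_stable_prime:
  fixes R :: "('a, 'm) ring_scheme" (structure)
  assumes triple: "triple p R \<Delta> \<aa>" and center: "center_of_sharp_F_purity p R \<Delta> \<aa> P"
    and q: "primeideal q (R Quot P)" "frob_stable p (R Quot P) q"
  shows "center_of_sharp_F_purity p R \<Delta> \<aa> {r \<in> carrier R. P +> r \<in> q}"
proof -
  define Q where "Q = {r \<in> carrier R. P +> r \<in> q}"
  have P: "primeideal P R" using center by (simp add: center_of_sharp_F_purity_def)
  have ff: "F_finite_ring p R" and eff: "effective \<Delta>" using triple by (simp_all add: triple_def)
  have noeth: "noetherian_ring R" using ff by (simp add: F_finite_ring_def)
  interpret prime_char_ring R p by (rule F_finite_prime_char[OF ff])
  interpret P: primeideal P R by (rule P)
  have ffA: "F_finite_ring p (R Quot P)" by (rule F_finite_quotient[OF ff P])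
  interpret B: prime_char_ring "R Quot P" p by (rule F_finite_prime_char[OF ffA])
  interpret h: ring_hom_cring R "R Quot P" "(+>) P" by (rule P.rcos_ring_hom_cring)
  interpret q: primeideal q "R Quot P" by (rule q(1))
  have h_pow: "P +> (r [^] n) = (P +> r) [^]\<^bsub>R Quot P\<^esub> n" if "r \<in> carrier R" for r and n :: nat
    using that by (induction n) auto
  have coset_eq: "P +> a = P +> b \<longleftrightarrow> a \<ominus> b \<in> P" if "a \<in> carrier R" "b \<in> carrier R" for a b
    using quotient_eq_iff_same_a_r_cos[OF P.ideal_axioms that] by simp
  have Qp: "primeideal Q R"
  proof (rule primeidealI)
    have "ring_hom_ring R (R Quot P) ((+>) P)" by (rule P.rcos_ring_hom_ring)
    then show "ideal Q R" unfolding Q_def by (rule ring_hom_ring.ideal_vimage) (rule q.ideal_axioms)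
    show "cring R" by (rule is_cring)
    have "\<one> \<notin> Q" using q.one_imp_carrier q.I_notcarr by (auto simp: Q_def)
    then show "carrier R \<noteq> Q" using one_closed by blast
    fix a b assume ab: "a \<in> carrier R" "b \<in> carrier R" "a \<otimes> b \<in> Q"
    then have "(P +> a) \<otimes>\<^bsub>R Quot P\<^esub> (P +> b) \<in> q" by (simp add: Q_def)
    then show "a \<in> Q \<or> b \<in> Q"
      using q.I_prime[OF h.hom_closed[OF ab(1)] h.hom_closed[OF ab(2)]] ab(1,2) unfolding Q_def by blast
  qed
  have PQ: "P \<subseteq> Q"
  proof
    fix x assume x: "x \<in> P"
    then have "P +> x = \<zero>\<^bsub>R Quot P\<^esub>" by (rule quot_coset_zero[OF P.ideal_axioms])
    then show "x \<in> Q" using x P.Icarr q.zero_closed by (simp add: Q_def)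
  qed
  interpret Q: prime_localization R Q by (rule prime_localizationI[OF is_cring Qp])
  have U: "has_uniformizers R" if "\<Delta> \<noteq> (\<lambda>_. 0)"
    using that triple normal_has_uniformizers[OF noeth] by (simp add: triple_def)
  have False if f: "f \<in> max_ideal_at R Q" and e: "e > 0" and a: "a \<in> \<aa> (p ^ e - 1)"
    and split: "splits_at Q.A (frob_push p e Q.A (center_sections R Q \<Delta> (p ^ e - 1)))
      (to_tot_frac Q.A (f \<otimes>\<^bsub>Q.A\<^esub> Q.\<iota> a))" for f e a
  proof -
    have "ideal (\<aa> (p ^ e - 1)) R" using triple by (simp add: triple_def graded_system_def)
    then have ac: "a \<in> carrier R" using a ideal.Icarr by metis
    obtain x t where x: "x \<in> Q" "t \<in> carrier R - Q" "f = loc_frac R (carrier R - Q) x t"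
      by (rule max_ideal_at_cases[OF Qp f])
    have xc: "x \<in> carrier R" using x(1) by (rule Q.P.Icarr)
    have tc: "t \<in> carrier R" using x(2) by simp
    have fc: "f \<in> carrier Q.A" unfolding x(3) using xc x(2) by simp
    have tf: "Q.\<iota> t \<otimes>\<^bsub>Q.A\<^esub> f = Q.\<iota> x" unfolding x(3) by (rule Q.S.frac_cancel[OF xc x(2)])
    let ?M = "center_sections R Q \<Delta> (p ^ e - 1)"
    let ?k = "\<lambda>r. to_tot_frac Q.A r"
    note closed = Q.center_sections_closed[OF eff U, where k = "p ^ e - 1"]
    have sec: "?k r \<in> carrier ?M" if "r \<in> carrier Q.A" for r using that by (intro closed(2)) auto
    define v where "v = ?k (f \<otimes>\<^bsub>Q.A\<^esub> Q.\<iota> a)"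
    obtain \<phi> where \<phi>: "\<phi> \<in> linear_maps Q.A (frob_push p e Q.A ?M) (self_module Q.A)"
      and \<phi>v: "\<forall>r\<in>carrier Q.A. \<phi> (r \<odot>\<^bsub>frob_push p e Q.A ?M\<^esub> v) = r"
      using split unfolding splits_at_def v_def by blast
    have \<phi>c: "\<And>g. g \<in> carrier ?M \<Longrightarrow> \<phi> g \<in> carrier Q.A"
      and \<phi>_add: "\<And>g g'. g \<in> carrier ?M \<Longrightarrow> g' \<in> carrier ?M \<Longrightarrow> \<phi> (g \<oplus>\<^bsub>tot_frac Q.A\<^esub> g') = \<phi> g \<oplus>\<^bsub>Q.A\<^esub> \<phi> g'"
      and \<phi>_smult: "\<And>r g. r \<in> carrier Q.A \<Longrightarrow> g \<in> carrier ?M \<Longrightarrow>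
        \<phi> (?k (r [^]\<^bsub>Q.A\<^esub> (p ^ e)) \<otimes>\<^bsub>tot_frac Q.A\<^esub> g) = r \<otimes>\<^bsub>Q.A\<^esub> \<phi> g"
      using \<phi> unfolding frob_linear_maps_iff by blast+
    have \<phi>v': "\<phi> (?k (r [^]\<^bsub>Q.A\<^esub> (p ^ e)) \<otimes>\<^bsub>tot_frac Q.A\<^esub> v) = r" if "r \<in> carrier Q.A" for r
      using \<phi>v that by (simp add: div_sections_simps)
    define \<psi> where "\<psi> r = \<phi> (?k (Q.\<iota> (r \<otimes> a)))" for r
    have mem: "?k (Q.\<iota> (r \<otimes> a)) \<in> carrier ?M" if "r \<in> carrier R" for r
      using that ac by (intro sec) simp
    have \<psi>c: "\<psi> r \<in> carrier Q.A" if "r \<in> carrier R" for r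
      unfolding \<psi>_def using that by (intro \<phi>c mem)
    have \<psi>_add: "\<psi> (r \<oplus> r') = \<psi> r \<oplus>\<^bsub>Q.A\<^esub> \<psi> r'" if "r \<in> carrier R" "r' \<in> carrier R" for r r'
    proof -
      have "?k (Q.\<iota> ((r \<oplus> r') \<otimes> a)) = ?k (Q.\<iota> (r \<otimes> a)) \<oplus>\<^bsub>tot_frac Q.A\<^esub> ?k (Q.\<iota> (r' \<otimes> a))"
        using that ac by (simp add: l_distr)
      then show ?thesis unfolding \<psi>_def using \<phi>_add[OF mem[OF that(1)] mem[OF that(2)]] by argo
    qed
    have \<psi>_smult: "\<psi> (r [^] (p ^ e) \<otimes> r') = Q.\<iota> r \<otimes>\<^bsub>Q.A\<^esub> \<psi> r'"
      if "r \<in> carrier R" "r' \<in> carrier R" for r r'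
    proof -
      have "?k (Q.\<iota> (r [^] (p ^ e) \<otimes> r' \<otimes> a))
        = ?k (Q.\<iota> r [^]\<^bsub>Q.A\<^esub> (p ^ e)) \<otimes>\<^bsub>tot_frac Q.A\<^esub> ?k (Q.\<iota> (r' \<otimes> a))"
        using that ac by (simp add: Q.S.loc_map_pow m_assoc)
      then show ?thesis
        unfolding \<psi>_def using \<phi>_smult[OF Q.S.loc_map.hom_closed[OF that(1)] mem[OF that(2)]] by argo
    qed
    obtain T where T: "power_generators R (p ^ e) T"
      using ff fin_gen_iff_power_generators exists_power_generators by (auto simp: F_finite_ring_def)
    have fT: "finite T" and Tc: "T \<subseteq> carrier R" using T by (simp_all add: power_generators_def)
    have "\<exists>s\<in>carrier R - Q. \<forall>t\<in>T. \<exists>y\<in>carrier R. Q.\<iota> s \<otimes>\<^bsub>Q.A\<^esub> \<psi> t = Q.\<iota> y"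
      using fT Tc
    proof (induction T)
      case empty then show ?case using Q.S.one_S by blast
    next
      case (insert u T)
      then obtain s where s: "s \<in> carrier R - Q" "\<forall>t\<in>T. \<exists>y\<in>carrier R. Q.\<iota> s \<otimes>\<^bsub>Q.A\<^esub> \<psi> t = Q.\<iota> y"
        by blast
      have uc: "u \<in> carrier R" using insert.prems by blast
      obtain y s' where y: "y \<in> carrier R" "s' \<in> carrier R - Q" "\<psi> u = loc_frac R (carrier R - Q) y s'"
        using \<psi>c[OF uc] by (rule Q.S.loc_cases)
      have su: "Q.\<iota> s' \<otimes>\<^bsub>Q.A\<^esub> \<psi> u = Q.\<iota> y" unfolding y(3) by (rule Q.S.frac_cancel[OF y(1,2)])
      have sc: "s \<in> carrier R" "s' \<in> carrier R" using s(1) y(2) by auto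
      have "\<exists>y\<in>carrier R. Q.\<iota> (s \<otimes> s') \<otimes>\<^bsub>Q.A\<^esub> \<psi> t = Q.\<iota> y" if t: "t \<in> insert u T" for t
      proof (cases "t = u")
        case True
        have "Q.\<iota> (s \<otimes> s') \<otimes>\<^bsub>Q.A\<^esub> \<psi> t = Q.\<iota> s \<otimes>\<^bsub>Q.A\<^esub> (Q.\<iota> s' \<otimes>\<^bsub>Q.A\<^esub> \<psi> u)"
          unfolding True using sc \<psi>c[OF uc] by (simp add: Q.S.L.m_assoc)
        also have "\<dots> = Q.\<iota> (s \<otimes> y)" unfolding su using sc y(1) by simp
        finally show ?thesis using sc y(1) by blast
      next
        case False
        then have tT: "t \<in> T" and t': "t \<in> carrier R" using t insert.prems by auto
        obtain z where z: "z \<in> carrier R" "Q.\<iota> s \<otimes>\<^bsub>Q.A\<^esub> \<psi> t = Q.\<iota> z" using s(2) tT by blast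
        have "Q.\<iota> (s \<otimes> s') \<otimes>\<^bsub>Q.A\<^esub> \<psi> t = Q.\<iota> s' \<otimes>\<^bsub>Q.A\<^esub> (Q.\<iota> s \<otimes>\<^bsub>Q.A\<^esub> \<psi> t)"
          using sc \<psi>c[OF t'] by (simp add: Q.S.L.m_ac)
        also have "\<dots> = Q.\<iota> (s' \<otimes> z)" unfolding z(2) using sc z(1) by simp
        finally show ?thesis using sc z(1) by blast
      qed
      then show ?case using Q.S.mult_S[OF s(1) y(2)] by blast
    qed
    then obtain s where s: "s \<in> carrier R - Q" "\<And>t. t \<in> T \<Longrightarrow> \<exists>y\<in>carrier R. Q.\<iota> s \<otimes>\<^bsub>Q.A\<^esub> \<psi> t = Q.\<iota> y"
      by blast
    have sc: "s \<in> carrier R" using s(1) by simp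
    define rel where "rel r y \<longleftrightarrow> r \<in> carrier R \<and> y \<in> carrier R \<and> Q.\<iota> s \<otimes>\<^bsub>Q.A\<^esub> \<psi> r = Q.\<iota> y" for r y
    have rel_add: "rel (r \<oplus> r') (y \<oplus> y')" if "rel r y" "rel r' y'" for r r' y y'
    proof -
      have c: "r \<in> carrier R" "r' \<in> carrier R" "y \<in> carrier R" "y' \<in> carrier R"
        using that by (simp_all add: rel_def)
      have "Q.\<iota> s \<otimes>\<^bsub>Q.A\<^esub> \<psi> (r \<oplus> r') = Q.\<iota> s \<otimes>\<^bsub>Q.A\<^esub> \<psi> r \<oplus>\<^bsub>Q.A\<^esub> Q.\<iota> s \<otimes>\<^bsub>Q.A\<^esub> \<psi> r'"
        using c \<psi>c sc by (simp add: \<psi>_add Q.S.L.r_distr)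
      then show ?thesis using that c by (simp add: rel_def)
    qed
    have rel_smult: "rel (r0 [^] (p ^ e) \<otimes> r) (r0 \<otimes> y)" if "rel r y" "r0 \<in> carrier R" for r0 r y
    proof -
      have c: "r \<in> carrier R" "y \<in> carrier R" using that by (simp_all add: rel_def)
      have "Q.\<iota> s \<otimes>\<^bsub>Q.A\<^esub> \<psi> (r0 [^] (p ^ e) \<otimes> r) = Q.\<iota> r0 \<otimes>\<^bsub>Q.A\<^esub> (Q.\<iota> s \<otimes>\<^bsub>Q.A\<^esub> \<psi> r)"
        using c \<psi>c sc that(2) by (simp add: \<psi>_smult Q.S.L.m_lcomm)
      then show ?thesis using that c by (simp add: rel_def)
    qed
    have "carrier R \<subseteq> {r. \<exists>y. rel r y}"
    proof (rule power_generatorsD[OF T])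
      have "\<psi> \<zero> = \<psi> (\<zero> [^] (p ^ e) \<otimes> \<zero>)" by simp
      also have "\<dots> = \<zero>\<^bsub>Q.A\<^esub>" using \<psi>_smult[of \<zero> \<zero>] \<psi>c[of \<zero>] by simp
      finally have "rel \<zero> \<zero>" using sc by (simp add: rel_def)
      then show "\<zero> \<in> {r. \<exists>y. rel r y}" by blast
    next
      fix r r' assume "r \<in> {r. \<exists>y. rel r y}" "r' \<in> {r. \<exists>y. rel r y}"
      then show "r \<oplus> r' \<in> {r. \<exists>y. rel r y}" using rel_add by blast
    next
      fix r u assume r: "r \<in> carrier R" and u: "u \<in> T"
      obtain y where "rel u y" using s(2)[OF u] u Tc by (auto simp: rel_def)
      then show "r [^] (p ^ e) \<otimes> u \<in> {r. \<exists>y. rel r y}" using rel_smult[OF _ r] by blast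
    qed
    then have rel_ex: "\<exists>y. rel r y" if "r \<in> carrier R" for r using that by blast
    have rel_P: "y \<in> P" if r: "r \<in> P" and y: "rel r y" for r y
    proof -
      have c: "r \<in> carrier R" "y \<in> carrier R" and eq: "Q.\<iota> s \<otimes>\<^bsub>Q.A\<^esub> \<psi> r = Q.\<iota> y"
        using y by (simp_all add: rel_def)
      have fr: "loc_frac R (carrier R - Q) y s \<in> carrier Q.A" using c s(1) by simp
      have "Q.\<iota> s \<otimes>\<^bsub>Q.A\<^esub> \<psi> r = Q.\<iota> s \<otimes>\<^bsub>Q.A\<^esub> loc_frac R (carrier R - Q) y s"
        unfolding eq Q.S.frac_cancel[OF c(2) s(1)] ..
      then have "\<psi> r = loc_frac R (carrier R - Q) y s"
        using Q.S.L.Units_l_cancel[OF Q.S.loc_map_Units[OF s(1)] \<psi>c[OF c(1)] fr] by blast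
      then show ?thesis
        using center_compatible[OF triple center Qp PQ e a \<phi> r c(2) s(1)] by (simp only: \<psi>_def)
    qed
    have rel_minus: "rel (\<ominus> r) (\<ominus> y)" if "rel r y" for r y
    proof -
      have c: "r \<in> carrier R" "y \<in> carrier R" using that by (simp_all add: rel_def)
      have "(\<ominus> \<one>) [^] (p ^ e) \<otimes> r = \<ominus> r" using c by (simp add: frobenius_minus l_minus)
      moreover have "\<ominus> \<one> \<otimes> y = \<ominus> y" using c by (simp add: l_minus)
      ultimately show ?thesis using rel_smult[OF that, of "\<ominus> \<one>"] by simp
    qed
    have rel_cong: "P +> y = P +> y'" if "rel r y" "rel r' y'" "P +> r = P +> r'" for r r' y y'
    proof -
      have c: "r \<in> carrier R" "r' \<in> carrier R" "y \<in> carrier R" "y' \<in> carrier R"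
        using that by (simp_all add: rel_def)
      have "r \<oplus> \<ominus> r' \<in> P" using that(3) coset_eq[OF c(1,2)] by (simp add: a_minus_def)
      then have "y \<oplus> \<ominus> y' \<in> P" using rel_add[OF that(1) rel_minus[OF that(2)]] by (rule rel_P)
      then show ?thesis using coset_eq[OF c(3,4)] by (simp add: a_minus_def)
    qed
    define \<chi> where "\<chi> X = (THE Y. \<exists>r y. rel r y \<and> X = P +> r \<and> Y = P +> y)" for X
    have \<chi>: "\<chi> (P +> r) = P +> y" if "rel r y" for r y
      unfolding \<chi>_def
    proof (rule the_equality)
      show "\<exists>r' y'. rel r' y' \<and> P +> r = P +> r' \<and> P +> y = P +> y'" using that by blast
      fix Y assume "\<exists>r' y'. rel r' y' \<and> P +> r = P +> r' \<and> Y = P +> y'"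
      then show "Y = P +> y" using rel_cong that by metis
    qed
    have "\<chi> \<in> frob_maps (R Quot P) p e"
      unfolding B.frob_maps_iff
    proof (intro conjI ballI)
      fix X assume "X \<in> carrier (R Quot P)"
      then obtain r y where "X = P +> r" "rel r y" using quot_carrier rel_ex by metis
      moreover then have "y \<in> carrier R" by (simp add: rel_def)
      ultimately show "\<chi> X \<in> carrier (R Quot P)" by (simp add: \<chi>)
    next
      fix X Y assume "X \<in> carrier (R Quot P)" "Y \<in> carrier (R Quot P)"
      then obtain r y r' y' where X: "X = P +> r" "rel r y" and Y: "Y = P +> r'" "rel r' y'"
        using quot_carrier rel_ex by metis
      then have c: "r \<in> carrier R" "r' \<in> carrier R" "y \<in> carrier R" "y' \<in> carrier R"
        by (simp_all add: rel_def)
      have "X \<oplus>\<^bsub>R Quot P\<^esub> Y = P +> (r \<oplus> r')" using X(1) Y(1) c by simp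
      then show "\<chi> (X \<oplus>\<^bsub>R Quot P\<^esub> Y) = \<chi> X \<oplus>\<^bsub>R Quot P\<^esub> \<chi> Y"
        using \<chi>[OF rel_add[OF X(2) Y(2)]] \<chi>[OF X(2)] \<chi>[OF Y(2)] X(1) Y(1) c by simp
    next
      fix Z X assume "Z \<in> carrier (R Quot P)" "X \<in> carrier (R Quot P)"
      then obtain r0 r y where Z: "Z = P +> r0" "r0 \<in> carrier R" and X: "X = P +> r" "rel r y"
        using quot_carrier rel_ex by metis
      then have c: "r \<in> carrier R" "y \<in> carrier R" by (simp_all add: rel_def)
      have "Z [^]\<^bsub>R Quot P\<^esub> (p ^ e) \<otimes>\<^bsub>R Quot P\<^esub> X = P +> (r0 [^] (p ^ e) \<otimes> r)"
        using X(1) Z c by (simp add: h_pow)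
      then show "\<chi> (Z [^]\<^bsub>R Quot P\<^esub> (p ^ e) \<otimes>\<^bsub>R Quot P\<^esub> X) = Z \<otimes>\<^bsub>R Quot P\<^esub> \<chi> X"
        using \<chi>[OF rel_smult[OF X(2) Z(2)]] \<chi>[OF X(2)] X(1) Z c by simp
    qed
    then have stable: "\<chi> X \<in> q" if "X \<in> q" for X using q(2) e that by (auto simp: frob_stable_def)
    obtain k where k: "p ^ e = Suc k" using q_pos[of e] by (metis gr0_implies_Suc)
    (* The numerator of t ^ (p ^ e) f: here \<psi> takes the value t, because \<phi> is 1 at f a. *)
    define x' where "x' = t [^] k \<otimes> x"
    have x'c: "x' \<in> carrier R" using xc tc by (simp add: x'_def)
    have "Q.\<iota> (x' \<otimes> a) = Q.\<iota> t [^]\<^bsub>Q.A\<^esub> k \<otimes>\<^bsub>Q.A\<^esub> (Q.\<iota> t \<otimes>\<^bsub>Q.A\<^esub> f) \<otimes>\<^bsub>Q.A\<^esub> Q.\<iota> a"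
      unfolding tf x'_def using xc tc ac by (simp add: Q.S.loc_map_pow)
    also have "\<dots> = Q.\<iota> t [^]\<^bsub>Q.A\<^esub> (p ^ e) \<otimes>\<^bsub>Q.A\<^esub> (f \<otimes>\<^bsub>Q.A\<^esub> Q.\<iota> a)"
      unfolding k using tc fc ac by (simp add: Q.S.L.m_assoc)
    finally have "?k (Q.\<iota> (x' \<otimes> a)) = ?k (Q.\<iota> t [^]\<^bsub>Q.A\<^esub> (p ^ e)) \<otimes>\<^bsub>tot_frac Q.A\<^esub> v"
      unfolding v_def using tc fc ac by simp
    then have "\<psi> x' = Q.\<iota> t" unfolding \<psi>_def using \<phi>v'[of "Q.\<iota> t"] tc by simp
    then have "rel x' (s \<otimes> t)" using x'c sc tc by (simp add: rel_def)
    from \<chi>[OF this] have val: "\<chi> (P +> x') = P +> (s \<otimes> t)" .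
    have "x' \<in> Q" unfolding x'_def using tc x(1) Q.P.I_l_closed by simp
    then have "P +> x' \<in> q" unfolding Q_def by blast
    from stable[OF this] have "P +> (s \<otimes> t) \<in> q" unfolding val .
    moreover have "s \<otimes> t \<in> carrier R" using sc tc by simp
    ultimately have "s \<otimes> t \<in> Q" unfolding Q_def by blast
    then show False using Q.S.mult_S[OF s(1) x(2)] by blast
  qed
  then show ?thesis
    unfolding center_of_sharp_F_purity_def Q_def[symmetric] using Qp by blast
qed

theorem corollary7p8:
  fixes p :: nat
    and R :: "('a, 'm) ring_scheme"
    and \<Delta> :: "'a set \<Rightarrow> real"
    and \<aa> :: "nat \<Rightarrow> 'a set"
    and P :: "'a set"
  assumes "triple p R \<Delta> \<aa>"
    and "center_of_sharp_F_purity p R \<Delta> \<aa> P"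
    and "\<And>Q. center_of_sharp_F_purity p R \<Delta> \<aa> Q \<Longrightarrow> P \<subseteq> Q \<Longrightarrow> Q = P"
  shows "strongly_F_regular p (R Quot P)"
proof (rule ccontr)
  assume not_regular: "\<not> strongly_F_regular p (R Quot P)"
  have P: "primeideal P R" using assms(2) by (simp add: center_of_sharp_F_purity_def)
  have ff: "F_finite_ring p R" using assms(1) by (simp add: triple_def)
  have ffA: "F_finite_ring p (R Quot P)" by (rule F_finite_quotient[OF ff P])
  interpret P: primeideal P R by (rule P)
  interpret A: prime_char_ring "R Quot P" p by (rule F_finite_prime_char[OF ffA])
  interpret AD: domain "R Quot P" by (rule P.quotient_is_domain)
  have "reduced_ring (R Quot P)"
    unfolding reduced_ring_def
  proof (intro ballI allI impI)
    fix x and n :: nat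
    assume x: "x \<in> carrier (R Quot P)" and "x [^]\<^bsub>R Quot P\<^esub> n = \<zero>\<^bsub>R Quot P\<^esub>"
    moreover have "x [^]\<^bsub>R Quot P\<^esub> n = \<zero>\<^bsub>R Quot P\<^esub> \<Longrightarrow> x = \<zero>\<^bsub>R Quot P\<^esub>" for n :: nat
      using x by (induction n) (auto simp: AD.integral_iff)
    ultimately show "x = \<zero>\<^bsub>R Quot P\<^esub>" by blast
  qed
  then obtain c where c: "c \<in> circ (R Quot P)"
    and nosplit: "\<And>e. e > 0 \<Longrightarrow> \<not> splits_at (R Quot P) (frob_push p e (R Quot P) (self_module (R Quot P))) c"
    using not_regular ffA unfolding strongly_F_regular_def by blast
  have cc: "c \<in> carrier (R Quot P)" using c by (simp add: circ_def)
  have "minimal_prime (R Quot P) {\<zero>\<^bsub>R Quot P\<^esub>}"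
  proof -
    have "Q' = {\<zero>\<^bsub>R Quot P\<^esub>}" if "primeideal Q' (R Quot P)" "Q' \<subseteq> {\<zero>\<^bsub>R Quot P\<^esub>}" for Q'
      using that additive_subgroup.zero_closed[OF ideal.axioms(1)[OF primeideal.axioms(1)[OF that(1)]]]
      by blast
    then show ?thesis using AD.zeroprimeideal by (simp add: minimal_prime_def)
  qed
  then have c0: "c \<noteq> \<zero>\<^bsub>R Quot P\<^esub>" using c unfolding circ_def by blast
  have "\<exists>J. ideal J (R Quot P) \<and> \<one>\<^bsub>R Quot P\<^esub> \<notin> J \<and> J \<noteq> {\<zero>\<^bsub>R Quot P\<^esub>} \<and> frob_stable p (R Quot P) J"
  proof (rule A.exists_stable_ideal[OF AD.domain_axioms cc c0])
    fix e h assume "e > 0" "h \<in> frob_maps (R Quot P) p e"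
    then show "h c \<noteq> \<one>\<^bsub>R Quot P\<^esub>" using nosplit A.splits_at_iff[OF cc] by blast
  qed
  then obtain J where J: "ideal J (R Quot P)" "\<one>\<^bsub>R Quot P\<^esub> \<notin> J" "J \<noteq> {\<zero>\<^bsub>R Quot P\<^esub>}" "frob_stable p (R Quot P) J"
    by blast
  have noeth: "noetherian_ring (R Quot P)" using ffA by (simp add: F_finite_ring_def)
  obtain q where q: "primeideal q (R Quot P)" "q \<noteq> {\<zero>\<^bsub>R Quot P\<^esub>}" "frob_stable p (R Quot P) q"
    by (rule prime_of_stable_ideal[OF A.prime_char_ring_axioms noeth J])
  define Q where "Q = {r \<in> carrier R. P +>\<^bsub>R\<^esub> r \<in> q}"
  have zero: "\<zero>\<^bsub>R Quot P\<^esub> \<in> q"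
    using additive_subgroup.zero_closed[OF ideal.axioms(1)[OF primeideal.axioms(1)[OF q(1)]]] .
  have coset_zero: "P +>\<^bsub>R\<^esub> r = \<zero>\<^bsub>R Quot P\<^esub>" if "r \<in> P" for r
    using that by (rule quot_coset_zero[OF P.ideal_axioms])
  have "P \<subseteq> Q" using coset_zero zero P.Icarr by (auto simp: Q_def)
  moreover have "center_of_sharp_F_purity p R \<Delta> \<aa> Q"
    unfolding Q_def by (rule center_of_stable_prime[OF assms(1,2) q(1,3)])
  ultimately have QP: "Q = P" using assms(3) by blast
  have "X = \<zero>\<^bsub>R Quot P\<^esub>" if X: "X \<in> q" for X
  proof -
    have "X \<in> carrier (R Quot P)" using X ideal.Icarr[OF primeideal.axioms(1)[OF q(1)]] by blast
    then obtain r where r: "r \<in> carrier R" "X = P +>\<^bsub>R\<^esub> r" using quot_carrier by metis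
    then have "r \<in> P" using X QP by (auto simp: Q_def)
    then show ?thesis using r coset_zero by simp
  qed
  then have "q = {\<zero>\<^bsub>R Quot P\<^esub>}" using zero by blast
  with q(2) show False by contradiction
qed

end
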